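(* Let $\hat\varphi:\Lambda\mathsf{Lie}_\infty\to\mathcal O$ be a map of dg operads. Let $\mathrm{Alg}^{\mathrm{MC}}_{\mathcal O}$ be the category of pairs $(V,\alpha)$, where $V$ is an $\mathcal O$-algebra equipped with a complete descending filtration compatible with the $\mathcal O$-algebra structure and $\alpha\in\mathcal F_1V$ is a Maurer–Cartan element; morphisms $(V,\alpha)\to(V',\alpha')$ are morphisms of filtered $\mathcal O$-algebras $f:V\to V'$ with $f(\alpha)=\alpha'$. Then the category $\mathrm{Alg}^{\mathrm{filtr}}_{\mathrm{Tw}\,\mathcal O}$ of filtered $\mathrm{Tw}\,\mathcal O$-algebras is isomorphic to the category $\mathrm{Alg}^{\mathrm{MC}}_{\mathcal O}$.
   Context: **Conventions.** $\mathbb K$ is a field of characteristic zero. A dg operad is a unital symmetric operad in unbounded cochain complexes over $\mathbb K$ (differentials of degree $+1$), with elementary insertions $\circ_i$. $\mathbf s$ raises degree by one. $\mathrm{Sh}_{p,q}\subset S_{p+q}$ is the set of $\sigma$ with $\sigma(1)<\dots<\sigma(p)$ and $\sigma(p+1)<\dots<\sigma(p+q)$. For $v\in\mathcal O(k)$, $w\in\mathcal O(m)$, an expression $v(i_1,\dots,w(j_1,\dots,j_m),\dots)$ in which each of $1,\dots,k+m-1$ occurs once denotes the operadic composite with inputs labelled as displayed. **$\Lambda\mathsf{Lie}_\infty$** is the dg operad free as a graded operad on $S_n$-invariant generators $\lambda_n$, arity $n\ge2$, degree $3-2n$, with $\partial\lambda_n=-\sum_{p=2}^{n-1}\sum_{\sigma\in\mathrm{Sh}_{p,n-p}}\sigma(\lambda_{n-p+1}\circ_1\lambda_p)$.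 **$\mathrm{Tw}\,\mathcal O$.** Put $\varphi_n=\hat\varphi(\lambda_n)$ for $n\ge2$, $\varphi_1=0$. $\mathrm{Tw}\,\mathcal O(n)=\prod_{r\ge0}\mathbf s^{2r}(\mathcal O(r+n))^{S_r}$, where $S_r\subset S_{r+n}$ permutes the first $r$ letters: a homogeneous $f$ is a sequence $(f_r)_{r\ge0}$ with $f_r\in\mathcal O(r+n)^{S_r}$ of degree $|f|-2r$. $S_n$ acts on the last $n$ inputs; the unit is $(u_{\mathcal O},0,0,\dots)$; for $f\in\mathrm{Tw}\,\mathcal O(n)$, $g\in\mathrm{Tw}\,\mathcal O(m)$, $$(f\circ_ig)_r=\sum_{p=0}^r\sum_{\sigma\in\mathrm{Sh}_{p,r-p}}f_p(\sigma(1),\dots,\sigma(p),r+1,\dots,r+i-1,g_{r-p}(\sigma(p+1),\dots,\sigma(r),r+i,\dots,r+i+m-1),r+i+m,\dots,r+n+m-1).$$ With $\kappa\in\mathrm{Tw}\,\mathcal O(1)$, $\kappa_r=\varphi_{r+1}$, the differential is $$(\partial^{\mathrm{Tw}}f)_r=\partial^{\mathcal O}f_r-(-1)^{|f|}\sum_{p=1}^r\sum_{\sigma\in\mathrm{Sh}_{p,r-p}}f_{r-p+1}(\varphi_p(\sigma(1),\dots,\sigma(p)),\sigma(p+1),\dots,\sigma(r),r+1,\dots,r+n)+(\kappa\circ_1f)_r-(-1)^{|f|}\sum_{i=1}^n(f\circ_i\kappa)_r.$$ $\mathrm{Tw}\,\mathcal O$ carries the complete descending filtration $\mathcal F_k\mathrm{Tw}\,\mathcal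 O(n)=\{f:f_r=0\text{ for all }r<k\}$. **Filtrations.** A complete descending filtration on a cochain complex $V$ is a chain of subcomplexes $V=\mathcal F_0V\supset\mathcal F_1V\supset\cdots$ with $V=\lim_kV/\mathcal F_kV$. It is compatible with an $\mathcal O$-algebra structure if every operation maps $\mathcal F_{i_1}V\otimes\dots\otimes\mathcal F_{i_n}V$ into $\mathcal F_{i_1+\dots+i_n}V$. The endomorphism operad $\mathrm{End}_V$ has the induced filtration: $\mathcal F_k\mathrm{End}_V(n)$ consists of the maps sending $\mathcal F_{i_1}V\otimes\dots\otimes\mathcal F_{i_n}V$ into $\mathcal F_{i_1+\dots+i_n+k}V$. A filtered $\mathrm{Tw}\,\mathcal O$-algebra is a cochain complex $V$ with a complete descending filtration and an operad map $\mathrm{Tw}\,\mathcal O\to\mathrm{End}_V$ compatible with the filtrations; morphisms are filtration-preserving morphisms of $\mathrm{Tw}\,\mathcal O$-algebras. A Maurer–Cartan element is a degree $2$ element $\alpha\in\mathcal F_1V$ with $\partial\alpha+\sum_{n\ge2}\frac1{n!}\varphi_n(\alpha,\dots,\alpha)=0$. *)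

theory Defs
  imports Complex_Main "HOL-Library.Function_Algebras" "HOL-Combinatorics.Permutations"
begin

section \<open>Graded linear algebra\<close>

text \<open>A graded vector space over \<open>'k\<close> is a family of subspaces \<open>V d\<close> (\<open>d :: int\<close>) of an ambient vector
  space. The pieces are external: they need not be independent in the ambient space, and every
  structure map receives the degrees of its arguments.\<close>

definition linear_on ::
  "('k::field \<Rightarrow> 'a::ab_group_add \<Rightarrow> 'a) \<Rightarrow> ('k \<Rightarrow> 'b::ab_group_add \<Rightarrow> 'b) \<Rightarrow> 'a set \<Rightarrow> 'b set \<Rightarrow> ('a \<Rightarrow> 'b) \<Rightarrow> bool"
  where "linear_on s t A B f \<longleftrightarrow>
    (\<forall>x\<in>A. f x \<in> B) \<and> (\<forall>x\<in>A. \<forall>y\<in>A. f (x + y) = f x + f y) \<and> (\<forall>c. \<forall>x\<in>A. f (s c x) = t c (f x))"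

definition signed :: "int \<Rightarrow> 'a::ab_group_add \<Rightarrow> 'a"  \<comment> \<open>\<open>(-1)\<close> to the power \<open>k\<close>, times \<open>x\<close>\<close>
  where "signed k x = (if even k then x else - x)"


section \<open>Symmetric operads\<close>

text \<open>\<open>o_car P n d\<close> is the degree \<open>d\<close> part of \<open>P(n)\<close>. For \<open>f\<close> in \<open>o_car P n d\<close> and \<open>g\<close> in \<open>o_car P m e\<close>,
  \<open>o_ins P n d m e i f g\<close> is the insertion of \<open>g\<close> into the \<open>i\<close>-th input of \<open>f\<close> (\<open>1 \<le> i \<le> n\<close>).
  Permutations of \<open>{1..n}\<close> act from the left: \<open>o_act P n d \<sigma> f\<close> is \<open>f(\<sigma>(1),\<dots>,\<sigma>(n))\<close>, that is, \<open>f\<close> with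
  its \<open>j\<close>-th input relabelled \<open>\<sigma>(j)\<close>.\<close>

record ('k, 'o) operad =
  o_scale :: "'k \<Rightarrow> 'o \<Rightarrow> 'o"
  o_car :: "nat \<Rightarrow> int \<Rightarrow> 'o set"
  o_unit :: 'o
  o_ins :: "nat \<Rightarrow> int \<Rightarrow> nat \<Rightarrow> int \<Rightarrow> nat \<Rightarrow> 'o \<Rightarrow> 'o \<Rightarrow> 'o"
  o_act :: "nat \<Rightarrow> int \<Rightarrow> (nat \<Rightarrow> nat) \<Rightarrow> 'o \<Rightarrow> 'o"
  o_diff :: "nat \<Rightarrow> int \<Rightarrow> 'o \<Rightarrow> 'o"

text \<open>Relabelling of the \<open>n + m - 1\<close> inputs of the insertion of \<open>g\<close> into the \<open>i\<close>-th input of \<open>f\<close> that is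
  induced by relabelling the inputs of \<open>f\<close> by \<open>\<sigma>\<close> and those of \<open>g\<close> by \<open>\<tau>\<close>.\<close>

definition block_perm :: "nat \<Rightarrow> nat \<Rightarrow> nat \<Rightarrow> (nat \<Rightarrow> nat) \<Rightarrow> (nat \<Rightarrow> nat) \<Rightarrow> nat \<Rightarrow> nat"
  where "block_perm n m i \<sigma> \<tau> a =
    (let sh = (\<lambda>b. if b < \<sigma> i then b else b + m - 1) in
     if a = 0 \<or> n + m \<le> a then a
     else if a < i then sh (\<sigma> a)
     else if a < i + m then \<sigma> i + \<tau> (a - i + 1) - 1
     else sh (\<sigma> (a + 1 - m)))"

locale graded_operad =
  fixes P :: "('k::field, 'o::ab_group_add) operad"
  assumes vector_space: "vector_space (o_scale P)"
    and subspace: "module.subspace (o_scale P) (o_car P n d)"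
    and unit_closed: "o_unit P \<in> o_car P 1 0"
    and act_linear: "\<sigma> permutes {1..n} \<Longrightarrow>
      linear_on (o_scale P) (o_scale P) (o_car P n d) (o_car P n d) (o_act P n d \<sigma>)"
    and act_id: "f \<in> o_car P n d \<Longrightarrow> o_act P n d id f = f"
    and act_comp: "\<lbrakk>\<sigma> permutes {1..n}; \<tau> permutes {1..n}; f \<in> o_car P n d\<rbrakk> \<Longrightarrow>
      o_act P n d (\<sigma> \<circ> \<tau>) f = o_act P n d \<sigma> (o_act P n d \<tau> f)"
    and ins_linear_left: "\<lbrakk>g \<in> o_car P m e; 1 \<le> i; i \<le> n\<rbrakk> \<Longrightarrow>
      linear_on (o_scale P) (o_scale P) (o_car P n d) (o_car P (n + m - 1) (d + e))
        (\<lambda>f. o_ins P n d m e i f g)"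
    and ins_linear_right: "\<lbrakk>f \<in> o_car P n d; 1 \<le> i; i \<le> n\<rbrakk> \<Longrightarrow>
      linear_on (o_scale P) (o_scale P) (o_car P m e) (o_car P (n + m - 1) (d + e))
        (o_ins P n d m e i f)"
    and ins_unit: "\<lbrakk>f \<in> o_car P n d; 1 \<le> i; i \<le> n\<rbrakk> \<Longrightarrow> o_ins P n d 1 0 i f (o_unit P) = f"
    and unit_ins: "f \<in> o_car P n d \<Longrightarrow> o_ins P 1 0 n d 1 (o_unit P) f = f"
    and equivariance: "\<lbrakk>f \<in> o_car P n d; g \<in> o_car P m e; 1 \<le> i; i \<le> n;
        \<sigma> permutes {1..n}; \<tau> permutes {1..m}\<rbrakk> \<Longrightarrow>
      o_ins P n d m e (\<sigma> i) (o_act P n d \<sigma> f) (o_act P m e \<tau> g) =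
      o_act P (n + m - 1) (d + e) (block_perm n m i \<sigma> \<tau>) (o_ins P n d m e i f g)"
    and sequential_assoc: "\<lbrakk>f \<in> o_car P n d; g \<in> o_car P m e; h \<in> o_car P k c;
        1 \<le> i; i \<le> n; 1 \<le> j; j \<le> m\<rbrakk> \<Longrightarrow>
      o_ins P (n + m - 1) (d + e) k c (i + j - 1) (o_ins P n d m e i f g) h =
      o_ins P n d (m + k - 1) (e + c) i f (o_ins P m e k c j g h)"
    and parallel_assoc: "\<lbrakk>f \<in> o_car P n d; g \<in> o_car P m e; h \<in> o_car P k c;
        1 \<le> i; i < j; j \<le> n\<rbrakk> \<Longrightarrow>
      o_ins P (n + m - 1) (d + e) k c (j + m - 1) (o_ins P n d m e i f g) h =
      signed (e * c) (o_ins P (n + k - 1) (d + c) m e i (o_ins P n d k c j f h) g)"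

locale dg_operad = graded_operad P for P :: "('k::field, 'o::ab_group_add) operad" +
  assumes diff_linear:
      "linear_on (o_scale P) (o_scale P) (o_car P n d) (o_car P n (d + 1)) (o_diff P n d)"
    and diff_diff: "f \<in> o_car P n d \<Longrightarrow> o_diff P n (d + 1) (o_diff P n d f) = 0"
    and diff_act: "\<lbrakk>f \<in> o_car P n d; \<sigma> permutes {1..n}\<rbrakk> \<Longrightarrow>
      o_diff P n d (o_act P n d \<sigma> f) = o_act P n (d + 1) \<sigma> (o_diff P n d f)"
    and diff_ins: "\<lbrakk>f \<in> o_car P n d; g \<in> o_car P m e; 1 \<le> i; i \<le> n\<rbrakk> \<Longrightarrow>
      o_diff P (n + m - 1) (d + e) (o_ins P n d m e i f g) =
      o_ins P n (d + 1) m e i (o_diff P n d f) g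
        + signed d (o_ins P n d m (e + 1) i f (o_diff P m e g))"

locale graded_operad_map =
  fixes P :: "('k::field, 'o::ab_group_add) operad"
    and Q :: "('k, 'q::ab_group_add) operad"
    and h :: "nat \<Rightarrow> int \<Rightarrow> 'o \<Rightarrow> 'q"
  assumes map_linear:
      "linear_on (o_scale P) (o_scale Q) (o_car P n d) (o_car Q n d) (h n d)"
    and map_unit: "h 1 0 (o_unit P) = o_unit Q"
    and map_act: "\<lbrakk>f \<in> o_car P n d; \<sigma> permutes {1..n}\<rbrakk> \<Longrightarrow>
      h n d (o_act P n d \<sigma> f) = o_act Q n d \<sigma> (h n d f)"
    and map_ins: "\<lbrakk>f \<in> o_car P n d; g \<in> o_car P m e; 1 \<le> i; i \<le> n\<rbrakk> \<Longrightarrow>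
      h (n + m - 1) (d + e) (o_ins P n d m e i f g) = o_ins Q n d m e i (h n d f) (h m e g)"

locale dg_operad_map = graded_operad_map P Q h
  for P :: "('k::field, 'o::ab_group_add) operad" and Q :: "('k, 'q::ab_group_add) operad" and h +
  assumes map_diff: "f \<in> o_car P n d \<Longrightarrow> h n (d + 1) (o_diff P n d f) = o_diff Q n d (h n d f)"

definition graded_suboperad ::
  "('k::field, 'o::ab_group_add) operad \<Rightarrow> (nat \<Rightarrow> int \<Rightarrow> 'o set) \<Rightarrow> bool"
  where "graded_suboperad P S \<longleftrightarrow>
    (\<forall>n d. S n d \<subseteq> o_car P n d \<and> module.subspace (o_scale P) (S n d)) \<and>
    o_unit P \<in> S 1 0 \<and>
    (\<forall>n d \<sigma>. \<sigma> permutes {1..n} \<longrightarrow> (\<forall>f\<in>S n d. o_act P n d \<sigma> f \<in> S n d)) \<and>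
    (\<forall>n d m e i. 1 \<le> i \<and> i \<le> n \<longrightarrow>
       (\<forall>f\<in>S n d. \<forall>g\<in>S m e. o_ins P n d m e i f g \<in> S (n + m - 1) (d + e)))"


section \<open>Shuffles, invariant elements and labelled composites\<close>

definition Sh :: "nat \<Rightarrow> nat \<Rightarrow> (nat \<Rightarrow> nat) set"
  where "Sh p q =
    {\<sigma>. \<sigma> permutes {1..p+q} \<and> strict_mono_on {1..p} \<sigma> \<and> strict_mono_on {p+1..p+q} \<sigma>}"

definition o_invariants ::
  "('k::field, 'o::ab_group_add) operad \<Rightarrow> nat \<Rightarrow> nat \<Rightarrow> int \<Rightarrow> 'o set"
  where "o_invariants P r n d = {f \<in> o_car P n d. \<forall>\<sigma>. \<sigma> permutes {1..r} \<longrightarrow> o_act P n d \<sigma> f = f}"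

definition perm_of :: "nat list \<Rightarrow> nat \<Rightarrow> nat"
  where "perm_of ls a = (if 1 \<le> a \<and> a \<le> length ls then ls ! (a - 1) else a)"

text \<open>The composite \<open>v(\<dots>, w(\<dots>), \<dots>)\<close> with \<open>w\<close> in the \<open>i\<close>-th slot of \<open>v\<close>, where \<open>ls\<close> lists the labels of
  the inputs as displayed, read from left to right.\<close>

definition labelled_comp ::
  "('k::field, 'o::ab_group_add) operad \<Rightarrow>
    nat \<Rightarrow> int \<Rightarrow> nat \<Rightarrow> int \<Rightarrow> nat \<Rightarrow> 'o \<Rightarrow> 'o \<Rightarrow> nat list \<Rightarrow> 'o"
  where "labelled_comp P n d m e i v w ls =
    o_act P (n + m - 1) (d + e) (perm_of ls) (o_ins P n d m e i v w)"


section \<open>The operad \<open>\<Lambda>Lie\<^sub>\<infinity>\<close>\<close>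

text \<open>\<open>L\<close> with generators \<open>lam n\<close> is a model of \<open>\<Lambda>Lie\<^sub>\<infinity>\<close>. Freeness as a graded operad is the universal
  property: uniqueness of the induced operad maps is expressed by generation, existence is required
  for test operads \<open>P\<close> living on the type \<open>nat \<Rightarrow> 'k\<close>. Since the free operad has finite-dimensional
  components, it has itself a copy on that type, so that these two conditions determine \<open>L\<close> up to
  isomorphism.\<close>

locale Lambda_Lie_infty = dg_operad L for L :: "('k::field, 'l::ab_group_add) operad" +
  fixes lam :: "nat \<Rightarrow> 'l"
  assumes lam_invariant: "2 \<le> n \<Longrightarrow> lam n \<in> o_invariants L n n (3 - 2 * int n)"
    and diff_lam: "2 \<le> n \<Longrightarrow> o_diff L n (3 - 2 * int n) (lam n) =
      - (\<Sum>p=2..n-1. \<Sum>\<sigma>\<in>Sh p (n - p). o_act L n (4 - 2 * int n) \<sigma>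
           (o_ins L (n - p + 1) (3 - 2 * int (n - p + 1)) p (3 - 2 * int p) 1
              (lam (n - p + 1)) (lam p)))"
    and generated: "\<lbrakk>graded_suboperad L S; \<And>n. 2 \<le> n \<Longrightarrow> lam n \<in> S n (3 - 2 * int n)\<rbrakk> \<Longrightarrow>
      o_car L n d \<subseteq> S n d"
    and free: "\<And>(P :: ('k, nat \<Rightarrow> 'k) operad) a.
      \<lbrakk>graded_operad P; \<And>n. 2 \<le> n \<Longrightarrow> a n \<in> o_invariants P n n (3 - 2 * int n)\<rbrakk> \<Longrightarrow>
      \<exists>h. graded_operad_map L P h \<and> (\<forall>n\<ge>2. h n (3 - 2 * int n) (lam n) = a n)"

definition generator_images :: "(nat \<Rightarrow> int \<Rightarrow> 'l \<Rightarrow> 'o::zero) \<Rightarrow> (nat \<Rightarrow> 'l) \<Rightarrow> nat \<Rightarrow> 'o"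
  where "generator_images \<phi>hat lam n = (if 2 \<le> n then \<phi>hat n (3 - 2 * int n) (lam n) else 0)"


section \<open>The twisted operad\<close>

definition tw_car :: "('k::field, 'o::ab_group_add) operad \<Rightarrow> nat \<Rightarrow> int \<Rightarrow> (nat \<Rightarrow> 'o) set"
  where "tw_car P n d = {f. \<forall>r. f r \<in> o_invariants P r (r + n) (d - 2 * int r)}"

definition tw_unit :: "('k::field, 'o::ab_group_add) operad \<Rightarrow> nat \<Rightarrow> 'o"
  where "tw_unit P r = (if r = 0 then o_unit P else 0)"

definition tw_ins :: "('k::field, 'o::ab_group_add) operad \<Rightarrow>
    nat \<Rightarrow> int \<Rightarrow> nat \<Rightarrow> int \<Rightarrow> nat \<Rightarrow> (nat \<Rightarrow> 'o) \<Rightarrow> (nat \<Rightarrow> 'o) \<Rightarrow> nat \<Rightarrow> 'o"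
  where "tw_ins P n d m e i f g r =
    (\<Sum>p\<le>r. \<Sum>\<sigma>\<in>Sh p (r - p).
       labelled_comp P (p + n) (d - 2 * int p) (r - p + m) (e - 2 * int (r - p)) (p + i)
         (f p) (g (r - p))
         (map \<sigma> [1..<p+1] @ [r+1..<r+i] @
          map \<sigma> [p+1..<r+1] @ [r+i..<r+i+m] @
          [r+i+m..<r+n+m]))"

definition tw_act :: "('k::field, 'o::ab_group_add) operad \<Rightarrow>
    nat \<Rightarrow> int \<Rightarrow> (nat \<Rightarrow> nat) \<Rightarrow> (nat \<Rightarrow> 'o) \<Rightarrow> nat \<Rightarrow> 'o"
  where "tw_act P n d \<sigma> f r =
    o_act P (r + n) (d - 2 * int r) (\<lambda>a. if a \<le> r then a else r + \<sigma> (a - r)) (f r)"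

definition tw_kappa :: "(nat \<Rightarrow> 'o) \<Rightarrow> nat \<Rightarrow> 'o"
  where "tw_kappa \<phi> r = \<phi> (r + 1)"

definition tw_diff :: "('k::field, 'o::ab_group_add) operad \<Rightarrow> (nat \<Rightarrow> 'o) \<Rightarrow>
    nat \<Rightarrow> int \<Rightarrow> (nat \<Rightarrow> 'o) \<Rightarrow> nat \<Rightarrow> 'o"
  where "tw_diff P \<phi> n d f r =
      o_diff P (r + n) (d - 2 * int r) (f r)
    - signed d (\<Sum>p=1..r. \<Sum>\<sigma>\<in>Sh p (r - p).
        labelled_comp P (r - p + 1 + n) (d - 2 * int (r - p + 1)) p (3 - 2 * int p) 1
          (f (r - p + 1)) (\<phi> p)
          (map \<sigma> [1..<p+1] @ map \<sigma> [p+1..<r+1] @ [r+1..<r+n+1]))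
    + tw_ins P 1 1 n d 1 (tw_kappa \<phi>) f r
    - signed d (\<Sum>i=1..n. tw_ins P n d 1 1 i f (tw_kappa \<phi>) r)"

definition Tw :: "('k::field, 'o::ab_group_add) operad \<Rightarrow> (nat \<Rightarrow> 'o) \<Rightarrow> ('k, nat \<Rightarrow> 'o) operad"
  where "Tw P \<phi> =
    \<lparr>o_scale = (\<lambda>c f r. o_scale P c (f r)), o_car = tw_car P, o_unit = tw_unit P,
     o_ins = tw_ins P, o_act = tw_act P, o_diff = tw_diff P \<phi>\<rparr>"

definition tw_filt :: "('k::field, 'o::ab_group_add) operad \<Rightarrow> nat \<Rightarrow> nat \<Rightarrow> int \<Rightarrow> (nat \<Rightarrow> 'o) set"
  where "tw_filt P k n d = {f \<in> tw_car P n d. \<forall>r<k. f r = 0}"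


section \<open>Filtered cochain complexes\<close>

text \<open>Maps are required to vanish outside their domain, so that equality of the HOL functions is
  equality of the maps. The same convention is used for multilinear maps, algebra structures and
  morphisms below.\<close>

record ('k, 'v) cochains =
  c_scale :: "'k \<Rightarrow> 'v \<Rightarrow> 'v"
  c_car :: "int \<Rightarrow> 'v set"
  c_diff :: "int \<Rightarrow> 'v \<Rightarrow> 'v"

record ('k, 'v) filtered_cochains = "('k, 'v) cochains" +
  c_filt :: "nat \<Rightarrow> int \<Rightarrow> 'v set"

locale cochain_complex =
  fixes V :: "('k::field, 'v::ab_group_add, 'z) cochains_scheme"
  assumes vector_space: "vector_space (c_scale V)"
    and subspace: "module.subspace (c_scale V) (c_car V d)"
    and diff_linear: "linear_on (c_scale V) (c_scale V) (c_car V d) (c_car V (d + 1)) (c_diff V d)"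
    and diff_diff: "x \<in> c_car V d \<Longrightarrow> c_diff V (d + 1) (c_diff V d x) = 0"
    and diff_outside: "x \<notin> c_car V d \<Longrightarrow> c_diff V d x = 0"

text \<open>\<open>filt_complete\<close> says that the canonical map from \<open>V\<close> to the limit of the \<open>V / F\<^sub>k V\<close> is bijective
  in each degree; a point of the limit is given by a sequence of representatives \<open>u k\<close>.\<close>

locale complete_filtered_complex = cochain_complex V
  for V :: "('k::field, 'v::ab_group_add, 'z) filtered_cochains_scheme" +
  assumes filt_0: "c_filt V 0 d = c_car V d"
    and filt_descending: "c_filt V (Suc k) d \<subseteq> c_filt V k d"
    and filt_subspace: "module.subspace (c_scale V) (c_filt V k d)"
    and filt_diff: "x \<in> c_filt V k d \<Longrightarrow> c_diff V d x \<in> c_filt V k (d + 1)"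
    and filt_complete: "(\<And>k. u k \<in> c_car V d \<and> u (Suc k) - u k \<in> c_filt V k d) \<Longrightarrow>
      \<exists>!y. y \<in> c_car V d \<and> (\<forall>k. y - u k \<in> c_filt V k d)"


section \<open>The endomorphism operad\<close>

text \<open>A multilinear map takes a list of homogeneous vectors, each paired with its degree.\<close>

definition hvecs :: "('k, 'v, 'z) cochains_scheme \<Rightarrow> nat \<Rightarrow> (int \<times> 'v) list set"
  where "hvecs V n = {xs. length xs = n \<and> (\<forall>(d, x)\<in>set xs. x \<in> c_car V d)}"

definition tdeg :: "(int \<times> 'v) list \<Rightarrow> int"
  where "tdeg xs = sum_list (map fst xs)"

definition end_car ::
  "('k::field, 'v::ab_group_add, 'z) cochains_scheme \<Rightarrow> nat \<Rightarrow> int \<Rightarrow> ((int \<times> 'v) list \<Rightarrow> 'v) set"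
  where "end_car V n d = {f.
    (\<forall>xs\<in>hvecs V n. f xs \<in> c_car V (tdeg xs + d)) \<and>
    (\<forall>xs. xs \<notin> hvecs V n \<longrightarrow> f xs = 0) \<and>
    (\<forall>xs ys e. xs \<in> hvecs V (length xs) \<and> ys \<in> hvecs V (length ys) \<and> length xs + 1 + length ys = n \<longrightarrow>
       linear_on (c_scale V) (c_scale V) (c_car V e) (c_car V (tdeg xs + e + tdeg ys + d))
         (\<lambda>x. f (xs @ (e, x) # ys)))}"

definition end_unit :: "('k, 'v::zero, 'z) cochains_scheme \<Rightarrow> (int \<times> 'v) list \<Rightarrow> 'v"
  where "end_unit V xs = (if xs \<in> hvecs V 1 then snd (hd xs) else 0)"

definition end_ins :: "('k::field, 'v::ab_group_add, 'z) cochains_scheme \<Rightarrow>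
    nat \<Rightarrow> int \<Rightarrow> nat \<Rightarrow> int \<Rightarrow> nat \<Rightarrow> ((int \<times> 'v) list \<Rightarrow> 'v) \<Rightarrow> ((int \<times> 'v) list \<Rightarrow> 'v) \<Rightarrow>
    (int \<times> 'v) list \<Rightarrow> 'v"
  where "end_ins V n d m e i f g xs =
    (if xs \<in> hvecs V (n + m - 1) then
       (let ys = take (i - 1) xs; zs = take m (drop (i - 1) xs); ws = drop (i - 1 + m) xs
        in signed (e * tdeg ys) (f (ys @ (tdeg zs + e, g zs) # ws)))
     else 0)"

text \<open>\<open>(\<sigma>f)(x\<^sub>1,\<dots>,x\<^sub>n) = \<plusminus>f(x\<^bsub>\<sigma>(1)\<^esub>,\<dots>,x\<^bsub>\<sigma>(n)\<^esub>)\<close>, where the Koszul sign counts the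
  transposed pairs of arguments of odd degree.\<close>

definition end_act :: "('k::field, 'v::ab_group_add, 'z) cochains_scheme \<Rightarrow>
    nat \<Rightarrow> int \<Rightarrow> (nat \<Rightarrow> nat) \<Rightarrow> ((int \<times> 'v) list \<Rightarrow> 'v) \<Rightarrow> (int \<times> 'v) list \<Rightarrow> 'v"
  where "end_act V n d \<sigma> f xs =
    (if xs \<in> hvecs V n then
       signed (\<Sum>(a, b)\<in>{(a, b). 1 \<le> a \<and> a < b \<and> b \<le> n \<and> \<sigma> b < \<sigma> a}.
                 fst (xs ! (\<sigma> a - 1)) * fst (xs ! (\<sigma> b - 1)))
         (f (map (\<lambda>j. xs ! (\<sigma> j - 1)) [1..<n+1]))
     else 0)"

definition end_diff :: "('k::field, 'v::ab_group_add, 'z) cochains_scheme \<Rightarrow>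
    nat \<Rightarrow> int \<Rightarrow> ((int \<times> 'v) list \<Rightarrow> 'v) \<Rightarrow> (int \<times> 'v) list \<Rightarrow> 'v"
  where "end_diff V n d f xs =
    (if xs \<in> hvecs V n then
       c_diff V (tdeg xs + d) (f xs)
       - signed d (\<Sum>j<n. signed (tdeg (take j xs))
           (f (xs[j := (fst (xs ! j) + 1, c_diff V (fst (xs ! j)) (snd (xs ! j)))])))
     else 0)"

definition End_operad ::
  "('k::field, 'v::ab_group_add, 'z) cochains_scheme \<Rightarrow> ('k, (int \<times> 'v) list \<Rightarrow> 'v) operad"
  where "End_operad V =
    \<lparr>o_scale = (\<lambda>c f xs. c_scale V c (f xs)), o_car = end_car V, o_unit = end_unit V,
     o_ins = end_ins V, o_act = end_act V, o_diff = end_diff V\<rparr>"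

definition end_filt :: "('k::field, 'v::ab_group_add, 'z) filtered_cochains_scheme \<Rightarrow>
    nat \<Rightarrow> nat \<Rightarrow> int \<Rightarrow> ((int \<times> 'v) list \<Rightarrow> 'v) set"
  where "end_filt V k n d = {f \<in> end_car V n d.
    \<forall>xs ks. length xs = n \<and> length ks = n \<and> (\<forall>j<n. snd (xs ! j) \<in> c_filt V (ks ! j) (fst (xs ! j))) \<longrightarrow>
      f xs \<in> c_filt V (sum_list ks + k) (tdeg xs + d)}"


section \<open>Algebras and their morphisms\<close>

type_synonym ('o, 'v) structure_map = "nat \<Rightarrow> int \<Rightarrow> 'o \<Rightarrow> (int \<times> 'v) list \<Rightarrow> 'v"

definition operad_algebra :: "('k::field, 'o::ab_group_add) operad \<Rightarrow>
    ('k, 'v::ab_group_add, 'z) cochains_scheme \<Rightarrow> ('o, 'v) structure_map \<Rightarrow> bool"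
  where "operad_algebra Q V \<rho> \<longleftrightarrow>
    cochain_complex V \<and> dg_operad_map Q (End_operad V) \<rho> \<and>
    (\<forall>n d f. f \<notin> o_car Q n d \<longrightarrow> \<rho> n d f = 0)"

definition compatible_algebra :: "('k::field, 'o::ab_group_add) operad \<Rightarrow>
    ('k, 'v::ab_group_add) filtered_cochains \<Rightarrow> ('o, 'v) structure_map \<Rightarrow> bool"
  where "compatible_algebra P V \<rho> \<longleftrightarrow>
    complete_filtered_complex V \<and> operad_algebra P V \<rho> \<and>
    (\<forall>n d. \<forall>f\<in>o_car P n d. \<rho> n d f \<in> end_filt V 0 n d)"

definition filtered_tw_algebra :: "('k::field, 'o::ab_group_add) operad \<Rightarrow> (nat \<Rightarrow> 'o) \<Rightarrow>
    ('k, 'v::ab_group_add) filtered_cochains \<Rightarrow> (nat \<Rightarrow> 'o, 'v) structure_map \<Rightarrow> bool"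
  where "filtered_tw_algebra P \<phi> V \<rho> \<longleftrightarrow>
    complete_filtered_complex V \<and> operad_algebra (Tw P \<phi>) V \<rho> \<and>
    (\<forall>k n d. \<forall>f\<in>tw_filt P k n d. \<rho> n d f \<in> end_filt V k n d)"

definition filtered_algebra_map :: "('k::field, 'o::ab_group_add) operad \<Rightarrow>
    ('k, 'v::ab_group_add) filtered_cochains \<Rightarrow> ('o, 'v) structure_map \<Rightarrow>
    ('k, 'v) filtered_cochains \<Rightarrow> ('o, 'v) structure_map \<Rightarrow> (int \<Rightarrow> 'v \<Rightarrow> 'v) \<Rightarrow> bool"
  where "filtered_algebra_map Q V \<rho> W \<rho>' f \<longleftrightarrow>
    (\<forall>d. linear_on (c_scale V) (c_scale W) (c_car V d) (c_car W d) (f d)) \<and>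
    (\<forall>d x. x \<notin> c_car V d \<longrightarrow> f d x = 0) \<and>
    (\<forall>d. \<forall>x\<in>c_car V d. f (d + 1) (c_diff V d x) = c_diff W d (f d x)) \<and>
    (\<forall>n d. \<forall>v\<in>o_car Q n d. \<forall>xs\<in>hvecs V n.
       f (tdeg xs + d) (\<rho> n d v xs) = \<rho>' n d v (map (\<lambda>(e, x). (e, f e x)) xs)) \<and>
    (\<forall>k d. \<forall>x\<in>c_filt V k d. f d x \<in> c_filt W k d)"

definition filt_sums ::
  "('k, 'v::ab_group_add) filtered_cochains \<Rightarrow> int \<Rightarrow> nat \<Rightarrow> (nat \<Rightarrow> 'v) \<Rightarrow> 'v \<Rightarrow> bool"
  \<comment> \<open>convergence of the sum of the \<open>t n\<close>, \<open>n \<ge> m\<close>, to \<open>s\<close> in degree \<open>d\<close>, in the topology of the filtration\<close>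
  where "filt_sums V d m t s \<longleftrightarrow> s \<in> c_car V d \<and>
    (\<forall>k. \<exists>N0. \<forall>N\<ge>N0. s - (\<Sum>n=m..N. t n) \<in> c_filt V k d)"

definition maurer_cartan :: "(nat \<Rightarrow> 'o) \<Rightarrow> ('k::field_char_0, 'v::ab_group_add) filtered_cochains \<Rightarrow>
    ('o, 'v) structure_map \<Rightarrow> 'v \<Rightarrow> bool"
  where "maurer_cartan \<phi> V \<rho> \<alpha> \<longleftrightarrow>
    \<alpha> \<in> c_filt V 1 2 \<and>
    (\<exists>s. filt_sums V 3 2
           (\<lambda>n. c_scale V (1 / fact n) (\<rho> n (3 - 2 * int n) (\<phi> n) (replicate n (2, \<alpha>)))) s \<and>
         c_diff V 2 \<alpha> + s = 0)"


section \<open>Categories\<close>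

record ('a, 'm) cat =
  Obj :: "'a set"
  Hom :: "'a \<Rightarrow> 'a \<Rightarrow> 'm set"
  Ident :: "'a \<Rightarrow> 'm"
  Comp :: "'a \<Rightarrow> 'a \<Rightarrow> 'a \<Rightarrow> 'm \<Rightarrow> 'm \<Rightarrow> 'm"  \<comment> \<open>\<open>Comp X Y Z g f\<close> for \<open>f : X \<rightarrow> Y\<close>, \<open>g : Y \<rightarrow> Z\<close>\<close>

locale category =
  fixes C :: "('a, 'm) cat"
  assumes ident_closed: "X \<in> Obj C \<Longrightarrow> Ident C X \<in> Hom C X X"
    and comp_closed: "\<lbrakk>X \<in> Obj C; Y \<in> Obj C; Z \<in> Obj C; f \<in> Hom C X Y; g \<in> Hom C Y Z\<rbrakk> \<Longrightarrow>
      Comp C X Y Z g f \<in> Hom C X Z"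
    and comp_ident: "\<lbrakk>X \<in> Obj C; Y \<in> Obj C; f \<in> Hom C X Y\<rbrakk> \<Longrightarrow> Comp C X X Y f (Ident C X) = f"
    and ident_comp: "\<lbrakk>X \<in> Obj C; Y \<in> Obj C; f \<in> Hom C X Y\<rbrakk> \<Longrightarrow> Comp C X Y Y (Ident C Y) f = f"
    and comp_assoc: "\<lbrakk>W \<in> Obj C; X \<in> Obj C; Y \<in> Obj C; Z \<in> Obj C;
        f \<in> Hom C W X; g \<in> Hom C X Y; h \<in> Hom C Y Z\<rbrakk> \<Longrightarrow>
      Comp C W X Z (Comp C X Y Z h g) f = Comp C W Y Z h (Comp C W X Y g f)"

locale category_isomorphism = C: category C + D: category D
  for C :: "('a, 'm) cat" and D :: "('b, 'n) cat" +
  fixes F :: "'a \<Rightarrow> 'b" and G :: "'a \<Rightarrow> 'a \<Rightarrow> 'm \<Rightarrow> 'n"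
  assumes bij_obj: "bij_betw F (Obj C) (Obj D)"
    and bij_hom: "\<lbrakk>X \<in> Obj C; Y \<in> Obj C\<rbrakk> \<Longrightarrow> bij_betw (G X Y) (Hom C X Y) (Hom D (F X) (F Y))"
    and map_ident: "X \<in> Obj C \<Longrightarrow> G X X (Ident C X) = Ident D (F X)"
    and map_comp: "\<lbrakk>X \<in> Obj C; Y \<in> Obj C; Z \<in> Obj C; f \<in> Hom C X Y; g \<in> Hom C Y Z\<rbrakk> \<Longrightarrow>
      G X Z (Comp C X Y Z g f) = Comp D (F X) (F Y) (F Z) (G Y Z g) (G X Y f)"

definition isomorphic_categories :: "('a, 'm) cat \<Rightarrow> ('b, 'n) cat \<Rightarrow> bool"
  where "isomorphic_categories C D \<longleftrightarrow> (\<exists>F G. category_isomorphism C D F G)"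

definition ident_map :: "('k, 'v::zero) filtered_cochains \<Rightarrow> int \<Rightarrow> 'v \<Rightarrow> 'v"
  where "ident_map V d x = (if x \<in> c_car V d then x else 0)"

definition Alg_filtr_Tw :: "('k::field_char_0, 'o::ab_group_add) operad \<Rightarrow> (nat \<Rightarrow> 'o) \<Rightarrow>
    (('k, 'v::ab_group_add) filtered_cochains \<times> (nat \<Rightarrow> 'o, 'v) structure_map, int \<Rightarrow> 'v \<Rightarrow> 'v) cat"
  where "Alg_filtr_Tw P \<phi> =
    \<lparr>Obj = {(V, \<rho>). filtered_tw_algebra P \<phi> V \<rho>},
     Hom = (\<lambda>(V, \<rho>) (W, \<rho>'). {f. filtered_algebra_map (Tw P \<phi>) V \<rho> W \<rho>' f}),
     Ident = (\<lambda>(V, \<rho>). ident_map V),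
     Comp = (\<lambda>_ _ _ g f d x. g d (f d x))\<rparr>"

definition Alg_MC :: "('k::field_char_0, 'o::ab_group_add) operad \<Rightarrow> (nat \<Rightarrow> 'o) \<Rightarrow>
    (('k, 'v::ab_group_add) filtered_cochains \<times> ('o, 'v) structure_map \<times> 'v, int \<Rightarrow> 'v \<Rightarrow> 'v) cat"
  where "Alg_MC P \<phi> =
    \<lparr>Obj = {(V, \<rho>, \<alpha>). compatible_algebra P V \<rho> \<and> maurer_cartan \<phi> V \<rho> \<alpha>},
     Hom = (\<lambda>(V, \<rho>, \<alpha>) (W, \<rho>', \<alpha>'). {f. filtered_algebra_map P V \<rho> W \<rho>' f \<and> f 2 \<alpha> = \<alpha>'}),
     Ident = (\<lambda>(V, \<rho>, \<alpha>). ident_map V),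
     Comp = (\<lambda>_ _ _ g f d x. g d (f d x))\<rparr>"

end

theory Submission
  imports Defs
begin


text \<open>
  Let \<open>u\<close> be the operadic unit of \<open>P\<close>. In characteristic zero, \<open>Tw P\<close> is generated up to completion by the
  operations \<open>(f, 0, 0, \<dots>)\<close> and the single nullary operation \<open>(0, u, 0, \<dots>)\<close> of degree \<open>2\<close>: if \<open>f\<close> is
  invariant in its first \<open>r\<close> inputs, inserting the latter \<open>r\<close> times into \<open>(f, 0, 0, \<dots>)\<close> gives \<open>r!\<close> times the
  element with \<open>f\<close> in position \<open>r\<close> (\<open>tw_ins_point\<close>, \<open>rho_mono_fact\<close>). A filtered \<open>Tw P\<close>-algebra is therefore
  determined by its operations \<open>(f, 0, 0, \<dots>)\<close> and by the value \<open>\<alpha>\<close> of the nullary operation, through the series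
  \<open>f(x\<^sub>1, \<dots>, x\<^sub>n) = \<Sum>\<^sub>r 1/r! f\<^sub>r(\<alpha>, \<dots>, \<alpha>, x\<^sub>1, \<dots>, x\<^sub>n)\<close> (\<open>rho_series\<close>). Conversely, for every \<open>\<alpha>\<close> of degree \<open>2\<close>
  and filtration \<open>1\<close> this series converges and defines a map of graded operads. Since \<open>\<alpha>\<close> has even degree,
  all shuffles in a composite contribute the same value; their number is a binomial coefficient, and the
  composite of two series becomes the diagonal sum of a double series (\<open>series_diagonal\<close>,
  \<open>twisted_ins\<close>).

  The differentials on the two sides differ. The map \<open>f \<mapsto> (f, 0, 0, \<dots>)\<close> commutes with the differentials only
  up to a commutator with \<open>\<kappa>\<close>, so the differential of the \<open>P\<close>-algebra is obtained from that of the
  \<open>Tw P\<close>-algebra by subtracting the operation \<open>\<kappa>\<close>, and in the other direction the operation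
  \<open>\<Sum>\<^sub>r 1/r! \<phi>\<^bsub>r+1\<^esub>(\<alpha>, \<dots>, \<alpha>, x)\<close> is added. Write \<open>D\<close> for the part of the twisted differential without \<open>\<kappa>\<close>. Two
  facts make this work.

  \<^item> The identity \<open>D \<kappa> + \<kappa> \<circ>\<^sub>1 \<kappa> = 0\<close> (\<open>kappa_square\<close>). It is the defining relation of the generators,
    with the shuffles sorted according to whether the last input belongs to the inner or to the outer
    operation. It makes both corrected differentials square to zero.
  \<^item> The commutator of the differential with the series of \<open>f\<close> contains the terms
    \<open>f\<^sub>r(\<partial>\<alpha>, \<alpha>, \<dots>, \<alpha>, x\<^sub>1, \<dots>, x\<^sub>n)\<close>. By the Maurer--Cartan equation they form the series of the second
    summand of \<open>D f\<close> (\<open>twisted_base_diff\<close>). In the other direction \<open>D (0, u, 0, \<dots>) = (0, - \<phi>\<^sub>1, - \<phi>\<^sub>2, \<dots>)\<close>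
    (\<open>tw_base_diff_point\<close>), whose series is the Maurer--Cartan equation for \<open>\<alpha>\<close>.

  The two constructions are inverse to each other. A filtered linear map respects one of the two
  structures exactly when it respects the other, because it commutes with convergent series
  (\<open>tw_algebra_map_iff\<close>); so the isomorphism of categories is the identity on morphisms.
\<close>

section \<open>Signs and linear maps on graded pieces\<close>

lemma sum_fun_apply: "sum f I x = (\<Sum>i\<in>I. f i x)"
  by (induction I rule: infinite_finite_induct) auto

lemma signed_even: "even k \<Longrightarrow> signed k x = x"
  by (simp add: signed_def)

lemma signed_cong_parity: "even (k - l) \<Longrightarrow> signed k x = signed l x"
  by (simp add: signed_def)

lemma signed_add: "signed k (x + y) = signed k x + signed k y"
  and signed_diff: "signed k (x - y) = signed k x - signed k y"
  and signed_minus: "signed k (- x) = - signed k x"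
  and signed_zero [simp]: "signed k 0 = 0"
  by (auto simp: signed_def)

lemma signed_sum: "signed k (sum f I) = (\<Sum>i\<in>I. signed k (f i))"
  by (simp add: signed_def sum_negf)

lemma signed_fun_apply: "signed k f x = signed k (f x)"
  by (simp add: signed_def)

lemma subspace_closed:
  assumes "vector_space s" "module.subspace s A"
  shows subspace_zero: "0 \<in> A"
    and subspace_plus: "x \<in> A \<Longrightarrow> y \<in> A \<Longrightarrow> x + y \<in> A"
    and subspace_minus: "x \<in> A \<Longrightarrow> y \<in> A \<Longrightarrow> x - y \<in> A"
    and subspace_uminus: "x \<in> A \<Longrightarrow> - x \<in> A"
    and subspace_scaled: "x \<in> A \<Longrightarrow> s c x \<in> A"
    and subspace_signed: "x \<in> A \<Longrightarrow> signed k x \<in> A"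
    and subspace_sums: "(\<And>i. i \<in> I \<Longrightarrow> f i \<in> A) \<Longrightarrow> sum f I \<in> A"
proof -
  have m: "module s" using assms(1) module_iff_vector_space by blast
  show "0 \<in> A" "x \<in> A \<Longrightarrow> y \<in> A \<Longrightarrow> x + y \<in> A" "x \<in> A \<Longrightarrow> y \<in> A \<Longrightarrow> x - y \<in> A"
    "x \<in> A \<Longrightarrow> - x \<in> A" "x \<in> A \<Longrightarrow> s c x \<in> A" "x \<in> A \<Longrightarrow> signed k x \<in> A"
    "(\<And>i. i \<in> I \<Longrightarrow> f i \<in> A) \<Longrightarrow> sum f I \<in> A"
    using assms(2) module.subspace_0[OF m] module.subspace_add[OF m] module.subspace_diff[OF m]
      module.subspace_neg[OF m] module.subspace_scale[OF m] module.subspace_sum[OF m, of A I f]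
    by (auto simp: signed_def)
qed

lemma linear_on_in: "linear_on s t A B f \<Longrightarrow> x \<in> A \<Longrightarrow> f x \<in> B"
  and linear_on_add: "linear_on s t A B f \<Longrightarrow> x \<in> A \<Longrightarrow> y \<in> A \<Longrightarrow> f (x + y) = f x + f y"
  and linear_on_scale: "linear_on s t A B f \<Longrightarrow> x \<in> A \<Longrightarrow> f (s c x) = t c (f x)"
  by (auto simp: linear_on_def)

lemma linear_on_derived:
  assumes "vector_space s" "module.subspace s A" "linear_on s t A B f"
  shows linear_on_zero: "f 0 = 0"
    and linear_on_uminus: "x \<in> A \<Longrightarrow> f (- x) = - f x"
    and linear_on_minus: "x \<in> A \<Longrightarrow> y \<in> A \<Longrightarrow> f (x - y) = f x - f y"
    and linear_on_signed: "x \<in> A \<Longrightarrow> f (signed k x) = signed k (f x)"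
    and linear_on_sum: "(\<And>i. i \<in> I \<Longrightarrow> g i \<in> A) \<Longrightarrow> f (sum g I) = (\<Sum>i\<in>I. f (g i))"
proof -
  note sc = subspace_closed[OF assms(1,2)]
  have z: "f 0 = 0"
    using linear_on_add[OF assms(3) sc(1) sc(1)] by simp
  have n: "f (- x) = - f x" if "x \<in> A" for x
  proof -
    have "f (x + - x) = f x + f (- x)"
      using linear_on_add[OF assms(3) that sc(4)[OF that]] .
    then show ?thesis using z by (simp add: eq_neg_iff_add_eq_0 add.commute)
  qed
  have d: "f (x - y) = f x - f y" if "x \<in> A" "y \<in> A" for x y
    using linear_on_add[OF assms(3) that(1) sc(4)[OF that(2)]] n[OF that(2)] by simp
  show "f 0 = 0" by (fact z)
  show "x \<in> A \<Longrightarrow> f (- x) = - f x" by (fact n)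
  show "x \<in> A \<Longrightarrow> y \<in> A \<Longrightarrow> f (x - y) = f x - f y" by (fact d)
  show "x \<in> A \<Longrightarrow> f (signed k x) = signed k (f x)" by (simp add: signed_def n)
  show "(\<And>i. i \<in> I \<Longrightarrow> g i \<in> A) \<Longrightarrow> f (sum g I) = (\<Sum>i\<in>I. f (g i))"
  proof (induction I rule: infinite_finite_induct)
    case (insert i I)
    then have "sum g I \<in> A" by (intro sc(7)) auto
    then show ?case using insert linear_on_add[OF assms(3), of "g i" "sum g I"] by simp
  qed (simp_all add: z)
qed


section \<open>Permutations and shuffles\<close>

lemma perm_of_permutes:
  assumes "distinct ls" "set ls = {1..length ls}"
  shows "perm_of ls permutes {1..length ls}"
proof (rule bij_imp_permutes)
  have "bij_betw ((!) ls) {..<length ls} (set ls)"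
    using assms(1) by (simp add: bij_betw_nth)
  moreover have "bij_betw (\<lambda>a. a - 1) {1..length ls} {..<length ls}"
    by (rule bij_betw_byWitness[where f' = Suc]) auto
  ultimately have "bij_betw ((!) ls \<circ> (\<lambda>a. a - 1)) {1..length ls} {1..length ls}"
    using bij_betw_trans assms(2) by metis
  then show "bij_betw (perm_of ls) {1..length ls} {1..length ls}"
    by (subst bij_betw_cong[where g = "(!) ls \<circ> (\<lambda>a. a - 1)"]) (auto simp: perm_of_def)
qed (auto simp: perm_of_def)


lemma permutes_le:
  fixes \<sigma> :: "nat \<Rightarrow> nat"
  assumes "\<sigma> permutes {1..r}" "r \<le> N"
  shows "\<sigma> permutes {1..N}"
  by (rule permutes_subset[OF assms(1)]) (use assms(2) in auto)

lemma permutes_atLeastAtMost_fixes: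
  fixes \<sigma> :: "nat \<Rightarrow> nat"
  assumes "\<sigma> permutes {a..b}"
  shows "x < a \<Longrightarrow> \<sigma> x = x" "x > b \<Longrightarrow> \<sigma> x = x" "\<sigma> x \<in> {a..b} \<longleftrightarrow> x \<in> {a..b}"
  using permutes_not_in[OF assms] permutes_in_image[OF assms] by auto

lemma translate_permutes:
  fixes \<rho> :: "nat \<Rightarrow> nat"
  assumes \<rho>: "\<rho> permutes {a..<a+q}"
  shows "(\<lambda>x. if x \<in> {b..<b+q} then \<rho> (x + a - b) + b - a else x) permutes {b..<b+q}"
    (is "?t permutes _")
proof (rule inj_imp_permutes)
  have mem: "x + a - b \<in> {a..<a+q}" "\<rho> (x + a - b) \<in> {a..<a+q}" if "x \<in> {b..<b+q}" for x
    using that permutes_in_image[OF \<rho>, of "x + a - b"] by auto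
  show "inj_on ?t {b..<b+q}"
  proof (rule inj_onI)
    fix x y assume xy: "x \<in> {b..<b+q}" "y \<in> {b..<b+q}" "?t x = ?t y"
    then have "\<rho> (x + a - b) + b - a = \<rho> (y + a - b) + b - a" by simp
    moreover have ge: "a \<le> \<rho> (x + a - b)" "a \<le> \<rho> (y + a - b)" "b \<le> x" "b \<le> y"
      using mem(2)[OF xy(1)] mem(2)[OF xy(2)] xy by auto
    ultimately have "\<rho> (x + a - b) = \<rho> (y + a - b)" by linarith
    then have "x + a - b = y + a - b" using permutes_inj[OF \<rho>] by (simp add: inj_def)
    then show "x = y" using ge(3,4) by linarith
  qed
  show "?t x \<in> {b..<b+q}" if "x \<in> {b..<b+q}" for x using mem(2)[OF that] that by auto
qed auto

lemma Sh_permutes: "\<sigma> \<in> Sh p q \<Longrightarrow> \<sigma> permutes {1..p+q}"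
  by (simp add: Sh_def)

lemma finite_Sh [simp]: "finite (Sh p q)"
  by (rule finite_subset[OF _ finite_permutations[of "{1..p+q}"]]) (auto simp: Sh_def)

lemma strict_mono_on_image_eqD:
  fixes f g :: "nat \<Rightarrow> nat"
  assumes "strict_mono_on {a..<b} f" "strict_mono_on {a..<b} g" "f ` {a..<b} = g ` {a..<b}"
    and "x \<in> {a..<b}"
  shows "f x = g x"
proof -
  have sd: "sorted_wrt (<) (map h [a..<b])" if "strict_mono_on {a..<b} h" for h :: "nat \<Rightarrow> nat"
    unfolding sorted_wrt_map
    by (rule sorted_wrt_mono_rel[OF _ sorted_wrt_upt]) (use that in \<open>auto simp: strict_mono_on_def\<close>)
  have "map f [a..<b] = map g [a..<b]"
    by (rule strict_sorted_equal[OF sd[OF assms(2)] sd[OF assms(1)]]) (use assms(3) in auto)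
  then show ?thesis using assms(4) by simp
qed

text \<open>Both blocks are listed in increasing order, so the set of labels of the first block determines the
  shuffle, and every set of the right size can be prescribed.\<close>

lemma Sh_subsets_bij:
  "bij_betw (\<lambda>\<sigma>. \<sigma> ` {1..p}) (Sh p q) {A. A \<subseteq> {1..p+q} \<and> card A = p}"
proof (rule bij_betw_imageI)
  show "inj_on (\<lambda>\<sigma>. \<sigma> ` {1..p}) (Sh p q)"
  proof (rule inj_onI)
    fix \<sigma> \<tau> assume s: "\<sigma> \<in> Sh p q" and t: "\<tau> \<in> Sh p q" and im: "\<sigma> ` {1..p} = \<tau> ` {1..p}"
    note ps = Sh_permutes[OF s] and pt = Sh_permutes[OF t]
    have split: "{p+1..p+q} = {1..p+q} - {1..p}" by auto
    have im2: "\<sigma> ` {p+1..p+q} = \<tau> ` {p+1..p+q}"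
      unfolding split using permutes_image[OF ps] permutes_image[OF pt] im
      by (simp add: image_set_diff[OF permutes_inj[OF ps]] image_set_diff[OF permutes_inj[OF pt]])
    have iv: "{1..p} = {1..<Suc p}" "{p+1..p+q} = {p+1..<Suc (p+q)}" by auto
    show "\<sigma> = \<tau>"
    proof
      fix x
      consider "x \<in> {1..p}" | "x \<in> {p+1..p+q}" | "x \<notin> {1..p+q}" by force
      then show "\<sigma> x = \<tau> x"
      proof cases
        case 1
        then show ?thesis
          using strict_mono_on_image_eqD[of 1 "Suc p" \<sigma> \<tau> x] s t im unfolding Sh_def iv by auto
      next
        case 2
        then show ?thesis
          using strict_mono_on_image_eqD[of "p+1" "Suc (p+q)" \<sigma> \<tau> x] s t im2 unfolding Sh_def iv by auto
      next
        case 3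
        then show ?thesis using permutes_not_in[OF ps] permutes_not_in[OF pt] by metis
      qed
    qed
  qed
  show "(\<lambda>\<sigma>. \<sigma> ` {1..p}) ` Sh p q = {A. A \<subseteq> {1..p+q} \<and> card A = p}"
  proof (intro equalityI subsetI)
    fix A assume "A \<in> (\<lambda>\<sigma>. \<sigma> ` {1..p}) ` Sh p q"
    then obtain \<sigma> where s: "\<sigma> \<in> Sh p q" and A: "A = \<sigma> ` {1..p}" by auto
    note ps = Sh_permutes[OF s]
    have "A \<subseteq> {1..p+q}" unfolding A using image_mono[of "{1..p}" "{1..p+q}" \<sigma>] permutes_image[OF ps] by auto
    moreover have "card A = p" unfolding A
      by (simp add: card_image permutes_inj_on[OF ps])
    ultimately show "A \<in> {A. A \<subseteq> {1..p+q} \<and> card A = p}" by simp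
  next
    fix A assume "A \<in> {A. A \<subseteq> {1..p+q} \<and> card A = p}"
    then have A: "A \<subseteq> {1..p+q}" and cA: "card A = p" by auto
    have fA: "finite A" using A finite_subset by blast
    define B where "B = {1..p+q} - A"
    have cB: "card B = q" unfolding B_def using A cA by (simp add: card_Diff_subset fA)
    have fB: "finite B" by (simp add: B_def)
    define as bs where "as = sorted_list_of_set A" and "bs = sorted_list_of_set B"
    have la: "length as = p" "set as = A" "sorted_wrt (<) as" "distinct as"
      and lb: "length bs = q" "set bs = B" "sorted_wrt (<) bs" "distinct bs"
      using fA fB cA cB by (auto simp: as_def bs_def)
    define \<sigma> where "\<sigma> = perm_of (as @ bs)"
    have un: "A \<union> B = {1..p+q}" using A by (auto simp: B_def)
    have "\<sigma> permutes {1..p+q}"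
      using perm_of_permutes[of "as @ bs"] la lb un by (auto simp: \<sigma>_def B_def)
    moreover have s1: "\<sigma> x = as ! (x - 1)" if "x \<in> {1..p}" for x
      using that la lb by (auto simp: \<sigma>_def perm_of_def nth_append)
    have s2: "\<sigma> x = bs ! (x - 1 - p)" if "x \<in> {p+1..p+q}" for x
      using that la lb by (auto simp: \<sigma>_def perm_of_def nth_append)
    have "strict_mono_on {1..p} \<sigma>"
    proof (rule strict_mono_onI)
      fix x y assume "x \<in> {1..p}" "y \<in> {1..p}" "x < y"
      then show "\<sigma> x < \<sigma> y" using s1 sorted_wrt_nth_less[OF la(3), of "x - 1" "y - 1"] la(1) by auto
    qed
    moreover have "strict_mono_on {p+1..p+q} \<sigma>"
    proof (rule strict_mono_onI)
      fix x y assume "x \<in> {p+1..p+q}" "y \<in> {p+1..p+q}" "x < y"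
      then show "\<sigma> x < \<sigma> y" using s2 sorted_wrt_nth_less[OF lb(3), of "x - 1 - p" "y - 1 - p"] lb(1)
        by auto
    qed
    ultimately have "\<sigma> \<in> Sh p q" by (simp add: Sh_def)
    moreover have "\<sigma> ` {1..p} = A"
    proof -
      have "\<sigma> ` {1..p} = (\<lambda>x. as ! (x - 1)) ` {1..p}" using s1 by auto
      also have "\<dots> = (!) as ` {0..<p}"
      proof -
        have "(\<lambda>x. x - 1) ` {1..p} = {0..<p}"
        proof (intro equalityI subsetI)
          fix x assume "x \<in> {0..<p}"
          then have "x = Suc x - 1" "Suc x \<in> {1..p}" by auto
          then show "x \<in> (\<lambda>x. x - 1) ` {1..p}" by blast
        qed auto
        then show ?thesis by (metis image_image)
      qed
      also have "\<dots> = A" using la by (auto simp: set_conv_nth)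
      finally show ?thesis .
    qed
    ultimately show "A \<in> (\<lambda>\<sigma>. \<sigma> ` {1..p}) ` Sh p q" by blast
  qed
qed

lemma card_Sh: "card (Sh p q) = (p + q) choose p"
  using bij_betw_same_card[OF Sh_subsets_bij] n_subsets[of "{1..p+q}" p] by simp

lemma Sh_id [simp]: "id \<in> Sh p q"
  by (auto simp: Sh_def permutes_id strict_mono_on_def)

lemma Sh_0_left [simp]: "Sh 0 q = {id}"
  using card_Sh[of 0 q] Sh_id[of 0 q] by (auto simp: card_1_singleton_iff simp del: Sh_id)

lemma Sh_0_right [simp]: "Sh p 0 = {id}"
  using card_Sh[of p 0] Sh_id[of p 0] by (auto simp: card_1_singleton_iff simp del: Sh_id)

lemma sum_Sh_subsets:
  "(\<Sum>\<sigma>\<in>Sh p q. F (\<sigma> ` {1..p})) = (\<Sum>A | A \<subseteq> {1..p+q} \<and> card A = p. F A)"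
  by (rule sum.reindex_bij_betw[OF Sh_subsets_bij])

text \<open>How the arguments are permuted by a composite with the special inputs of both factors moved to
  the front: slot \<open>p + j\<close> (\<open>1 \<le> j < i\<close>) of the composite carries the label \<open>p + q + j\<close>, and the \<open>q\<close> special
  inputs of the inner factor carry the labels \<open>p + 1, \<dots>, p + q\<close>.\<close>

definition slot_perm :: "nat \<Rightarrow> nat \<Rightarrow> nat \<Rightarrow> nat \<Rightarrow> nat"
  where "slot_perm p q i a =
    (if p < a \<and> a < p + i then a + q else if p + i \<le> a \<and> a < p + i + q then a + 1 - i else a)"

lemma slot_perm_permutes:
  assumes "1 \<le> i" "p + q + i \<le> N + 1"
  shows "slot_perm p q i permutes {1..N}"
proof (rule inj_imp_permutes)
  have *: "slot_perm p q i a = (if a \<le> p then a else if a < p + i then a + q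
      else if a < p + i + q then a + 1 - i else a)" for a
    using assms(1) unfolding slot_perm_def by (simp split: if_split)
  show "inj_on (slot_perm p q i) {1..N}"
  proof (rule inj_onI)
    fix a b assume eq: "slot_perm p q i a = slot_perm p q i b"
    consider "a \<le> p" | "p < a" "a < p + i" | "p + i \<le> a" "a < p + i + q" | "p + i + q \<le> a" by linarith
    then show "a = b"
      by cases (use eq assms(1) in \<open>simp add: * split: if_splits; linarith\<close>)+
  qed
  show "slot_perm p q i a \<in> {1..N}" if "a \<in> {1..N}" for a
    using that assms unfolding * by (simp split: if_split) linarith
  show "slot_perm p q i a = a" if "a \<notin> {1..N}" for a
    using that assms unfolding * by (simp split: if_split) linarith
qed simp

lemma slot_perm_first: "slot_perm p q 1 = id"
proof
  show "slot_perm p q 1 a = id a" for a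
    unfolding slot_perm_def id_apply by (simp split: if_split)
qed

lemma slot_perm_0: "slot_perm p 0 i = id"
proof
  show "slot_perm p 0 i a = id a" for a
    unfolding slot_perm_def id_apply by simp
qed

text \<open>The labels displayed in the composition formula of the twisted operad combine the shuffle, which
  varies with the summand, with a rearrangement that depends only on the sizes of the blocks. Separating
  the two presents a composite as a sum of translates of a few elements under shuffles.\<close>

lemma perm_of_tw_labels:
  assumes "\<sigma> permutes {1..r}" "r = p + q" "1 \<le> i" "i \<le> n"
  shows "perm_of (map \<sigma> [1..<p+1] @ [r+1..<r+i] @ map \<sigma> [p+1..<r+1] @ [r+i..<r+i+m] @
      [r+i+m..<r+n+m]) = \<sigma> \<circ> slot_perm p q i"
proof -
  note fx = permutes_atLeastAtMost_fixes[OF assms(1)]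
  let ?w = "\<sigma> \<circ> slot_perm p q i"
  have shift: "map f [a..<b] = [a'..<b']"
    if "b - a = b' - a'" "\<And>x. a \<le> x \<Longrightarrow> x < b \<Longrightarrow> f x = x - a + a'" for f :: "nat \<Rightarrow> nat" and a b a' b'
    by (rule nth_equalityI) (use that in auto)
  have "map ?w [1..<r+n+m] = map ?w ([1..<p+1] @ [p+1..<p+i] @ [p+i..<r+i] @ [r+i..<r+i+m] @ [r+i+m..<r+n+m])"
  proof -
    have split: "[a..<c] = [a..<b] @ [b..<c]" if "a \<le> b" "b \<le> c" for a b c :: nat
      using that upt_add_eq_append[of a b "c - b"] by simp
    have "[1..<r+n+m] = [1..<p+1] @ [p+1..<r+n+m]" "[p+1..<r+n+m] = [p+1..<p+i] @ [p+i..<r+n+m]"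
      "[p+i..<r+n+m] = [p+i..<r+i] @ [r+i..<r+n+m]" "[r+i..<r+n+m] = [r+i..<r+i+m] @ [r+i+m..<r+n+m]"
      by (rule split; use assms in simp)+
    then show ?thesis by simp
  qed
  also have "\<dots> = map \<sigma> [1..<p+1] @ [r+1..<r+i] @ map \<sigma> [p+1..<r+1] @ [r+i..<r+i+m] @ [r+i+m..<r+n+m]"
  proof -
    have "map ?w [1..<p+1] = map \<sigma> [1..<p+1]" using assms(3) by (auto simp: slot_perm_def)
    moreover have "map ?w [p+1..<p+i] = [r+1..<r+i]"
      by (rule shift) (use fx(2) assms in \<open>auto simp: slot_perm_def\<close>)
    moreover have "map ?w [p+i..<r+i] = map \<sigma> [p+1..<r+1]"
      by (rule nth_equalityI) (use assms in \<open>auto simp: slot_perm_def simp del: upt_Suc\<close>)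
    moreover have "map ?w [r+i..<r+i+m] = [r+i..<r+i+m]" "map ?w [r+i+m..<r+n+m] = [r+i+m..<r+n+m]"
      by (rule shift; use fx(2) assms in \<open>auto simp: slot_perm_def\<close>)+
    ultimately show ?thesis by (simp only: map_append)
  qed
  finally have eq: "map ?w [1..<r+n+m] = \<dots>" .
  have "perm_of (map ?w [1..<r+n+m]) = ?w"
  proof
    fix a
    have N: "length (map ?w [1..<r+n+m]) = r + n + m - 1" by simp
    have w: "?w permutes {1..r+n+m-1}"
      by (rule permutes_compose[OF slot_perm_permutes permutes_le[OF assms(1)]]) (use assms in auto)
    show "perm_of (map ?w [1..<r+n+m]) a = ?w a"
      using permutes_atLeastAtMost_fixes(1,2)[OF w, of a] unfolding perm_of_def N
      by (cases "a = 0") auto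
  qed
  then show ?thesis unfolding eq .
qed


section \<open>Invariants and shuffle sums in an operad\<close>

text \<open>Elements fixed by the Young subgroup \<open>S\<^sub>p \<times> S\<^sub>q\<close> of the permutations of the first \<open>p + q\<close> inputs; its
  two factors generate it.\<close>

definition young_invariants ::
  "('k::field, 'o::ab_group_add) operad \<Rightarrow> nat \<Rightarrow> nat \<Rightarrow> nat \<Rightarrow> int \<Rightarrow> 'o set"
  where "young_invariants P p q N d = {x \<in> o_car P N d.
    (\<forall>\<rho>. \<rho> permutes {1..p} \<longrightarrow> o_act P N d \<rho> x = x) \<and>
    (\<forall>\<rho>. \<rho> permutes {p+1..p+q} \<longrightarrow> o_act P N d \<rho> x = x)}"


context graded_operad
begin

lemmas car_closed = subspace_closed[OF vector_space subspace]
lemmas car_zero [simp] = car_closed(1) and car_add = car_closed(2) and car_diff = car_closed(3)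
  and car_uminus = car_closed(4) and car_scale = car_closed(5) and car_signed = car_closed(6)
  and car_sum = car_closed(7)

lemmas act_car = linear_on_in[OF act_linear]
lemmas act_add = linear_on_add[OF act_linear]
lemmas act_scale = linear_on_scale[OF act_linear]
lemmas act_derived = linear_on_derived[OF vector_space subspace act_linear]
lemmas act_zero [simp] = act_derived(1) and act_uminus = act_derived(2) and act_diff = act_derived(3)
  and act_signed = act_derived(4) and act_sum = act_derived(5)

lemma ins_car: "f \<in> o_car P n d \<Longrightarrow> g \<in> o_car P m e \<Longrightarrow> 1 \<le> i \<Longrightarrow> i \<le> n \<Longrightarrow>
    o_ins P n d m e i f g \<in> o_car P (n + m - 1) (d + e)"
  using linear_on_in[OF ins_linear_right] by blast

lemma ins_zero_right: "f \<in> o_car P n d \<Longrightarrow> 1 \<le> i \<Longrightarrow> i \<le> n \<Longrightarrow> o_ins P n d m e i f 0 = 0"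
  using linear_on_zero[OF vector_space subspace ins_linear_right] by blast

lemma ins_zero_left: "g \<in> o_car P m e \<Longrightarrow> 1 \<le> i \<Longrightarrow> i \<le> n \<Longrightarrow> o_ins P n d m e i 0 g = 0"
  using linear_on_zero[OF vector_space subspace ins_linear_left] by blast

lemma invariants_car: "f \<in> o_invariants P r n d \<Longrightarrow> f \<in> o_car P n d"
  by (simp add: o_invariants_def)

lemma invariants_act: "f \<in> o_invariants P r n d \<Longrightarrow> \<sigma> permutes {1..r} \<Longrightarrow> o_act P n d \<sigma> f = f"
  by (simp add: o_invariants_def)

lemma invariants_mono: "f \<in> o_invariants P r n d \<Longrightarrow> s \<le> r \<Longrightarrow> f \<in> o_invariants P s n d"
  using permutes_le by (auto simp: o_invariants_def)

lemma invariants_zero_iff [simp]: "f \<in> o_invariants P 0 n d \<longleftrightarrow> f \<in> o_car P n d"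
  by (auto simp: o_invariants_def act_id)

lemma invariants_subspace:
  assumes "r \<le> n"
  shows "module.subspace (o_scale P) (o_invariants P r n d)"
proof -
  have m: "module (o_scale P)" using vector_space module_iff_vector_space by blast
  show ?thesis
    unfolding module.subspace_def[OF m]
    using permutes_le[OF _ assms]
    by (auto simp: o_invariants_def car_add car_scale act_add act_scale)
qed

text \<open>If two permutations send the first block to the same set, they differ by a permutation that
  preserves both blocks.\<close>

lemma young_coset:
  assumes x: "x \<in> young_invariants P p q N d" and le: "p + q \<le> N"
    and perm: "\<pi> permutes {1..p+q}" "\<pi>' permutes {1..p+q}" and im: "\<pi> ` {1..p} = \<pi>' ` {1..p}"
  shows "o_act P N d \<pi> x = o_act P N d \<pi>' x"
proof -
  define \<rho> where "\<rho> = inv \<pi>' \<circ> \<pi>"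
  have \<rho>: "\<rho> permutes {1..p+q}"
    unfolding \<rho>_def by (rule permutes_compose[OF perm(1) permutes_inv[OF perm(2)]])
  have im1: "\<rho> ` {1..p} = {1..p}"
    unfolding \<rho>_def image_comp[symmetric] im
    by (simp add: image_comp permutes_inv_o[OF perm(2)])
  have im2: "\<rho> ` {p+1..p+q} = {p+1..p+q}"
  proof -
    have "{p+1..p+q} = {1..p+q} - {1..p}" by auto
    then show ?thesis
      using image_set_diff[OF permutes_inj[OF \<rho>], of "{1..p+q}" "{1..p}"] im1 permutes_image[OF \<rho>]
      by simp
  qed
  define \<rho>1 \<rho>2 where "\<rho>1 = (\<lambda>a. if a \<in> {1..p} then \<rho> a else a)"
    and "\<rho>2 = (\<lambda>a. if a \<in> {p+1..p+q} then \<rho> a else a)"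
  have \<rho>1: "\<rho>1 permutes {1..p}"
    by (rule inj_imp_permutes) (use im1 permutes_inj[OF \<rho>] in \<open>auto simp: \<rho>1_def inj_on_def inj_def\<close>)
  have \<rho>2: "\<rho>2 permutes {p+1..p+q}"
    by (rule inj_imp_permutes) (use im2 permutes_inj[OF \<rho>] in \<open>auto simp: \<rho>2_def inj_on_def inj_def\<close>)
  have eq: "\<pi> = \<pi>' \<circ> (\<rho>1 \<circ> \<rho>2)"
  proof -
    have "\<rho>1 \<circ> \<rho>2 = \<rho>"
    proof
      fix a
      consider "a \<in> {1..p}" | "a \<in> {p+1..p+q}" | "a \<notin> {1..p+q}" by force
      then show "(\<rho>1 \<circ> \<rho>2) a = \<rho> a"
      proof cases
        case 1
        then show ?thesis by (auto simp: \<rho>1_def \<rho>2_def)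
      next
        case 2
        moreover from this have "\<rho> a \<in> {p+1..p+q}" using im2 by blast
        ultimately show ?thesis by (auto simp: \<rho>1_def \<rho>2_def)
      next
        case 3
        then show ?thesis using permutes_not_in[OF \<rho>] by (auto simp: \<rho>1_def \<rho>2_def)
      qed
    qed
    moreover have "\<pi>' \<circ> \<rho> = \<pi>"
      by (simp add: \<rho>_def o_assoc[symmetric] comp_def permutes_inverses[OF perm(2)])
    ultimately show ?thesis by simp
  qed
  have N1: "\<pi>' permutes {1..N}" "\<rho>1 permutes {1..N}" "\<rho>2 permutes {1..N}"
    using perm(2) \<rho>1 \<rho>2 le by (auto intro: permutes_subset)
  have "o_act P N d \<pi> x = o_act P N d \<pi>' (o_act P N d \<rho>1 (o_act P N d \<rho>2 x))"
    using x N1 unfolding eq young_invariants_def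
    by (simp add: act_comp permutes_compose act_car)
  then show ?thesis using x \<rho>1 \<rho>2 by (simp add: young_invariants_def)
qed

text \<open>This turns sums over shuffles into sums over subsets, which are easier to cut up and reindex.\<close>

lemma young_coset_function:
  assumes "x \<in> young_invariants P p q N d" "p + q \<le> N"
  obtains Y where "\<And>\<pi>. \<pi> permutes {1..p+q} \<Longrightarrow> o_act P N d \<pi> x = Y (\<pi> ` {1..p})"
proof
  let ?Y = "\<lambda>A. o_act P N d (SOME \<pi>. \<pi> permutes {1..p+q} \<and> \<pi> ` {1..p} = A) x"
  show "o_act P N d \<pi> x = ?Y (\<pi> ` {1..p})" if "\<pi> permutes {1..p+q}" for \<pi>
    using someI[of "\<lambda>\<pi>'. \<pi>' permutes {1..p+q} \<and> \<pi>' ` {1..p} = \<pi> ` {1..p}" \<pi>] that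
    by (intro young_coset[OF assms]) auto
qed

text \<open>A relabelling of the special inputs permutes the subsets of a given size, hence the summands.\<close>

lemma shuffle_sum_invariant:
  assumes x: "x \<in> young_invariants P p q N d" and le: "p + q \<le> N"
  shows "(\<Sum>\<sigma>\<in>Sh p q. o_act P N d \<sigma> x) \<in> o_invariants P (p + q) N d"
proof -
  have xc: "x \<in> o_car P N d" using x by (simp add: young_invariants_def)
  obtain Y where Y: "\<And>\<pi>. \<pi> permutes {1..p+q} \<Longrightarrow> o_act P N d \<pi> x = Y (\<pi> ` {1..p})"
    using young_coset_function[OF x le] by metis
  let ?S = "{A. A \<subseteq> {1..p+q} \<and> card A = p}"
  have perm: "\<sigma> permutes {1..N}" if "\<sigma> permutes {1..p+q}" for \<sigma>
    using permutes_le[OF that le] .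
  have sumY: "(\<Sum>\<sigma>\<in>Sh p q. o_act P N d \<sigma> x) = (\<Sum>A\<in>?S. Y A)"
    unfolding sum_Sh_subsets[symmetric] by (rule sum.cong[OF refl]) (rule Y[OF Sh_permutes])
  have "o_act P N d \<tau> (\<Sum>\<sigma>\<in>Sh p q. o_act P N d \<sigma> x) = (\<Sum>\<sigma>\<in>Sh p q. o_act P N d \<sigma> x)"
    if \<tau>: "\<tau> permutes {1..p+q}" for \<tau>
  proof -
    have "o_act P N d \<tau> (\<Sum>\<sigma>\<in>Sh p q. o_act P N d \<sigma> x) = (\<Sum>\<sigma>\<in>Sh p q. o_act P N d (\<tau> \<circ> \<sigma>) x)"
      by (subst act_sum[OF perm[OF \<tau>]])
        (auto intro!: sum.cong act_car xc perm[OF Sh_permutes]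
          simp del: One_nat_def simp: act_comp[OF perm[OF \<tau>] perm[OF Sh_permutes] xc])
    also have "\<dots> = (\<Sum>\<sigma>\<in>Sh p q. Y (\<tau> ` (\<sigma> ` {1..p})))"
      by (rule sum.cong) (auto simp: Y[OF permutes_compose[OF Sh_permutes \<tau>]] image_comp)
    also have "\<dots> = (\<Sum>A\<in>?S. Y (\<tau> ` A))" by (rule sum_Sh_subsets)
    also have "\<dots> = (\<Sum>A\<in>?S. Y A)"
    proof (rule sum.reindex_bij_betw)
      have sub: "\<sigma> ` A \<in> ?S" if "\<sigma> permutes {1..p+q}" "A \<in> ?S" for \<sigma> A
        using that permutes_image[OF that(1)] image_mono[of A "{1..p+q}" \<sigma>]
        by (auto simp: card_image permutes_inj_on)
      show "bij_betw ((`) \<tau>) ?S ?S"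
        by (rule bij_betw_byWitness[where f' = "(`) (inv \<tau>)"])
          (use sub[OF \<tau>] sub[OF permutes_inv[OF \<tau>]] in
            \<open>simp_all add: image_comp permutes_inv_o[OF \<tau>] image_subset_iff del: One_nat_def\<close>)
    qed
    finally show ?thesis by (simp add: sumY)
  qed
  then show ?thesis
    by (auto simp: o_invariants_def intro!: car_sum act_car xc perm Sh_permutes)
qed

text \<open>For a permutation of inputs of the outer factor that precede the insertion slot, or of the initial
  inputs of the inner factor, the block permutation that it induces on the composite is the same
  permutation, up to a translation. Equivariance therefore passes invariance on to the composite.\<close>

lemma ins_young:
  assumes f: "f \<in> o_invariants P p n d" and g: "g \<in> o_invariants P q m e"
    and i: "p < i" "i \<le> n" and q: "q \<le> m"
  shows ins_invariant_left: "\<rho> permutes {1..p} \<Longrightarrow>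
      o_act P (n + m - 1) (d + e) \<rho> (o_ins P n d m e i f g) = o_ins P n d m e i f g"
    and ins_invariant_right: "\<rho> permutes {i..<i + q} \<Longrightarrow>
      o_act P (n + m - 1) (d + e) \<rho> (o_ins P n d m e i f g) = o_ins P n d m e i f g"
proof -
  note fc = invariants_car[OF f] and gc = invariants_car[OF g]
  assume \<rho>: "\<rho> permutes {1..p}"
  note fx = permutes_atLeastAtMost_fixes[OF \<rho>]
  have blk: "block_perm n m i \<rho> id = \<rho>"
  proof
    fix a
    have r: "\<rho> a < i" if "a < i" using that fx(2,3)[of a] i fx(1)[of 0]
      by (cases "a \<in> {1..p}"; cases "a = 0") (auto simp: not_le)
    show "block_perm n m i \<rho> id a = \<rho> a"
      using fx(1)[of a] fx(2)[of i] fx(2)[of a] fx(2)[of "a + 1 - m"] i r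
      unfolding block_perm_def Let_def by auto
  qed
  have "o_ins P n d m e (\<rho> i) (o_act P n d \<rho> f) (o_act P m e id g) =
      o_act P (n + m - 1) (d + e) (block_perm n m i \<rho> id) (o_ins P n d m e i f g)"
    by (rule equivariance[OF fc gc _ _ permutes_le[OF \<rho>] permutes_id]) (use i in auto)
  then show "o_act P (n + m - 1) (d + e) \<rho> (o_ins P n d m e i f g) = o_ins P n d m e i f g"
    using fx(2)[of i] i by (simp add: blk act_id[OF gc] invariants_act[OF f \<rho>])
next
  note fc = invariants_car[OF f] and gc = invariants_car[OF g]
  assume \<rho>: "\<rho> permutes {i..<i + q}"
  have fx: "\<rho> a = a" if "a \<notin> {i..<i+q}" for a using permutes_not_in[OF \<rho> that] .
  have mem: "\<rho> a \<in> {i..<i+q}" if "a \<in> {i..<i+q}" for a using permutes_in_image[OF \<rho>] that by blast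
  define \<tau> where "\<tau> = (\<lambda>b. if b \<in> {1..q} then \<rho> (b + i - 1) + 1 - i else b)"
  have \<tau>: "\<tau> permutes {1..q}"
    using translate_permutes[OF \<rho>, of 1] by (simp add: \<tau>_def atLeastLessThanSuc_atLeastAtMost)
  have blk: "block_perm n m i id \<tau> = \<rho>"
  proof
    fix a
    consider "a < i" | "a \<in> {i..<i+q}" | "i + q \<le> a" by force
    then show "block_perm n m i id \<tau> a = \<rho> a"
    proof cases
      case 1
      then show ?thesis using fx[of a] i by (auto simp: block_perm_def)
    next
      case 2
      then have "a - i + 1 + i - 1 = a" "a - i + 1 \<in> {1..q}" "a < i + m" "a < n + m" "a \<noteq> 0" "\<not> a < i"
        using i q by auto
      then show ?thesis using mem[OF 2] i by (simp add: block_perm_def \<tau>_def)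
    next
      case 3
      then show ?thesis using fx[of a] i by (auto simp: block_perm_def \<tau>_def)
    qed
  qed
  have "o_ins P n d m e (id i) (o_act P n d id f) (o_act P m e \<tau> g) =
      o_act P (n + m - 1) (d + e) (block_perm n m i id \<tau>) (o_ins P n d m e i f g)"
    by (rule equivariance[OF fc gc _ _ permutes_id permutes_le[OF \<tau> q]]) (use i in auto)
  then show "o_act P (n + m - 1) (d + e) \<rho> (o_ins P n d m e i f g) = o_ins P n d m e i f g"
    by (simp add: blk act_id[OF fc] invariants_act[OF g \<tau>])
qed

text \<open>Conjugation with \<open>slot_perm\<close> moves the special inputs of both factors to the front.\<close>

lemma slot_ins_young:
  assumes f: "f \<in> o_invariants P p (p + n) d" and g: "g \<in> o_invariants P q (q + m) e"
    and i: "1 \<le> i" "i \<le> n" and N: "N = p + q + n + m - 1" and D: "D = d + e"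
  shows "o_act P N D (slot_perm p q i) (o_ins P (p + n) d (q + m) e (p + i) f g)
      \<in> young_invariants P p q N D"
proof -
  let ?y = "o_ins P (p + n) d (q + m) e (p + i) f g" and ?w = "slot_perm p q i"
  have y: "?y \<in> o_car P N D"
    using ins_car[OF invariants_car[OF f] invariants_car[OF g], of "p + i"] i
    by (simp add: N D ac_simps)
  have w: "?w permutes {1..N}" by (rule slot_perm_permutes) (use i N in auto)
  have conj: "o_act P N D \<rho> (o_act P N D ?w ?y) = o_act P N D ?w ?y"
    if \<rho>: "\<rho> permutes {1..N}" and \<rho>': "\<rho>' permutes {1..N}" and c: "\<rho> \<circ> ?w = ?w \<circ> \<rho>'"
      and fixed: "o_act P N D \<rho>' ?y = ?y" for \<rho> \<rho>'
    using act_comp[OF \<rho> w y] act_comp[OF w \<rho>' y] c fixed by simp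
  have N': "p + n + (q + m) - 1 = N" and Nle: "p + q \<le> N" "p + i + q \<le> N + 1"
    using N i by auto
  have "o_act P N D \<rho> (o_act P N D ?w ?y) = o_act P N D ?w ?y" if \<rho>: "\<rho> permutes {1..p}" for \<rho>
  proof (rule conj[where \<rho>' = \<rho>])
    show "\<rho> permutes {1..N}" "\<rho> permutes {1..N}" using permutes_le[OF \<rho>] N i by auto
    note fx = permutes_atLeastAtMost_fixes[OF \<rho>]
    show "\<rho> \<circ> ?w = ?w \<circ> \<rho>"
    proof
      fix a
      show "(\<rho> \<circ> ?w) a = (?w \<circ> \<rho>) a"
      proof (cases "a \<in> {1..p}")
        case True
        moreover from this have "\<rho> a \<in> {1..p}" using fx(3) by blast
        ultimately show ?thesis using i by (auto simp: slot_perm_def)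
      next
        case False
        then have "?w a \<notin> {1..p}" using i by (auto simp: slot_perm_def)
        then show ?thesis using permutes_not_in[OF \<rho>] False by simp
      qed
    qed
    show "o_act P N D \<rho> ?y = ?y"
      using ins_invariant_left[OF f g _ _ _ \<rho>, of "p + i"] i N' D by simp
  qed
  moreover have "o_act P N D \<rho> (o_act P N D ?w ?y) = o_act P N D ?w ?y"
    if \<rho>: "\<rho> permutes {p+1..p+q}" for \<rho>
  proof -
    note fx = permutes_atLeastAtMost_fixes[OF \<rho>]
    define \<rho>' where "\<rho>' = (\<lambda>a. if a \<in> {p+i..<p+i+q} then \<rho> (a + 1 - i) + i - 1 else a)"
    have mem: "\<rho> (a + 1 - i) \<in> {p+1..p+q}" if "a \<in> {p+i..<p+i+q}" for a
      using that i fx(3)[of "a + 1 - i"] by auto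
    have \<rho>': "\<rho>' permutes {p+i..<p+i+q}"
    proof -
      have "\<rho>' = (\<lambda>x. if x \<in> {p+i..<p+i+q} then \<rho> (x + (p + 1) - (p + i)) + (p + i) - (p + 1) else x)"
        by (auto simp: \<rho>'_def fun_eq_iff)
      then show ?thesis
        using translate_permutes[of \<rho> "p + 1" q "p + i"] \<rho> by (simp add: atLeastLessThanSuc_atLeastAtMost)
    qed
    show ?thesis
    proof (rule conj[where \<rho>' = \<rho>'])
      show "\<rho> permutes {1..N}" by (rule permutes_subset[OF \<rho>]) (use Nle in auto)
      show "\<rho>' permutes {1..N}" by (rule permutes_subset[OF \<rho>']) (use Nle i in auto)
      show "\<rho> \<circ> ?w = ?w \<circ> \<rho>'"
      proof
        fix a
        show "(\<rho> \<circ> ?w) a = (?w \<circ> \<rho>') a"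
        proof (cases "a \<in> {p+i..<p+i+q}")
          case True
          define b where "b = \<rho> (a + 1 - i)"
          have "p + 1 \<le> b" "b \<le> p + q" using mem[OF True] by (auto simp: b_def)
          then have "?w (b + i - 1) = b" using i by (auto simp: slot_perm_def)
          moreover have "?w a = a + 1 - i" "\<rho>' a = b + i - 1"
            using True by (auto simp: slot_perm_def \<rho>'_def b_def)
          ultimately show ?thesis by (simp add: b_def)
        next
          case False
          then have "?w a \<notin> {p+1..p+q}" using i by (auto simp: slot_perm_def)
          then show ?thesis using False fx(1,2)[of "?w a"] by (auto simp: \<rho>'_def)
        qed
      qed
      show "o_act P N D \<rho>' ?y = ?y"
        using ins_invariant_right[OF f g _ _ _ \<rho>'] i N' D by simp
    qed
  qed
  ultimately show ?thesis using act_car[OF w y] by (simp add: young_invariants_def)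
qed

text \<open>In an insertion into the first slot the special inputs of both factors are already in front. Those
  of the outer factor are translated by \<open>p - 1\<close>, because the \<open>p\<close> inputs of \<open>g\<close> replace one input of \<open>f\<close>.\<close>

lemma ins_first_young:
  assumes f: "f \<in> o_invariants P (Suc q) n d" and g: "g \<in> o_invariants P p p e"
    and n: "Suc q \<le> n" and N: "N = n + p - 1" and D: "D = d + e"
  shows "o_ins P n d p e 1 f g \<in> young_invariants P p q N D"
proof -
  let ?y = "o_ins P n d p e 1 f g"
  note fc = invariants_car[OF f] and gc = invariants_car[OF g]
  have y: "?y \<in> o_car P N D" using ins_car[OF fc gc, of 1] n by (simp add: N D)
  have "o_act P N D \<rho> ?y = ?y" if \<rho>: "\<rho> permutes {1..p}" for \<rho>
  proof -
    have "{1..p} = {1..<1 + p}" by auto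
    then show ?thesis
      using ins_invariant_right[OF invariants_mono[OF f, of 0] g, of 1 \<rho>] \<rho> n by (simp add: N D)
  qed
  moreover have "o_act P N D \<rho> ?y = ?y" if \<rho>: "\<rho> permutes {p+1..p+q}" for \<rho>
  proof -
    note fx = permutes_atLeastAtMost_fixes[OF \<rho>]
    define \<sigma> where "\<sigma> = (\<lambda>b. if b \<in> {2..Suc q} then \<rho> (b + p - 1) + 1 - p else b)"
    have mem: "\<rho> (b + p - 1) \<in> {p+1..p+q}" if "b \<in> {2..Suc q}" for b
      using that fx(3)[of "b + p - 1"] by auto
    have \<sigma>: "\<sigma> permutes {2..Suc q}"
    proof -
      have "\<sigma> = (\<lambda>x. if x \<in> {2..<2+q} then \<rho> (x + (p + 1) - 2) + 2 - (p + 1) else x)"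
        by (auto simp: \<sigma>_def fun_eq_iff)
      then show ?thesis
        using translate_permutes[of \<rho> "p + 1" q 2] \<rho> by (simp add: atLeastLessThanSuc_atLeastAtMost)
    qed
    have \<sigma>': "\<sigma> permutes {1..Suc q}" "\<sigma> permutes {1..n}" using permutes_subset[OF \<sigma>] n by auto
    have \<sigma>1: "\<sigma> 1 = 1" by (simp add: \<sigma>_def)
    have blk: "block_perm n p 1 \<sigma> id = \<rho>"
    proof
      fix a
      consider "a \<le> p" | "a \<in> {p+1..p+q}" | "p + q < a" by force
      then show "block_perm n p 1 \<sigma> id a = \<rho> a"
      proof cases
        case 1
        then show ?thesis using fx(1)[of a] n \<sigma>1 by (auto simp: block_perm_def)
      next
        case 2
        then have "a + 1 - p \<in> {2..Suc q}" "a + 1 - p + p - 1 = a" by auto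
        then have "\<sigma> (a + 1 - p) = \<rho> a + 1 - p" "\<rho> a \<in> {p+1..p+q}" 
          using mem[of "a + 1 - p"] by (auto simp: \<sigma>_def)
        then show ?thesis using 2 n \<sigma>1 by (auto simp: block_perm_def)
      next
        case 3
        then show ?thesis using fx(2)[of a] n \<sigma>1 by (auto simp: block_perm_def \<sigma>_def)
      qed
    qed
    have "o_ins P n d p e (\<sigma> 1) (o_act P n d \<sigma> f) (o_act P p e id g) =
        o_act P (n + p - 1) (d + e) (block_perm n p 1 \<sigma> id) ?y"
      by (rule equivariance[OF fc gc _ _ \<sigma>'(2) permutes_id]) (use n in auto)
    then show ?thesis by (simp add: blk \<sigma>1 act_id[OF gc] invariants_act[OF f \<sigma>'(1)] N D del: One_nat_def)
  qed
  ultimately show ?thesis using y by (simp add: young_invariants_def)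
qed

end


section \<open>The graded structure of the twisted operad\<close>

text \<open>The summand of a composite that belongs to the identity shuffle, with \<open>p\<close> special inputs in \<open>f\<close> and \<open>q\<close>
  in \<open>g\<close>.\<close>

definition tw_comp :: "('k::field, 'o::ab_group_add) operad \<Rightarrow>
    nat \<Rightarrow> int \<Rightarrow> nat \<Rightarrow> int \<Rightarrow> nat \<Rightarrow> (nat \<Rightarrow> 'o) \<Rightarrow> (nat \<Rightarrow> 'o) \<Rightarrow> nat \<Rightarrow> nat \<Rightarrow> 'o"
  where "tw_comp P n d m e i f g p q =
    o_act P (p + q + n + m - 1) (d + e - 2 * int (p + q)) (slot_perm p q i)
      (o_ins P (p + n) (d - 2 * int p) (q + m) (e - 2 * int q) (p + i) (f p) (g q))"

abbreviation tw_base_comp :: "('k::field, 'o::ab_group_add) operad \<Rightarrow> (nat \<Rightarrow> 'o) \<Rightarrow>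
    nat \<Rightarrow> int \<Rightarrow> (nat \<Rightarrow> 'o) \<Rightarrow> nat \<Rightarrow> nat \<Rightarrow> 'o"
  where "tw_base_comp P \<phi> n d f r p \<equiv>
    o_ins P (r - p + 1 + n) (d - 2 * int (r - p + 1)) p (3 - 2 * int p) 1 (f (r - p + 1)) (\<phi> p)"

text \<open>The part of the twisted differential that does not involve \<open>\<kappa>\<close>. On a twisted algebra it corresponds to
  the differential before twisting.\<close>

definition tw_base_diff :: "('k::field, 'o::ab_group_add) operad \<Rightarrow> (nat \<Rightarrow> 'o) \<Rightarrow>
    nat \<Rightarrow> int \<Rightarrow> (nat \<Rightarrow> 'o) \<Rightarrow> nat \<Rightarrow> 'o"
  where "tw_base_diff P \<phi> n d f r = o_diff P (r + n) (d - 2 * int r) (f r)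
    - signed d (\<Sum>p=1..r. \<Sum>\<sigma>\<in>Sh p (r - p). o_act P (r + n) (d + 1 - 2 * int r) \<sigma> (tw_base_comp P \<phi> n d f r p))"

definition tw_shift :: "nat \<Rightarrow> (nat \<Rightarrow> nat) \<Rightarrow> nat \<Rightarrow> nat"
  where "tw_shift r \<sigma> a = (if a \<le> r then a else r + \<sigma> (a - r))"

lemma tw_shift_permutes:
  assumes "\<sigma> permutes {1..n}"
  shows "tw_shift r \<sigma> permutes {r+1..r+n}"
proof (rule inj_imp_permutes)
  note fx = permutes_atLeastAtMost_fixes[OF assms]
  show "inj_on (tw_shift r \<sigma>) {r+1..r+n}"
  proof (rule inj_onI)
    fix a b assume ab: "a \<in> {r+1..r+n}" "b \<in> {r+1..r+n}" "tw_shift r \<sigma> a = tw_shift r \<sigma> b"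
    then have "\<sigma> (a - r) = \<sigma> (b - r)" by (simp add: tw_shift_def)
    then have "a - r = b - r" using permutes_inj[OF assms] by (simp add: inj_def)
    then show "a = b" using ab(1,2) eq_diff_iff[of r a b] by auto
  qed
  show "tw_shift r \<sigma> a \<in> {r+1..r+n}" if "a \<in> {r+1..r+n}" for a
    using that fx(3)[of "a - r"] by (auto simp: tw_shift_def)
  show "tw_shift r \<sigma> a = a" if "a \<notin> {r+1..r+n}" for a
    using that fx(2)[of "a - r"] by (auto simp: tw_shift_def)
qed simp

context graded_operad
begin

lemma tw_carD: "f \<in> tw_car P n d \<Longrightarrow> f r \<in> o_invariants P r (r + n) (d - 2 * int r)"
  and tw_car_car: "f \<in> tw_car P n d \<Longrightarrow> f r \<in> o_car P (r + n) (d - 2 * int r)"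
  by (auto simp: tw_car_def intro: invariants_car)

lemma tw_car_subspace: "module.subspace (o_scale (Tw P \<phi>)) (tw_car P n d)"
  and tw_vector_space: "vector_space (o_scale (Tw P \<phi>))"
proof -
  have vs: "vector_space (\<lambda>c f (r::nat). o_scale P c (f r))"
    using vector_space by (auto simp: vector_space_def fun_eq_iff)
  then show "vector_space (o_scale (Tw P \<phi>))" by (simp add: Tw_def)
  have m: "module (\<lambda>c f (r::nat). o_scale P c (f r))" using vs module_iff_vector_space by blast
  show "module.subspace (o_scale (Tw P \<phi>)) (tw_car P n d)"
    using subspace_closed[OF vector_space invariants_subspace[of r "r + n" "d - 2 * int r" for r]]
    unfolding Tw_def by (auto simp: module.subspace_def[OF m] tw_car_def)
qed

lemma invariants_zero [simp]: "r \<le> n \<Longrightarrow> 0 \<in> o_invariants P r n d"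
  using subspace_zero[OF vector_space invariants_subspace] .

lemma labelled_comp_tw:
  assumes f: "f \<in> tw_car P n d" and g: "g \<in> tw_car P m e" and i: "1 \<le> i" "i \<le> n"
    and r: "r = p + q" and \<sigma>: "\<sigma> permutes {1..r}"
  shows "labelled_comp P (p + n) (d - 2 * int p) (q + m) (e - 2 * int q) (p + i) (f p) (g q)
         (map \<sigma> [1..<p+1] @ [r+1..<r+i] @ map \<sigma> [p+1..<r+1] @ [r+i..<r+i+m] @ [r+i+m..<r+n+m])
    = o_act P (r + n + m - 1) (d + e - 2 * int r) \<sigma> (tw_comp P n d m e i f g p q)"
proof -
  have deg: "d - 2 * int p + (e - 2 * int q) = d + e - 2 * int r" "p + n + (q + m) - 1 = r + n + m - 1"
    using r by auto
  let ?y = "o_ins P (p + n) (d - 2 * int p) (q + m) (e - 2 * int q) (p + i) (f p) (g q)"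
  have y: "?y \<in> o_car P (r + n + m - 1) (d + e - 2 * int r)"
    using ins_car[OF tw_car_car[OF f] tw_car_car[OF g], of "p + i" p q] i deg by simp
  show ?thesis
    unfolding labelled_comp_def perm_of_tw_labels[OF \<sigma> r i] deg tw_comp_def r[symmetric]
    by (rule act_comp[OF permutes_le[OF \<sigma>] slot_perm_permutes y]) (use i r in auto)
qed

lemma tw_ins_eq:
  assumes f: "f \<in> tw_car P n d" and g: "g \<in> tw_car P m e" and i: "1 \<le> i" "i \<le> n"
  shows "tw_ins P n d m e i f g r = (\<Sum>p\<le>r. \<Sum>\<sigma>\<in>Sh p (r - p).
    o_act P (r + n + m - 1) (d + e - 2 * int r) \<sigma> (tw_comp P n d m e i f g p (r - p)))"
  unfolding tw_ins_def
proof (intro sum.cong refl)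
  fix p \<sigma> assume "p \<in> {..r}" and s: "\<sigma> \<in> Sh p (r - p)"
  then have p: "r = p + (r - p)" by simp
  then have "\<sigma> permutes {1..r}" using Sh_permutes[OF s] by simp
  from labelled_comp_tw[OF f g i p this]
  show "labelled_comp P (p + n) (d - 2 * int p) (r - p + m) (e - 2 * int (r - p)) (p + i)
          (f p) (g (r - p)) (map \<sigma> [1..<p + 1] @ [r + 1..<r + i] @ map \<sigma> [p + 1..<r + 1] @
          [r + i..<r + i + m] @ [r + i + m..<r + n + m]) =
     o_act P (r + n + m - 1) (d + e - 2 * int r) \<sigma> (tw_comp P n d m e i f g p (r - p))" .
qed

lemma tw_comp_young:
  assumes f: "f \<in> tw_car P n d" and g: "g \<in> tw_car P m e" and i: "1 \<le> i" "i \<le> n"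
  shows "tw_comp P n d m e i f g p q
    \<in> young_invariants P p q (p + q + n + m - 1) (d + e - 2 * int (p + q))"
  unfolding tw_comp_def
  by (rule slot_ins_young[OF tw_carD[OF f] tw_carD[OF g] i]) auto

text \<open>The summands with \<open>p\<close> special inputs in the outer factor add up to an invariant element, for each \<open>p\<close>
  separately.\<close>

lemma tw_ins_car:
  assumes f: "f \<in> tw_car P n d" and g: "g \<in> tw_car P m e" and i: "1 \<le> i" "i \<le> n"
  shows "tw_ins P n d m e i f g \<in> tw_car P (n + m - 1) (d + e)"
  unfolding tw_car_def
proof (intro CollectI allI)
  fix r
  have eq: "r + n + m - 1 = r + (n + m - 1)" using i by simp
  show "tw_ins P n d m e i f g r \<in> o_invariants P r (r + (n + m - 1)) (d + e - 2 * int r)"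
    unfolding tw_ins_eq[OF assms] eq[symmetric]
  proof (rule subspace_sums[OF vector_space invariants_subspace])
    fix p assume "p \<in> {..r}"
    then have r: "p + (r - p) = r" by simp
    show "(\<Sum>\<sigma>\<in>Sh p (r - p). o_act P (r + n + m - 1) (d + e - 2 * int r) \<sigma>
        (tw_comp P n d m e i f g p (r - p))) \<in> o_invariants P r (r + n + m - 1) (d + e - 2 * int r)"
      using shuffle_sum_invariant[OF tw_comp_young[OF assms, of p "r - p"]] i unfolding r by simp
  qed (use i in simp)
qed

lemma tw_act_eq: "tw_act P n d \<sigma> f r = o_act P (r + n) (d - 2 * int r) (tw_shift r \<sigma>) (f r)"
  by (simp add: tw_act_def tw_shift_def[abs_def])

lemma tw_act_car:
  assumes f: "f \<in> tw_car P n d" and \<sigma>: "\<sigma> permutes {1..n}"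
  shows "tw_act P n d \<sigma> f \<in> tw_car P n d"
  unfolding tw_car_def o_invariants_def
proof (intro CollectI allI conjI impI)
  fix r
  let ?s = "tw_shift r \<sigma>" and ?A = "o_act P (r + n) (d - 2 * int r)"
  have s: "?s permutes {1..r+n}" by (rule permutes_subset[OF tw_shift_permutes[OF \<sigma>]]) auto
  show "tw_act P n d \<sigma> f r \<in> o_car P (r + n) (d - 2 * int r)"
    unfolding tw_act_eq by (rule act_car[OF s tw_car_car[OF f]])
  fix \<rho> assume \<rho>: "\<rho> permutes {1..r}"
  have \<rho>': "\<rho> permutes {1..r+n}" by (rule permutes_le[OF \<rho>]) simp
  have "\<rho> \<circ> ?s = ?s \<circ> \<rho>"
  proof
    fix a
    show "(\<rho> \<circ> ?s) a = (?s \<circ> \<rho>) a"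
    proof (cases "a \<in> {1..r}")
      case True
      then have "\<rho> a \<in> {1..r}" using permutes_in_image[OF \<rho>] by blast
      then show ?thesis using True by (simp add: tw_shift_def)
    next
      case False
      then have "?s a \<notin> {1..r}"
        using permutes_atLeastAtMost_fixes(1)[OF \<sigma>, of 0] permutes_in_image[OF tw_shift_permutes[OF \<sigma>, of r], of a]
          permutes_not_in[OF tw_shift_permutes[OF \<sigma>, of r], of a] by force
      then show ?thesis using False permutes_not_in[OF \<rho>] by simp
    qed
  qed
  then show "?A \<rho> (tw_act P n d \<sigma> f r) = tw_act P n d \<sigma> f r"
    unfolding tw_act_eq
    using act_comp[OF \<rho>' s tw_car_car[OF f]] act_comp[OF s \<rho>' tw_car_car[OF f]]
      invariants_act[OF tw_carD[OF f] \<rho>] by simp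
qed

end


section \<open>The twisted differential\<close>

text \<open>The images of the generators of \<open>\<Lambda>Lie\<^sub>\<infinity>\<close>, described by the relations that they satisfy. Because \<open>\<phi> 1\<close>
  vanishes, the sum over \<open>p\<close> may include the terms \<open>p = 1\<close> and \<open>p = n\<close>; in this form its terms match those of
  the twisted differential of \<open>\<kappa>\<close>.\<close>

locale twisting = dg_operad P for P :: "('k::field, 'o::ab_group_add) operad" +
  fixes \<phi> :: "nat \<Rightarrow> 'o"
  assumes phi_invariant: "\<phi> n \<in> o_invariants P n n (3 - 2 * int n)"
    and phi_0: "\<phi> 0 = 0" and phi_1: "\<phi> (Suc 0) = 0"
    and phi_diff: "1 \<le> n \<Longrightarrow> o_diff P n (3 - 2 * int n) (\<phi> n) =
      - (\<Sum>p=1..n. \<Sum>\<sigma>\<in>Sh p (n - p). o_act P n (4 - 2 * int n) \<sigma>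
           (o_ins P (n - p + 1) (3 - 2 * int (n - p + 1)) p (3 - 2 * int p) 1
              (\<phi> (n - p + 1)) (\<phi> p)))"
begin

lemma phi_car: "\<phi> n \<in> o_car P n (3 - 2 * int n)"
  using invariants_car[OF phi_invariant] .

lemma kappa_car: "tw_kappa \<phi> \<in> tw_car P 1 1"
proof -
  have "\<phi> (Suc r) \<in> o_invariants P r (Suc r) (1 - 2 * int r)" for r
    using invariants_mono[OF phi_invariant[of "Suc r"], of r] by (simp add: algebra_simps)
  then show ?thesis by (simp add: tw_car_def tw_kappa_def)
qed

lemma diff_invariants: "f \<in> o_invariants P r n d \<Longrightarrow> r \<le> n \<Longrightarrow> o_diff P n d f \<in> o_invariants P r n (d + 1)"
  unfolding o_invariants_def
proof (intro CollectI conjI allI impI; elim CollectE conjE)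
  assume f: "f \<in> o_car P n d" "\<forall>\<sigma>. \<sigma> permutes {1..r} \<longrightarrow> o_act P n d \<sigma> f = f" and le: "r \<le> n"
  show "o_diff P n d f \<in> o_car P n (d + 1)" using linear_on_in[OF diff_linear f(1)] .
  fix \<sigma> assume s: "\<sigma> permutes {1..r}"
  show "o_act P n (d + 1) \<sigma> (o_diff P n d f) = o_diff P n d f"
    using diff_act[OF f(1) permutes_le[OF s le]] f(2) s by simp
qed

lemma tw_base_young:
  assumes f: "f \<in> tw_car P n d" and p: "1 \<le> p" "p \<le> r"
  shows "tw_base_comp P \<phi> n d f r p
    \<in> young_invariants P p (r - p) (r + n) (d + 1 - 2 * int r)"
  by (rule ins_first_young[OF _ phi_invariant]) (use tw_carD[OF f, of "r - p + 1"] p in auto)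

lemma tw_diff_eq:
  assumes f: "f \<in> tw_car P n d"
  shows "tw_diff P \<phi> n d f = tw_base_diff P \<phi> n d f + tw_ins P 1 1 n d 1 (tw_kappa \<phi>) f
    - signed d (\<Sum>i=1..n. tw_ins P n d 1 1 i f (tw_kappa \<phi>))"
proof
  fix r
  have "labelled_comp P (r - p + 1 + n) (d - 2 * int (r - p + 1)) p (3 - 2 * int p) 1
          (f (r - p + 1)) (\<phi> p)
          (map \<sigma> [1..<p+1] @ map \<sigma> [p+1..<r+1] @ [r+1..<r+n+1]) =
      o_act P (r + n) (d + 1 - 2 * int r) \<sigma> (tw_base_comp P \<phi> n d f r p)"
    if p: "p \<in> {1..r}" and s: "\<sigma> \<in> Sh p (r - p)" for p \<sigma>
  proof -
    have \<sigma>: "\<sigma> permutes {1..r}" using Sh_permutes[OF s] p by simp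
    have "perm_of (map \<sigma> [1..<p+1] @ map \<sigma> [p+1..<r+1] @ [r+1..<r+n+1]) = \<sigma>"
      using perm_of_tw_labels[OF \<sigma>, of p "r - p" 1 "Suc n" 0] p by (simp add: slot_perm_first[simplified])
    moreover have "r - p + 1 + n + p - 1 = r + n"
       "d - 2 * int (r - p + 1) + (3 - 2 * int p) = d + 1 - 2 * int r" using p by auto
    ultimately show ?thesis by (simp only: labelled_comp_def)
  qed
  then show "tw_diff P \<phi> n d f r = (tw_base_diff P \<phi> n d f + tw_ins P 1 1 n d 1 (tw_kappa \<phi>) f
    - signed d (\<Sum>i=1..n. tw_ins P n d 1 1 i f (tw_kappa \<phi>))) r"
    by (simp only: tw_diff_def tw_base_diff_def plus_fun_apply minus_apply signed_fun_apply sum_fun_apply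
      cong: sum.cong)
qed

lemma tw_base_diff_car:
  assumes f: "f \<in> tw_car P n d"
  shows "tw_base_diff P \<phi> n d f \<in> tw_car P n (d + 1)"
  unfolding tw_car_def tw_base_diff_def
proof (intro CollectI allI)
  fix r
  let ?I = "o_invariants P r (r + n) (d + 1 - 2 * int r)"
  note cl = subspace_closed[OF vector_space invariants_subspace[of r "r + n" "d + 1 - 2 * int r"]]
  have "o_diff P (r + n) (d - 2 * int r) (f r) \<in> ?I"
  proof -
    have eq: "d - 2 * int r + 1 = d + 1 - 2 * int r" by simp
    have "o_diff P (r + n) (d - 2 * int r) (f r) \<in> o_invariants P r (r + n) (d - 2 * int r + 1)"
      by (rule diff_invariants[OF tw_carD[OF f]]) simp
    then show ?thesis unfolding eq .
  qed
  moreover have "(\<Sum>\<sigma>\<in>Sh p (r - p). o_act P (r + n) (d + 1 - 2 * int r) \<sigma> (tw_base_comp P \<phi> n d f r p))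
      \<in> ?I" if "p \<in> {1..r}" for p
    using shuffle_sum_invariant[OF tw_base_young[OF f, of p r]] that by simp
  ultimately show "o_diff P (r + n) (d - 2 * int r) (f r)
    - signed d (\<Sum>p=1..r. \<Sum>\<sigma>\<in>Sh p (r - p). o_act P (r + n) (d + 1 - 2 * int r) \<sigma> (tw_base_comp P \<phi> n d f r p))
    \<in> ?I"
    by (intro cl(3) cl(6) cl(7)[OF le_add1, of "{1..r}"]) simp_all
qed

lemma tw_kappa_ins_car:
  assumes "f \<in> tw_car P n d"
  shows "tw_ins P 1 1 n d 1 (tw_kappa \<phi>) f \<in> tw_car P n (d + 1)"
    and "i \<in> {1..n} \<Longrightarrow> tw_ins P n d 1 1 i f (tw_kappa \<phi>) \<in> tw_car P n (d + 1)"
  using tw_ins_car[OF kappa_car assms, of 1] tw_ins_car[OF assms kappa_car, of i]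
  by (auto simp: add.commute)

text \<open>A cyclic rotation of the inputs of the symmetric operation \<open>\<phi> (p' + 1)\<close> moves the insertion from its last
  slot to its first one.\<close>

lemma kappa_comp_rotated:
  assumes n: "n = p' + p" and p: "1 \<le> p"
  defines "\<omega> \<equiv> \<lambda>a. if 1 \<le> a \<and> a \<le> p then a + p' else if p < a \<and> a \<le> n then a - p else a"
  shows "\<omega> permutes {1..n}" "\<omega> ` {1..p} = {p'+1..n}"
    and "o_ins P (p' + 1) (1 - 2 * int p') p (3 - 2 * int p) (p' + 1) (\<phi> (p' + 1)) (\<phi> p) =
     o_act P n (4 - 2 * int n) \<omega>
       (o_ins P (p' + 1) (1 - 2 * int p') p (3 - 2 * int p) 1 (\<phi> (p' + 1)) (\<phi> p))"
proof -
  show "\<omega> permutes {1..n}"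
  proof (rule inj_imp_permutes)
    show "inj_on \<omega> {1..n}"
    proof (rule inj_onI)
      fix a b assume ab: "a \<in> {1..n}" "b \<in> {1..n}" "\<omega> a = \<omega> b"
      show "a = b" using ab unfolding \<omega>_def n by (cases "a \<le> p"; cases "b \<le> p") simp_all
    qed
    show "\<omega> a \<in> {1..n}" if "a \<in> {1..n}" for a
      using that unfolding \<omega>_def n by (cases "a \<le> p") (simp, simp, arith)
    show "\<omega> a = a" if "a \<notin> {1..n}" for a
      using that unfolding \<omega>_def n by auto
  qed simp
  show "\<omega> ` {1..p} = {p'+1..n}"
  proof (intro equalityI subsetI)
    fix b assume b: "b \<in> {p'+1..n}"
    then have "b = \<omega> (b - p')" "b - p' \<in> {1..p}" by (auto simp: \<omega>_def n)
    then show "b \<in> \<omega> ` {1..p}" by blast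
  qed (auto simp: \<omega>_def n)
  define \<tau> where "\<tau> = (\<lambda>a. if a = 1 then p' + 1 else if 2 \<le> a \<and> a \<le> p' + 1 then a - 1 else a)"
  have \<tau>: "\<tau> permutes {1..p'+1}"
  proof (rule inj_imp_permutes)
    show "inj_on \<tau> {1..p'+1}"
    proof (rule inj_onI)
      fix a b assume ab: "a \<in> {1..p'+1}" "b \<in> {1..p'+1}" "\<tau> a = \<tau> b"
      show "a = b" using ab unfolding \<tau>_def by (cases "a = 1"; cases "b = 1") (simp_all; linarith)+
    qed
    show "\<tau> a \<in> {1..p'+1}" if "a \<in> {1..p'+1}" for a
      using that unfolding \<tau>_def by (cases "a = 1") (simp, simp, arith)
    show "\<tau> a = a" if "a \<notin> {1..p'+1}" for a
      using that unfolding \<tau>_def by auto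
  qed simp
  have \<tau>1: "\<tau> 1 = p' + 1" by (simp add: \<tau>_def)
  have f: "\<phi> (p' + 1) \<in> o_invariants P (p' + 1) (p' + 1) (1 - 2 * int p')"
    using phi_invariant[of "p' + 1"] by (simp add: algebra_simps)
  have blk: "block_perm (p' + 1) p 1 \<tau> id = \<omega>"
  proof
    fix a
    consider "a = 0" | "1 \<le> a" "a \<le> p" | "p < a" "a \<le> n" | "n < a" by linarith
    then show "block_perm (p' + 1) p 1 \<tau> id a = \<omega> a"
    proof cases
      case 3
      then have "\<tau> (a + 1 - p) = a - p" "a - p < p' + 1" using n p by (auto simp: \<tau>_def)
      then show ?thesis using 3 n p \<tau>1 by (simp add: block_perm_def \<omega>_def)
    next
      case 4
      then have "\<tau> (a + 1 - p) = a + 1 - p" "\<not> a + 1 - p < p' + 1" using n p by (auto simp: \<tau>_def)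
      then show ?thesis using 4 n p \<tau>1 by (simp add: block_perm_def \<omega>_def)
    qed (use n p in \<open>simp_all add: block_perm_def \<omega>_def \<tau>_def\<close>)
  qed
  have deg: "1 - 2 * int p' + (3 - 2 * int p) = 4 - 2 * int n" "p' + 1 + p - 1 = n" using n by auto
  have "o_ins P (p' + 1) (1 - 2 * int p') p (3 - 2 * int p) (\<tau> 1)
      (o_act P (p' + 1) (1 - 2 * int p') \<tau> (\<phi> (p' + 1))) (o_act P p (3 - 2 * int p) id (\<phi> p)) =
    o_act P n (4 - 2 * int n) \<omega>
       (o_ins P (p' + 1) (1 - 2 * int p') p (3 - 2 * int p) 1 (\<phi> (p' + 1)) (\<phi> p))"
    using equivariance[OF invariants_car[OF f] phi_car[of p] order.refl le_add2 \<tau> permutes_id]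
    unfolding blk deg .
  then show "o_ins P (p' + 1) (1 - 2 * int p') p (3 - 2 * int p) (p' + 1) (\<phi> (p' + 1)) (\<phi> p) =
     o_act P n (4 - 2 * int n) \<omega>
       (o_ins P (p' + 1) (1 - 2 * int p') p (3 - 2 * int p) 1 (\<phi> (p' + 1)) (\<phi> p))"
    unfolding \<tau>1 act_id[OF phi_car] invariants_act[OF f \<tau>] .
qed

text \<open>In position \<open>r\<close> put \<open>n = r + 1\<close>. The relation for \<open>\<phi> n\<close> sums \<open>\<phi> (n - p + 1) \<circ>\<^sub>1 \<phi> p\<close> over the subsets
  \<open>A\<close> of \<open>{1..n}\<close> with \<open>p\<close> elements, the labels of the inner operation. The subsets without \<open>n\<close> give the
  second summand of the differential of \<open>\<kappa>\<close>. A subset that contains \<open>n\<close> is the complement of a subset of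
  \<open>{1..r}\<close> with \<open>n - p\<close> elements, which labels the special inputs of the outer factor in \<open>\<kappa> \<circ>\<^sub>1 \<kappa>\<close>.\<close>

lemma kappa_square:
  "tw_base_diff P \<phi> 1 1 (tw_kappa \<phi>) + tw_ins P 1 1 1 1 1 (tw_kappa \<phi>) (tw_kappa \<phi>) = 0"
proof
  fix r
  define n where "n = Suc r"
  define y where "y p = o_ins P (n - p + 1) (3 - 2 * int (n - p + 1)) p (3 - 2 * int p) 1
              (\<phi> (n - p + 1)) (\<phi> p)" for p
  let ?A = "o_act P n (4 - 2 * int n)" and ?KK = "tw_comp P 1 1 1 1 1 (tw_kappa \<phi>) (tw_kappa \<phi>)"
  define S2 where "S2 p = (\<Sum>\<sigma>\<in>Sh p (r - p). ?A \<sigma> (y p))" for p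
  define S3 where "S3 p' = (\<Sum>\<sigma>\<in>Sh p' (r - p'). ?A \<sigma> (?KK p' (r - p')))"
    for p'
  have young: "y p \<in> young_invariants P p (n - p) n (4 - 2 * int n)" if "1 \<le> p" "p \<le> n" for p
    unfolding y_def by (rule ins_first_young[OF _ phi_invariant])
        (use that phi_invariant[of "n - p + 1"] in auto)
  \<comment> \<open>For \<open>p = n\<close> the inner operation takes all inputs, in particular \<open>n\<close>, so only the second kind occurs.\<close>
  have split: "(\<Sum>\<sigma>\<in>Sh p (n - p). ?A \<sigma> (y p)) = (if p = n then 0 else S2 p) + S3 (n - p)"
    if p: "1 \<le> p" "p \<le> n" for p
  proof -
    have np: "p + (n - p) = n" using p by simp
    define p' where "p' = n - p"
    have p': "n = p' + p" "p' \<le> r" "r - p' = p - 1" "p' + (p - 1) = r" using p by (auto simp: p'_def n_def)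
    have yc: "y p \<in> o_car P n (4 - 2 * int n)" using young[OF p] by (simp add: young_invariants_def)
    obtain Y where Y: "\<And>\<pi>. \<pi> permutes {1..n} \<Longrightarrow> ?A \<pi> (y p) = Y (\<pi> ` {1..p})"
      using young_coset_function[OF young[OF p]] unfolding np by auto
    have rn: "{1..n} = insert n {1..r}" "n \<notin> {1..r}" by (auto simp: n_def)
    have perm: "\<sigma> permutes {1..n}" if "\<sigma> permutes {1..r}" for \<sigma>
      using permutes_le[OF that] by (simp add: n_def)
    have "(\<Sum>\<sigma>\<in>Sh p (n - p). ?A \<sigma> (y p)) = (\<Sum>\<sigma>\<in>Sh p (n - p). Y (\<sigma> ` {1..p}))"
      by (rule sum.cong[OF refl]) (rule Y, use Sh_permutes np in metis)
    also have "\<dots> = (\<Sum>A | A \<subseteq> {1..n} \<and> card A = p. Y A)"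
      unfolding sum_Sh_subsets np ..
    also have "{A. A \<subseteq> {1..n} \<and> card A = p} =
      {A. A \<subseteq> {1..r} \<and> card A = p} \<union> (\<lambda>B. {1..n} - B) ` {B. B \<subseteq> {1..r} \<and> card B = p'}"
    proof (intro equalityI subsetI)
      fix A assume "A \<in> {A. A \<subseteq> {1..n} \<and> card A = p}"
      then have A: "A \<subseteq> {1..n}" "card A = p" by auto
      have fA: "finite A" using A(1) finite_subset by blast
      show "A \<in> {A. A \<subseteq> {1..r} \<and> card A = p} \<union> (\<lambda>B. {1..n} - B) ` {B. B \<subseteq> {1..r} \<and> card B = p'}"
      proof (cases "n \<in> A")
        case False
        then show ?thesis using A rn by auto
      next
        case True
        have "{1..n} - A \<subseteq> {1..r}" using True rn by auto
        moreover have "card ({1..n} - A) = p'" using A fA by (simp add: card_Diff_subset p'_def)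
        moreover have "A = {1..n} - ({1..n} - A)" using A by auto
        ultimately show ?thesis by blast
      qed
    next
      fix A assume "A \<in> {A. A \<subseteq> {1..r} \<and> card A = p} \<union> (\<lambda>B. {1..n} - B) ` {B. B \<subseteq> {1..r} \<and> card B = p'}"
      then consider "A \<subseteq> {1..r}" "card A = p" | B where "B \<subseteq> {1..r}" "card B = p'" "A = {1..n} - B" by blast
      then show "A \<in> {A. A \<subseteq> {1..n} \<and> card A = p}"
      proof cases
        case 1
        then show ?thesis using rn by auto
      next
        case 2
        then have "finite B" "B \<subseteq> {1..n}" using finite_subset rn by auto
        then show ?thesis using 2 p' by (auto simp: card_Diff_subset)
      qed
    qed
    also have "(\<Sum>A\<in>\<dots>. Y A) = (\<Sum>A | A \<subseteq> {1..r} \<and> card A = p. Y A) +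
        (\<Sum>A\<in>(\<lambda>B. {1..n} - B) ` {B. B \<subseteq> {1..r} \<and> card B = p'}. Y A)"
    proof (rule sum.union_disjoint)
      have "n \<in> {1..n} - B" if "B \<subseteq> {1..r}" for B using that rn by blast
      then show "{A. A \<subseteq> {1..r} \<and> card A = p} \<inter> (\<lambda>B. {1..n} - B) ` {B. B \<subseteq> {1..r} \<and> card B = p'} = {}"
        using rn(2) by blast
    qed auto
    also have "(\<Sum>A\<in>(\<lambda>B. {1..n} - B) ` {B. B \<subseteq> {1..r} \<and> card B = p'}. Y A) =
      (\<Sum>B | B \<subseteq> {1..r} \<and> card B = p'. Y ({1..n} - B))"
      by (subst sum.reindex) (use rn in \<open>auto simp: inj_on_def\<close>)
    also have "\<dots> = (\<Sum>\<sigma>\<in>Sh p' (r - p'). Y ({1..n} - \<sigma> ` {1..p'}))"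
      using sum_Sh_subsets[of "\<lambda>B. Y ({1..n} - B)" p' "r - p'"] p' by simp
    also have "\<dots> = S3 p'"
      unfolding S3_def
    proof (rule sum.cong[OF refl])
      fix \<sigma> assume s: "\<sigma> \<in> Sh p' (r - p')"
      have \<sigma>: "\<sigma> permutes {1..n}" using perm Sh_permutes[OF s] p' by simp
      note rot = kappa_comp_rotated[OF p'(1) p(1)]
      have yeq: "y p = o_ins P (p' + 1) (1 - 2 * int p') p (3 - 2 * int p) 1 (\<phi> (p' + 1)) (\<phi> p)"
        by (simp add: y_def p'_def algebra_simps)
      have ar: "p' + (r - p') + 1 + 1 - 1 = n" "1 + 1 - 2 * int (p' + (r - p')) = 4 - 2 * int n"
        "r - p' + 1 = p" "1 - 2 * int (r - p') = 3 - 2 * int p"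
        using p' p by (auto simp: n_def)
      have eq: "?KK p' (r - p') =
          o_ins P (p' + 1) (1 - 2 * int p') p (3 - 2 * int p) (p' + 1) (\<phi> (p' + 1)) (\<phi> p)"
        unfolding tw_comp_def slot_perm_first ar tw_kappa_def
        by (rule act_id) (subst rot(3), rule act_car[OF rot(1)], use yc yeq in simp)
      have "?A \<sigma> (?KK p' (r - p')) =
          ?A (\<sigma> \<circ> (\<lambda>a. if 1 \<le> a \<and> a \<le> p then a + p' else if p < a \<and> a \<le> n then a - p else a)) (y p)"
        unfolding eq rot(3) yeq[symmetric] by (rule act_comp[OF \<sigma> rot(1) yc, symmetric])
      also have "\<dots> = Y (\<sigma> ` {p'+1..n})"
        unfolding Y[OF permutes_compose[OF rot(1) \<sigma>]] image_comp[symmetric] rot(2) ..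
      also have "{p'+1..n} = {1..n} - {1..p'}" using p' by auto
      also have "\<sigma> ` \<dots> = {1..n} - \<sigma> ` {1..p'}"
        unfolding image_set_diff[OF permutes_inj[OF \<sigma>]] permutes_image[OF \<sigma>] ..
      finally show "Y ({1..n} - \<sigma> ` {1..p'}) =
        ?A \<sigma> (?KK p' (r - p'))" by simp
    qed
    also have "(\<Sum>A | A \<subseteq> {1..r} \<and> card A = p. Y A) = (if p = n then 0 else S2 p)"
    proof (cases "p = n")
      case True
      have "card A \<noteq> p" if "A \<subseteq> {1..r}" for A using card_mono[OF _ that] True by (simp add: n_def)
      then have none: "{A. A \<subseteq> {1..r} \<and> card A = p} = {}" by blast
      show ?thesis unfolding none using True by simp
    next
      case False
      then have pr: "p + (r - p) = r" using p by (simp add: n_def)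
      have "S2 p = (\<Sum>\<sigma>\<in>Sh p (r - p). Y (\<sigma> ` {1..p}))"
        unfolding S2_def by (rule sum.cong[OF refl]) (rule Y, use perm Sh_permutes pr in metis)
      then show ?thesis using False sum_Sh_subsets[of Y p "r - p"] pr by simp
    qed
    finally show ?thesis by (simp add: p'_def)
  qed
  have "(\<Sum>p=1..n. \<Sum>\<sigma>\<in>Sh p (n - p). ?A \<sigma> (y p)) = (\<Sum>p=1..n. if p = n then 0 else S2 p) + (\<Sum>p=1..n. S3 (n - p))"
    unfolding sum.distrib[symmetric] by (rule sum.cong[OF refl]) (rule split, simp_all)
  also have "(\<Sum>p=1..n. if p = n then 0 else S2 p) = (\<Sum>p=1..r. S2 p)"
    by (simp add: n_def)
  also have "(\<Sum>p=1..n. S3 (n - p)) = (\<Sum>p\<le>r. S3 p)"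
    by (rule sum.reindex_bij_witness[of _ "\<lambda>p. n - p" "\<lambda>p. n - p"]) (auto simp: n_def)
  finally have key: "o_diff P n (3 - 2 * int n) (\<phi> n) + ((\<Sum>p=1..r. S2 p) + (\<Sum>p\<le>r. S3 p)) = 0"
    using phi_diff[of n] by (simp add: n_def y_def)
  have e1: "tw_base_diff P \<phi> 1 1 (tw_kappa \<phi>) r = o_diff P n (3 - 2 * int n) (\<phi> n) + (\<Sum>p=1..r. S2 p)"
  proof -
    have ar: "r + 1 = n" "1 - 2 * int r = 3 - 2 * int n" "1 + 1 - 2 * int r = 4 - 2 * int n"
      by (auto simp: n_def)
    have "(\<Sum>p=1..r. S2 p) = (\<Sum>p=1..r. \<Sum>\<sigma>\<in>Sh p (r - p). ?A \<sigma>
       (o_ins P (r - p + 1 + 1) (1 - 2 * int (r - p + 1)) p (3 - 2 * int p) 1 (\<phi> (r - p + 1 + 1)) (\<phi> p)))"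
    proof (rule sum.cong[OF refl])
      fix p assume "p \<in> {1..r}"
      then have "n - p + 1 = r - p + 1 + 1" "3 - 2 * int (n - p + 1) = 1 - 2 * int (r - p + 1)"
        by (auto simp: n_def)
      then show "S2 p = (\<Sum>\<sigma>\<in>Sh p (r - p). ?A \<sigma>
       (o_ins P (r - p + 1 + 1) (1 - 2 * int (r - p + 1)) p (3 - 2 * int p) 1 (\<phi> (r - p + 1 + 1)) (\<phi> p)))"
        by (simp only: S2_def y_def)
    qed
    then show ?thesis unfolding tw_base_diff_def tw_kappa_def ar by (simp add: signed_def)
  qed
  have e2: "tw_ins P 1 1 1 1 1 (tw_kappa \<phi>) (tw_kappa \<phi>) r = (\<Sum>p\<le>r. S3 p)"
  proof -
    have ar: "r + 1 + 1 - 1 = n" "1 + 1 - 2 * int r = 4 - 2 * int n" by (auto simp: n_def)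
    show ?thesis unfolding tw_ins_eq[OF kappa_car kappa_car order.refl order.refl] ar S3_def ..
  qed
  show "(tw_base_diff P \<phi> 1 1 (tw_kappa \<phi>) + tw_ins P 1 1 1 1 1 (tw_kappa \<phi>) (tw_kappa \<phi>)) r = 0 r"
    using key e1 e2 by (simp add: add.assoc)
qed

end


section \<open>Series in a complete filtered complex\<close>

text \<open>The error of the \<open>k\<close>-th partial sum is required to lie in \<open>F\<^sub>k\<close>. Every series whose \<open>r\<close>-th term lies in
  \<open>F\<^sub>r\<close> converges at this rate, and fixing the rate makes termwise arguments immediate.\<close>

definition series_sum ::
  "('k, 'v::ab_group_add, 'z) filtered_cochains_scheme \<Rightarrow> int \<Rightarrow> (nat \<Rightarrow> 'v) \<Rightarrow> 'v \<Rightarrow> bool"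
  where "series_sum V d t y \<longleftrightarrow> y \<in> c_car V d \<and> (\<forall>k. y - (\<Sum>r<k. t r) \<in> c_filt V k d)"

context complete_filtered_complex
begin

lemmas car_closed = subspace_closed[OF vector_space subspace]
lemmas filt_closed = subspace_closed[OF vector_space filt_subspace]

lemma filt_mono: "k \<le> l \<Longrightarrow> x \<in> c_filt V l d \<Longrightarrow> x \<in> c_filt V k d"
  using lift_Suc_antimono_le[of "\<lambda>k. c_filt V k d", OF filt_descending] by blast

lemma filt_car: "x \<in> c_filt V k d \<Longrightarrow> x \<in> c_car V d"
  using filt_mono[of 0 k x d] by (simp add: filt_0)

text \<open>A term is the difference of two consecutive errors.\<close>

lemma series_term:
  assumes "series_sum V d t y"
  shows "t k \<in> c_filt V k d"
proof -
  have "y - (\<Sum>r<k. t r) \<in> c_filt V k d" "y - (\<Sum>r<Suc k. t r) \<in> c_filt V k d"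
    using assms filt_mono[of k "Suc k", OF _ assms[unfolded series_sum_def, THEN conjunct2, rule_format]]
    unfolding series_sum_def by auto
  from filt_closed(3)[OF this] show ?thesis by (simp add: algebra_simps)
qed

lemma series_exists:
  assumes "\<And>k. t k \<in> c_filt V k d"
  shows "\<exists>!y. series_sum V d t y"
proof -
  have "\<exists>!y. y \<in> c_car V d \<and> (\<forall>k. y - (\<Sum>r<k. t r) \<in> c_filt V k d)"
    by (rule filt_complete) (use assms filt_car in \<open>auto intro!: car_closed(7)\<close>)
  then show ?thesis by (simp add: series_sum_def)
qed

lemma series_unique: "series_sum V d t y \<Longrightarrow> series_sum V d t z \<Longrightarrow> y = z"
  using series_exists[of t d] series_term by blast

lemma series_add: "series_sum V d t y \<Longrightarrow> series_sum V d s z \<Longrightarrow> series_sum V d (\<lambda>r. t r + s r) (y + z)"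
  unfolding series_sum_def using filt_closed(2) car_closed(2)
  by (fastforce simp: sum.distrib add_diff_add)

lemma series_diff:
  assumes "series_sum V d t y" "series_sum V d s z"
  shows "series_sum V d (\<lambda>r. t r - s r) (y - z)"
proof -
  have "y - z - (\<Sum>r<k. t r - s r) = (y - (\<Sum>r<k. t r)) - (z - (\<Sum>r<k. s r))" for k
    by (simp add: sum_subtractf algebra_simps)
  then show ?thesis
    unfolding series_sum_def using assms filt_closed(3) car_closed(3)
    by (simp only: series_sum_def) blast
qed

lemma series_signed:
  assumes "series_sum V d t y"
  shows "series_sum V d (\<lambda>r. signed k (t r)) (signed k y)"
  using assms filt_closed(6) car_closed(6) unfolding series_sum_def
  by (auto simp: signed_sum[symmetric] signed_diff[symmetric])

lemma series_zero: "series_sum V d (\<lambda>r. 0) 0"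
  unfolding series_sum_def using filt_closed(1) car_closed(1) by simp

lemma series_single:
  assumes "y \<in> c_filt V j d"
  shows "series_sum V d (\<lambda>r. if r = j then y else 0) y"
  unfolding series_sum_def
proof (intro conjI allI)
  show "y \<in> c_car V d" using filt_car[OF assms] .
  fix k
  have "(\<Sum>r<k. if r = j then y else 0) = (if j < k then y else 0)" by simp
  then show "y - (\<Sum>r<k. if r = j then y else 0) \<in> c_filt V k d"
    using filt_mono[OF _ assms, of k] filt_closed(1) by simp
qed

lemma series_finite_sum:
  "(\<And>i. i \<in> I \<Longrightarrow> series_sum V d (t i) (y i)) \<Longrightarrow> series_sum V d (\<lambda>r. \<Sum>i\<in>I. t i r) (\<Sum>i\<in>I. y i)"
  by (induction I rule: infinite_finite_induct) (auto intro: series_add series_zero)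

lemma series_filtered:
  assumes y: "series_sum V d t y" and t: "\<And>r. t r \<in> c_filt V k d"
  shows "y \<in> c_filt V k d"
proof -
  have "y - (\<Sum>r<k. t r) \<in> c_filt V k d" using y by (simp add: series_sum_def)
  moreover have "(\<Sum>r<k. t r) \<in> c_filt V k d" by (rule filt_closed(7)) (rule t)
  ultimately show ?thesis using filt_closed(2) by fastforce
qed

text \<open>The tails of the inner sums are controlled by the index of the outer one, so the terms can be
  collected along the diagonals.\<close>

lemma series_diagonal:
  assumes y: "series_sum V d Y y"
    and tail: "\<And>p m. Y p - (\<Sum>q<m. T p q) \<in> c_filt V (p + m) d"
  shows "series_sum V d (\<lambda>r. \<Sum>p\<le>r. T p (r - p)) y"
  unfolding series_sum_def
proof (intro conjI allI)
  show "y \<in> c_car V d" using y by (simp add: series_sum_def)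
  fix k
  have "(\<Sum>r<k. \<Sum>p\<le>r. T p (r - p)) = (\<Sum>(p,q)\<in>{(p,q). p + q < k}. T p q)"
    by (rule sum.triangle_reindex[symmetric])
  also have "{(p,q). p + q < k} = Sigma {..<k} (\<lambda>p. {..<k-p})" by auto
  also have "(\<Sum>(p,q)\<in>\<dots>. T p q) = (\<Sum>p<k. \<Sum>q<k-p. T p q)"
    by (rule sum.Sigma[symmetric]) auto
  finally have eq: "y - (\<Sum>r<k. \<Sum>p\<le>r. T p (r - p)) = (y - (\<Sum>p<k. Y p)) + (\<Sum>p<k. Y p - (\<Sum>q<k-p. T p q))"
    by (simp add: sum_subtractf)
  have "(\<Sum>p<k. Y p - (\<Sum>q<k-p. T p q)) \<in> c_filt V k d"
  proof (rule filt_closed(7))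
    fix p assume "p \<in> {..<k}"
    then show "Y p - (\<Sum>q<k-p. T p q) \<in> c_filt V k d" using tail[of p "k - p"] by simp
  qed
  then show "y - (\<Sum>r<k. \<Sum>p\<le>r. T p (r - p)) \<in> c_filt V k d"
    unfolding eq using y by (intro filt_closed(2)) (simp_all add: series_sum_def)
qed

text \<open>If the \<open>r\<close>-th term lies in \<open>F\<^sub>r\<close>, then from the \<open>k\<close>-th one on the partial sums are constant modulo \<open>F\<^sub>k\<close>,
  so that convergence at an unspecified rate is convergence at rate \<open>k\<close>.\<close>

lemma filt_sums_iff_series:
  assumes t: "\<And>r. t r \<in> c_filt V r d" and z: "t 0 = 0" "t 1 = 0"
  shows "(\<exists>N0. \<forall>N\<ge>N0. s - (\<Sum>n=2..N. t n) \<in> c_filt V k d) \<longleftrightarrow> s - (\<Sum>r<k. t r) \<in> c_filt V k d"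
proof -
  have eq: "(\<Sum>n=2..N. t n) = (\<Sum>n<Suc N. t n)" for N
    by (rule sum.mono_neutral_left)
      (use z in \<open>auto simp: not_le less_Suc_eq_le numeral_2_eq_2 le_Suc_eq\<close>)
  have iff: "s - (\<Sum>r<M. t r) \<in> c_filt V k d \<longleftrightarrow> s - (\<Sum>r<k. t r) \<in> c_filt V k d" if "k \<le> M" for M
  proof -
    have "(\<Sum>r<M. t r) = (\<Sum>r<k. t r) + (\<Sum>r=k..<M. t r)"
      using sum.atLeastLessThan_concat[of 0 k M t] that by (simp add: lessThan_atLeast0)
    moreover have "(\<Sum>r=k..<M. t r) \<in> c_filt V k d"
      by (rule filt_closed(7)) (use t filt_mono in auto)
    ultimately show ?thesis
      using filt_closed(2)[of "s - (\<Sum>r<M. t r)" k d "\<Sum>r=k..<M. t r"]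
        filt_closed(3)[of "s - (\<Sum>r<k. t r)" k d "\<Sum>r=k..<M. t r"]
      by (auto simp: algebra_simps)
  qed
  show ?thesis
    unfolding eq
  proof
    assume "\<exists>N0. \<forall>N\<ge>N0. s - (\<Sum>n<Suc N. t n) \<in> c_filt V k d"
    then obtain N0 where N0: "\<forall>N\<ge>N0. s - (\<Sum>n<Suc N. t n) \<in> c_filt V k d" by blast
    then have "s - (\<Sum>n<Suc (max N0 k). t n) \<in> c_filt V k d" by simp
    then show "s - (\<Sum>r<k. t r) \<in> c_filt V k d" by (subst (asm) iff) auto
  next
    assume "s - (\<Sum>r<k. t r) \<in> c_filt V k d"
    then have "\<forall>N\<ge>k. s - (\<Sum>n<Suc N. t n) \<in> c_filt V k d" using iff[of "Suc N" for N] by simp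
    then show "\<exists>N0. \<forall>N\<ge>N0. s - (\<Sum>n<Suc N. t n) \<in> c_filt V k d" by blast
  qed
qed

end

text \<open>The shift \<open>l\<close> of the filtration provides the tail estimates for the rows of a double series.\<close>

lemma series_map:
  assumes V: "complete_filtered_complex V"
    and g: "linear_on (c_scale V) s (c_car V d) (c_car W d') g"
    and filt: "\<And>k x. x \<in> c_filt V k d \<Longrightarrow> g x \<in> c_filt W (l + k) d'"
    and y: "series_sum V d t y"
  shows "g y - (\<Sum>r<k. g (t r)) \<in> c_filt W (l + k) d'" "l = 0 \<Longrightarrow> series_sum W d' (\<lambda>r. g (t r)) (g y)"
proof -
  interpret V: complete_filtered_complex V by fact
  note lin = linear_on_derived[OF V.vector_space V.subspace g]
  have t: "t r \<in> c_car V d" for r using V.series_term[OF y] V.filt_car by blast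
  have yc: "y \<in> c_car V d" using y by (simp add: series_sum_def)
  have 1: "g y - (\<Sum>r<k. g (t r)) = g (y - (\<Sum>r<k. t r))" for k
  proof -
    have "(\<Sum>r<k. t r) \<in> c_car V d" by (rule V.car_closed(7)) (rule t)
    moreover have "g (\<Sum>r<k. t r) = (\<Sum>r<k. g (t r))" by (rule lin(5)) (rule t)
    ultimately show ?thesis using lin(3)[OF yc] by simp
  qed
  show 2: "g y - (\<Sum>r<k. g (t r)) \<in> c_filt W (l + k) d'" for k
    unfolding 1 by (rule filt) (use y in \<open>simp add: series_sum_def\<close>)
  show "series_sum W d' (\<lambda>r. g (t r)) (g y)" if "l = 0"
    using 2 linear_on_in[OF g yc] that by (simp add: series_sum_def)
qed


section \<open>Evaluation in the endomorphism operad\<close>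

lemma hvecs_append:
  "xs @ ys \<in> hvecs V n \<longleftrightarrow> length xs \<le> n \<and> xs \<in> hvecs V (length xs) \<and> ys \<in> hvecs V (n - length xs)"
  by (auto simp: hvecs_def)

lemma hvecs_Nil [simp]: "[] \<in> hvecs V n \<longleftrightarrow> n = 0"
  by (auto simp: hvecs_def)

lemma hvecs_Cons [simp]: "(d, x) # xs \<in> hvecs V n \<longleftrightarrow> n \<noteq> 0 \<and> x \<in> c_car V d \<and> xs \<in> hvecs V (n - 1)"
  by (auto simp: hvecs_def)

lemma hvecs_length: "xs \<in> hvecs V n \<Longrightarrow> length xs = n"
  by (simp add: hvecs_def)

lemma hvecs_appendI: "xs \<in> hvecs V a \<Longrightarrow> ys \<in> hvecs V b \<Longrightarrow> xs @ ys \<in> hvecs V (a + b)"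
  by (auto simp: hvecs_def)

lemma hvecs_replicate: "x \<in> c_car V d \<Longrightarrow> replicate r (d, x) \<in> hvecs V r"
  by (auto simp: hvecs_def)

lemma hvecs_take: "xs \<in> hvecs V n \<Longrightarrow> j \<le> n \<Longrightarrow> take j xs \<in> hvecs V j"
  and hvecs_drop: "xs \<in> hvecs V n \<Longrightarrow> drop j xs \<in> hvecs V (n - j)"
  by (auto simp: hvecs_def dest: in_set_takeD in_set_dropD)

lemma hvecs_nth: "xs \<in> hvecs V n \<Longrightarrow> j < n \<Longrightarrow> snd (xs ! j) \<in> c_car V (fst (xs ! j))"
proof -
  assume a: "xs \<in> hvecs V n" "j < n"
  then have "xs ! j \<in> set xs" by (simp add: hvecs_def)
  then show ?thesis using a by (cases "xs ! j") (auto simp: hvecs_def)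
qed

lemma tdeg_Nil [simp]: "tdeg [] = 0"
  and tdeg_Cons [simp]: "tdeg (x # xs) = fst x + tdeg xs"
  and tdeg_append [simp]: "tdeg (xs @ ys) = tdeg xs + tdeg ys"
  and tdeg_replicate [simp]: "tdeg (replicate r (d, y)) = int r * d"
  by (simp_all add: tdeg_def sum_list_replicate)

lemma end_car_in: "f \<in> end_car V n d \<Longrightarrow> xs \<in> hvecs V n \<Longrightarrow> f xs \<in> c_car V (tdeg xs + d)"
  and end_car_outside: "f \<in> end_car V n d \<Longrightarrow> xs \<notin> hvecs V n \<Longrightarrow> f xs = 0"
  by (auto simp: end_car_def)

lemma end_car_linear:
  "f \<in> end_car V n d \<Longrightarrow> xs \<in> hvecs V a \<Longrightarrow> ys \<in> hvecs V b \<Longrightarrow> a + 1 + b = n \<Longrightarrow>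
    linear_on (c_scale V) (c_scale V) (c_car V e) (c_car V (tdeg xs + e + tdeg ys + d))
         (\<lambda>x. f (xs @ (e, x) # ys))"
  using hvecs_length[of xs V a] hvecs_length[of ys V b] by (auto simp: end_car_def)

lemma end_ins_eval:
  assumes "ys @ zs @ ws \<in> hvecs V (n + m - 1)" "length ys = i - 1" "length zs = m"
  shows "end_ins V n d m e i f g (ys @ zs @ ws) = signed (e * tdeg ys) (f (ys @ (tdeg zs + e, g zs) # ws))"
  using assms by (simp add: end_ins_def Let_def)

text \<open>The Koszul sign is the parity of a sum over the inversions, all of whose terms are even here.\<close>

lemma end_act_eval:
  assumes "xs \<in> hvecs V n"
    and "\<And>a b. 1 \<le> a \<Longrightarrow> a < b \<Longrightarrow> b \<le> n \<Longrightarrow> \<sigma> b < \<sigma> a \<Longrightarrow>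
      even (fst (xs ! (\<sigma> a - 1))) \<or> even (fst (xs ! (\<sigma> b - 1)))"
  shows "end_act V n d \<sigma> f xs = f (map (\<lambda>j. xs ! (\<sigma> j - 1)) [1..<n+1])"
  using assms(1) unfolding end_act_def
  by (simp only: if_True) (rule signed_even, rule dvd_sum, use assms(2) in auto)

text \<open>The permuted arguments are equal, and of even degree.\<close>

lemma end_act_special:
  assumes \<sigma>: "\<sigma> permutes {1..r}" and x: "x \<in> c_car V 2" and xs: "xs \<in> hvecs V n" and N: "N = r + n"
  shows "end_act V N d \<sigma> f (replicate r (2, x) @ xs) = f (replicate r (2, x) @ xs)"
proof -
  let ?v = "replicate r (2, x) @ xs"
  note fx = permutes_atLeastAtMost_fixes[OF \<sigma>]
  have v: "?v \<in> hvecs V N" unfolding N by (rule hvecs_appendI[OF hvecs_replicate[OF x] xs])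
  have "map (\<lambda>j. ?v ! (\<sigma> j - 1)) [1..<N+1] = ?v"
  proof (rule nth_equalityI)
    fix j assume "j < length (map (\<lambda>j. ?v ! (\<sigma> j - 1)) [1..<N+1])"
    then have j: "j < N" by (simp del: upt_Suc)
    show "map (\<lambda>j. ?v ! (\<sigma> j - 1)) [1..<N+1] ! j = ?v ! j"
    proof (cases "j < r")
      case True
      then have "Suc j \<in> {1..r}" by simp
      then have "\<sigma> (Suc j) \<in> {1..r}" using fx(3) by blast
      then show ?thesis using True j by (auto simp: nth_append simp del: upt_Suc)
    next
      case False
      then show ?thesis using fx(2)[of "Suc j"] j by (simp add: nth_append del: upt_Suc)
    qed
  qed (use v in \<open>simp add: hvecs_def\<close>)
  moreover have "end_act V N d \<sigma> f ?v = f (map (\<lambda>j. ?v ! (\<sigma> j - 1)) [1..<N+1])"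
  proof (rule end_act_eval[OF v])
    fix a b assume ab: "1 \<le> a" "a < b" "b \<le> N" "\<sigma> b < \<sigma> a"
    have "even (fst (?v ! (\<sigma> c - 1)))" if "c \<in> {1..r}" for c
    proof -
      have "\<sigma> c \<in> {1..r}" using fx(3) that by blast
      then show ?thesis by (auto simp: nth_append)
    qed
    moreover have "a \<in> {1..r}" using ab fx(2)[of a] fx(2)[of b] by (cases "a \<le> r") auto
    ultimately show "even (fst (?v ! (\<sigma> a - 1))) \<or> even (fst (?v ! (\<sigma> b - 1)))" by blast
  qed
  ultimately show ?thesis by simp
qed

text \<open>Only arguments equal to \<open>x\<close>, of even degree, move past others.\<close>

lemma end_act_slot_perm:
  assumes x: "x \<in> c_car V 2" and ys: "ys \<in> hvecs V (i - 1)" and zs: "zs \<in> hvecs V k"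
    and i: "1 \<le> i" and N: "N = p + q + (i - 1) + k"
  shows "end_act V N d (slot_perm p q i) f (replicate (p + q) (2, x) @ ys @ zs) =
    f (replicate p (2, x) @ ys @ replicate q (2, x) @ zs)"
proof -
  let ?v = "replicate (p + q) (2, x) @ ys @ zs" and ?w = "slot_perm p q i"
  have len: "length ys = i - 1" "length zs = k" using ys zs hvecs_length by auto
  have v: "?v \<in> hvecs V N"
    unfolding N using hvecs_appendI[OF hvecs_replicate[OF x, of "p + q"] hvecs_appendI[OF ys zs]]
    by (simp add: add.assoc)
  have "map (\<lambda>j. ?v ! (?w j - 1)) [1..<N+1] = replicate p (2, x) @ ys @ replicate q (2, x) @ zs"
    (is "?l = ?r")
  proof (rule nth_equalityI)
    show "length ?l = length ?r" using len N by (simp del: upt_Suc)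
    fix j assume "j < length ?l"
    then have j: "j < N" by (simp del: upt_Suc)
    then have "?l ! j = ?v ! (?w (Suc j) - 1)" by (simp del: upt_Suc)
    also have "\<dots> = ?r ! j"
    proof -
      consider "j < p" | "p \<le> j" "j + 1 < p + i" | "p + i \<le> j + 1" "j + 1 < p + i + q" | "p + i + q \<le> j + 1"
        by linarith
      then show ?thesis
      proof cases
        case 1
        then have "?w (Suc j) - 1 = j" using i by (simp add: slot_perm_def)
        then show ?thesis using 1 by (simp add: nth_append)
      next
        case 2
        then have "?w (Suc j) - 1 = p + q + (j - p)" "j - p < length ys" using i len
          by (auto simp: slot_perm_def)
        then show ?thesis using 2 by (simp add: nth_append)
      next
        case 3
        then have "?w (Suc j) - 1 < p + q" "\<not> j - p < length ys" "\<not> j < p" "j - p - length ys < q"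
          using i len by (auto simp: slot_perm_def)
        then show ?thesis by (simp add: nth_append)
      next
        case 4
        then have "?w (Suc j) - 1 = j" "\<not> j < p + q" "\<not> j - (p + q) < length ys" "\<not> j - p < length ys"
          "\<not> j < p" "\<not> j - p - length ys < q" "j - (p + q) - length ys = j - p - length ys - q"
          using i len by (auto simp: slot_perm_def)
        then show ?thesis by (simp add: nth_append)
      qed
    qed
    finally show "?l ! j = ?r ! j" .
  qed
  moreover have "end_act V N d ?w f ?v = f (map (\<lambda>j. ?v ! (?w j - 1)) [1..<N+1])"
  proof (rule end_act_eval[OF v])
    fix a b assume ab: "1 \<le> a" "a < b" "b \<le> N" "?w b < ?w a"
    have "1 \<le> ?w c" if "1 \<le> c" for c using that i by (auto simp: slot_perm_def)
    moreover have "?w b \<le> p + q"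
      using ab i unfolding slot_perm_def by (simp split: if_splits)
    moreover have "1 \<le> b" using ab by simp
    ultimately have "?w b - 1 < p + q" by (meson diff_less less_le_trans less_one zero_less_one le_less_trans)
    then show "even (fst (?v ! (?w a - 1))) \<or> even (fst (?v ! (?w b - 1)))" by (simp add: nth_append)
  qed
  ultimately show ?thesis by simp
qed

text \<open>All inversions are among the last \<open>n\<close> arguments, so the Koszul signs on both sides agree.\<close>

lemma end_act_tw_shift:
  assumes \<sigma>: "\<sigma> permutes {1..n}" and x: "x \<in> c_car V 2" and xs: "xs \<in> hvecs V n"
  shows "end_act V (r + n) d (tw_shift r \<sigma>) f (replicate r (2, x) @ xs) =
    end_act V n e \<sigma> (\<lambda>ys. f (replicate r (2, x) @ ys)) xs"
proof -
  let ?v = "replicate r (2, x) @ xs" and ?s = "tw_shift r \<sigma>"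
  note fx = permutes_atLeastAtMost_fixes[OF \<sigma>]
  have v: "?v \<in> hvecs V (r + n)" by (rule hvecs_appendI[OF hvecs_replicate[OF x] xs])
  have ge: "1 \<le> \<sigma> a" if "1 \<le> a" for a
    using that fx(3)[of a] fx(2)[of a] by (cases "a \<le> n") auto
  have nth: "?v ! (?s (r + a) - 1) = xs ! (\<sigma> a - 1)" if "1 \<le> a" for a
  proof -
    have "\<not> ?s (r + a) - 1 < r" "?s (r + a) - 1 - r = \<sigma> a - 1"
      using ge[OF that] that by (auto simp: tw_shift_def)
    then show ?thesis by (simp add: nth_append)
  qed
  have sgn: "(\<Sum>(a, b)\<in>{(a, b). 1 \<le> a \<and> a < b \<and> b \<le> r + n \<and> ?s b < ?s a}.
                 fst (?v ! (?s a - 1)) * fst (?v ! (?s b - 1))) =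
     (\<Sum>(a, b)\<in>{(a, b). 1 \<le> a \<and> a < b \<and> b \<le> n \<and> \<sigma> b < \<sigma> a}.
                 fst (xs ! (\<sigma> a - 1)) * fst (xs ! (\<sigma> b - 1)))"
  proof (rule sum.reindex_bij_witness[where i = "\<lambda>(a, b). (r + a, r + b)" and j = "\<lambda>(a, b). (a - r, b - r)"])
    fix ab assume "ab \<in> {(a, b). 1 \<le> a \<and> a < b \<and> b \<le> r + n \<and> ?s b < ?s a}"
    then obtain a b where ab: "ab = (a, b)" "1 \<le> a" "a < b" "b \<le> r + n" "?s b < ?s a" by auto
    have "r < a"
    proof (rule ccontr)
      assume "\<not> r < a"
      then show False using ab ge[of "b - r"] by (auto simp: tw_shift_def split: if_splits)
    qed
    then have eqs: "r + (a - r) = a" "r + (b - r) = b" "1 \<le> a - r" "1 \<le> b - r" using ab by auto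
    have lt: "\<sigma> (b - r) < \<sigma> (a - r)" using ab \<open>r < a\<close> by (simp add: tw_shift_def)
    show "(\<lambda>(a, b). (r + a, r + b)) ((\<lambda>(a, b). (a - r, b - r)) ab) = ab" using ab eqs by simp
    show "(\<lambda>(a, b). (a - r, b - r)) ab \<in> {(a, b). 1 \<le> a \<and> a < b \<and> b \<le> n \<and> \<sigma> b < \<sigma> a}"
      using ab eqs lt by auto
    show "(case (\<lambda>(a, b). (a - r, b - r)) ab of (a, b) \<Rightarrow> fst (xs ! (\<sigma> a - 1)) * fst (xs ! (\<sigma> b - 1))) =
       (case ab of (a, b) \<Rightarrow> fst (?v ! (?s a - 1)) * fst (?v ! (?s b - 1)))"
      using nth[OF eqs(3)] nth[OF eqs(4)] unfolding eqs ab by simp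
  next
    fix ab assume "ab \<in> {(a, b). 1 \<le> a \<and> a < b \<and> b \<le> n \<and> \<sigma> b < \<sigma> a}"
    then obtain a b where ab: "ab = (a, b)" "1 \<le> a" "a < b" "b \<le> n" "\<sigma> b < \<sigma> a" by auto
    show "(\<lambda>(a, b). (a - r, b - r)) ((\<lambda>(a, b). (r + a, r + b)) ab) = ab" using ab by simp
    show "(\<lambda>(a, b). (r + a, r + b)) ab \<in> {(a, b). 1 \<le> a \<and> a < b \<and> b \<le> r + n \<and> ?s b < ?s a}"
      using ab by (auto simp: tw_shift_def)
  qed
  have mp: "map (\<lambda>j. ?v ! (?s j - 1)) [1..<r+n+1] = replicate r (2, x) @ map (\<lambda>j. xs ! (\<sigma> j - 1)) [1..<n+1]"
    (is "?l = ?r")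
  proof (rule nth_equalityI)
    fix j assume "j < length ?l"
    then have j: "j < r + n" by (simp del: upt_Suc)
    then have "?l ! j = ?v ! (?s (Suc j) - 1)" by (simp del: upt_Suc)
    also have "\<dots> = ?r ! j"
    proof (cases "j < r")
      case True
      then show ?thesis by (simp add: tw_shift_def nth_append del: upt_Suc)
    next
      case False
      then have "Suc j = r + (Suc j - r)" "1 \<le> Suc j - r" "Suc j - r = Suc (j - r)" by auto
      then show ?thesis using nth[of "Suc j - r"] False j by (simp add: nth_append del: upt_Suc)
    qed
    finally show "?l ! j = ?r ! j" .
  qed simp
  show ?thesis
    unfolding end_act_def using v xs sgn mp by (simp only: if_True)
qed

text \<open>The differential of the endomorphism operad is the commutator with the differential of the complex,
  and hence depends on it additively.\<close>

lemma end_diff_change: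
  fixes V V' :: "('k::field, 'v::ab_group_add, 'z) cochains_scheme"
  assumes V: "cochain_complex V" and same: "c_car V' = c_car V"
    and diff: "\<And>d x. x \<in> c_car V d \<Longrightarrow> c_diff V' d x = c_diff V d x + K [(d, x)]"
    and K: "K \<in> end_car V 1 1" and f: "f \<in> end_car V n d" and xs: "xs \<in> hvecs V n"
  shows "end_diff V' n d f xs = end_diff V n d f xs + end_ins V 1 1 n d 1 K f xs
    - signed d (\<Sum>i=1..n. end_ins V n d 1 1 i f K xs)"
proof -
  interpret V: cochain_complex V by fact
  have hv: "hvecs V' = hvecs V" by (auto simp: hvecs_def fun_eq_iff same)
  have fx: "f xs \<in> c_car V (tdeg xs + d)" by (rule end_car_in[OF f xs])
  have 1: "end_ins V 1 1 n d 1 K f xs = K [(tdeg xs + d, f xs)]"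
    using end_ins_eval[of "[]" xs "[]" V 1 n 1 1 d K f] xs hvecs_length[OF xs] by (simp add: signed_even)
  have 2: "signed (tdeg (take j xs))
      (f (xs[j := (fst (xs ! j) + 1, c_diff V' (fst (xs ! j)) (snd (xs ! j)))])) =
      signed (tdeg (take j xs)) (f (xs[j := (fst (xs ! j) + 1, c_diff V (fst (xs ! j)) (snd (xs ! j)))]))
      + end_ins V n d 1 1 (Suc j) f K xs" if j: "j < n" for j
  proof -
    have len: "length xs = n" using hvecs_length[OF xs] .
    obtain e x where ex: "xs ! j = (e, x)" by (cases "xs ! j")
    have x: "x \<in> c_car V e" using hvecs_nth[OF xs j] ex by simp
    have Kx: "K [(e, x)] \<in> c_car V (e + 1)" using end_car_in[OF K, of "[(e, x)]"] x by simp
    have dx: "c_diff V e x \<in> c_car V (e + 1)" using linear_on_in[OF V.diff_linear x] .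
    have up: "xs[j := v] = take j xs @ v # drop (Suc j) xs" for v
      using j len by (simp add: upd_conv_take_nth_drop)
    have lin: "linear_on (c_scale V) (c_scale V) (c_car V (e + 1))
        (c_car V (tdeg (take j xs) + (e + 1) + tdeg (drop (Suc j) xs) + d))
        (\<lambda>x. f (take j xs @ (e + 1, x) # drop (Suc j) xs))"
      by (rule end_car_linear[OF f hvecs_take[OF xs] hvecs_drop[OF xs]]) (use j in auto)
    have "xs = take j xs @ [(e, x)] @ drop (Suc j) xs"
      using j len ex id_take_nth_drop[of j xs] by simp
    then have "end_ins V n d 1 1 (Suc j) f K xs =
        signed (tdeg (take j xs)) (f (take j xs @ (e + 1, K [(e, x)]) # drop (Suc j) xs))"
      using end_ins_eval[of "take j xs" "[(e, x)]" "drop (Suc j) xs" V n 1 "Suc j" d 1 f K] xs len j by simp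
    then show ?thesis
      unfolding up ex fst_conv snd_conv diff[OF x] linear_on_add[OF lin dx Kx] by (simp add: signed_add)
  qed
  have 3: "(\<Sum>i=1..n. end_ins V n d 1 1 i f K xs) = (\<Sum>j<n. end_ins V n d 1 1 (Suc j) f K xs)"
    by (rule sum.reindex_bij_witness[of _ Suc "\<lambda>i. i - 1"]) auto
  have 4: "(\<Sum>j<n. signed (tdeg (take j xs))
      (f (xs[j := (fst (xs ! j) + 1, c_diff V' (fst (xs ! j)) (snd (xs ! j)))]))) =
    (\<Sum>j<n. signed (tdeg (take j xs))
        (f (xs[j := (fst (xs ! j) + 1, c_diff V (fst (xs ! j)) (snd (xs ! j)))])))
    + (\<Sum>j<n. end_ins V n d 1 1 (Suc j) f K xs)"
    unfolding sum.distrib[symmetric] by (rule sum.cong[OF refl]) (use 2 in simp)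
  show ?thesis
    unfolding end_diff_def hv 1 3 4 using xs diff[OF fx] by (simp add: signed_add algebra_simps)
qed

text \<open>The operation is symmetric in its first \<open>r\<close> arguments and \<open>x\<close> has even degree, so the terms in which the
  differential hits one of the copies of \<open>x\<close> all agree, without signs.\<close>

lemma end_diff_special:
  assumes V: "cochain_complex V" and f: "f \<in> end_car V (r + n) d"
    and inv: "\<And>\<sigma>. \<sigma> permutes {1..r} \<Longrightarrow> end_act V (r + n) d \<sigma> f = f"
    and x: "x \<in> c_car V 2" and xs: "xs \<in> hvecs V n"
  shows "end_diff V (r + n) d f (replicate r (2, x) @ xs) =
    c_diff V (2 * int r + tdeg xs + d) (f (replicate r (2, x) @ xs))
    - signed d (\<Sum>j<r. f ((3, c_diff V 2 x) # replicate (r - 1) (2, x) @ xs))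
    - signed d (\<Sum>j<n. signed (tdeg (take j xs))
        (f (replicate r (2, x) @ xs[j := (fst (xs ! j) + 1, c_diff V (fst (xs ! j)) (snd (xs ! j)))])))"
proof -
  interpret V: cochain_complex V by fact
  let ?v = "replicate r (2, x) @ xs"
  let ?g = "\<lambda>j. signed (tdeg (take j ?v))
       (f (?v[j := (fst (?v ! j) + 1, c_diff V (fst (?v ! j)) (snd (?v ! j)))]))"
  have v: "?v \<in> hvecs V (r + n)" by (rule hvecs_appendI[OF hvecs_replicate[OF x] xs])
  have dx: "c_diff V 2 x \<in> c_car V 3" using linear_on_in[OF V.diff_linear x] by simp
  have len: "length xs = n" using hvecs_length[OF xs] .
  have first: "?g j = f ((3, c_diff V 2 x) # replicate (r - 1) (2, x) @ xs)" if j: "j < r" for j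
  proof -
    let ?u = "?v[j := (3, c_diff V 2 x)]"
    let ?t = "transpose 1 (Suc j)"
    have t: "?t permutes {1..r}" by (rule permutes_swap_id) (use j in auto)
    note fx = permutes_atLeastAtMost_fixes[OF t]
    have u: "?u \<in> hvecs V (r + n)"
    proof -
      have "?u = replicate j (2, x) @ (3, c_diff V 2 x) # replicate (r - Suc j) (2, x) @ xs"
        using j by (simp add: upd_conv_take_nth_drop list_update_append)
      then show ?thesis using x dx xs j hvecs_replicate[OF x] len
        by (simp add: hvecs_append)
    qed
    have ev: "even (fst (?u ! i))" if "i < r" "i \<noteq> j" for i using that by (simp add: nth_append)
    have "end_act V (r + n) d ?t f ?u = f (map (\<lambda>k. ?u ! (?t k - 1)) [1..<r+n+1])"
    proof (rule end_act_eval[OF u])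
      fix a b assume ab: "1 \<le> a" "a < b" "b \<le> r + n" "?t b < ?t a"
      have a: "a \<in> {1..r}" using ab fx(2)[of a] fx(2)[of b] by (cases "a \<le> r") auto
      then have ta: "?t a \<in> {1..r}" using fx(3) by blast
      have tb: "?t b \<in> {1..r}" using ta ab fx(1,2,3)[of b] by (cases "b \<le> r") auto
      have neq: "A - 1 \<noteq> j \<or> B - 1 \<noteq> j" if "A \<in> {1..r}" "B \<in> {1..r}" "B < A" for A B
        using that by auto
      have "?t a - 1 \<noteq> j \<or> ?t b - 1 \<noteq> j" by (rule neq[OF ta tb ab(4)])
      then show "even (fst (?u ! (?t a - 1))) \<or> even (fst (?u ! (?t b - 1)))"
        using ev[of "?t a - 1"] ev[of "?t b - 1"] ta tb by auto
    qed
    moreover have "map (\<lambda>k. ?u ! (?t k - 1)) [1..<r+n+1] = (3, c_diff V 2 x) # replicate (r - 1) (2, x) @ xs"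
      (is "?l = ?r")
    proof (rule nth_equalityI)
      show "length ?l = length ?r" using j len by (simp del: upt_Suc)
      fix k assume "k < length ?l"
      then have k: "k < r + n" by (simp del: upt_Suc)
      then have "?l ! k = ?u ! (?t (Suc k) - 1)" by (simp del: upt_Suc)
      also have "\<dots> = ?r ! k"
      proof (cases "k = 0")
        case True
        then show ?thesis using j by simp
      next
        case False
        show ?thesis
        proof (cases "k = j")
          case True
          have "j - 1 < r - 1" using False j True by auto
          then show ?thesis using False j True by (simp add: nth_append nth_Cons')
        next
          case False2: False
          then have "?t (Suc k) = Suc k" using False by (simp add: transpose_def)
          then show ?thesis using False False2 j by (auto simp: nth_append nth_Cons')
        qed
      qed
      finally show "?l ! k = ?r ! k" .
    qed
    ultimately have "f ?u = f ((3, c_diff V 2 x) # replicate (r - 1) (2, x) @ xs)"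
      using inv[OF t] by simp
    moreover have "even (tdeg (take j ?v))" using j by simp
    ultimately show ?thesis using j by (simp add: nth_append signed_even)
  qed
  have second: "?g (r + j) = signed (tdeg (take j xs))
        (f (replicate r (2, x) @ xs[j := (fst (xs ! j) + 1, c_diff V (fst (xs ! j)) (snd (xs ! j)))]))" for j
    by (simp add: nth_append list_update_append signed_def)
  have "(\<Sum>j<r+n. ?g j) = (\<Sum>j<r. ?g j) + (\<Sum>j<n. ?g (r + j))"
    by (induction n) (simp_all add: add.assoc)
  also have "(\<Sum>j<r. ?g j) = (\<Sum>j<r. f ((3, c_diff V 2 x) # replicate (r - 1) (2, x) @ xs))"
    by (rule sum.cong[OF refl]) (use first in simp)
  also have "(\<Sum>j<n. ?g (r + j)) = (\<Sum>j<n. signed (tdeg (take j xs))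
        (f (replicate r (2, x) @ xs[j := (fst (xs ! j) + 1, c_diff V (fst (xs ! j)) (snd (xs ! j)))])))"
    by (rule sum.cong[OF refl]) (rule second)
  finally have sum: "(\<Sum>j<r+n. ?g j) = (\<Sum>j<r. f ((3, c_diff V 2 x) # replicate (r - 1) (2, x) @ xs)) +
    (\<Sum>j<n. signed (tdeg (take j xs))
        (f (replicate r (2, x) @ xs[j := (fst (xs ! j) + 1, c_diff V (fst (xs ! j)) (snd (xs ! j)))])))" .
  have deg: "tdeg ?v + d = 2 * int r + tdeg xs + d" by simp
  show ?thesis
    unfolding end_diff_def if_P[OF v] sum deg signed_add by (simp only: diff_diff_eq)
qed


section \<open>Twisting an algebra by a Maurer--Cartan element\<close>

text \<open>The number of shuffles is a binomial coefficient.\<close>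

lemma scale_shuffle_sum:
  fixes scale :: "'k::field_char_0 \<Rightarrow> 'v::ab_group_add \<Rightarrow> 'v"
  assumes "vector_space scale"
  shows "scale (1 / fact (p + q)) (\<Sum>\<sigma>\<in>Sh p q. v) = scale (1 / (fact p * fact q)) v"
proof -
  interpret vector_space scale by fact
  have "(of_nat (fact p * fact q * ((p + q) choose p)) :: 'k) = of_nat (fact (p + q))"
    using binomial_fact_lemma[of p "p + q"] by simp
  then have *: "(fact p * fact q * of_nat ((p + q) choose p) :: 'k) = fact (p + q)"
    by (simp only: of_nat_mult of_nat_fact)
  have "(fact (p + q) :: 'k) \<noteq> 0" by simp
  then have "(1 / fact (p + q) * of_nat ((p + q) choose p) :: 'k) = 1 / (fact p * fact q)"
    unfolding *[symmetric] by simp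
  then show ?thesis by (simp add: sum_constant_scale card_Sh)
qed

locale filtered_algebra = dg_operad P for P :: "('k::field_char_0, 'o::ab_group_add) operad" +
  fixes V :: "('k, 'v::ab_group_add) filtered_cochains" and \<rho> :: "('o, 'v) structure_map"
  assumes compatible: "compatible_algebra P V \<rho>"
begin

lemma complete_filtered: "complete_filtered_complex V"
  using compatible by (simp add: compatible_algebra_def)

sublocale V: complete_filtered_complex V
  by (rule complete_filtered)

sublocale scaling: vector_space "c_scale V"
  by (rule V.vector_space)

sublocale rho: dg_operad_map P "End_operad V" \<rho>
  using compatible by (simp add: compatible_algebra_def operad_algebra_def)

lemma rho_linear:
  "linear_on (o_scale P) (\<lambda>c f xs. c_scale V c (f xs)) (o_car P n d) (end_car V n d) (\<rho> n d)"
  using rho.map_linear[of n d] by (simp add: End_operad_def)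

lemmas rho_car = linear_on_in[OF rho_linear]
lemmas rho_derived = linear_on_derived[OF vector_space subspace rho_linear]

lemma rho_act: "f \<in> o_car P n d \<Longrightarrow> \<sigma> permutes {1..n} \<Longrightarrow>
    \<rho> n d (o_act P n d \<sigma> f) = end_act V n d \<sigma> (\<rho> n d f)"
  using rho.map_act[of f n d \<sigma>] by (simp add: End_operad_def)

lemma rho_ins: "f \<in> o_car P n d \<Longrightarrow> g \<in> o_car P m e \<Longrightarrow> 1 \<le> i \<Longrightarrow> i \<le> n \<Longrightarrow>
    \<rho> (n + m - 1) (d + e) (o_ins P n d m e i f g) = end_ins V n d m e i (\<rho> n d f) (\<rho> m e g)"
  using rho.map_ins[of f n d g m e i] by (simp add: End_operad_def)

lemma rho_unit: "\<rho> 1 0 (o_unit P) = end_unit V"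
  using rho.map_unit by (simp add: End_operad_def)

lemma rho_diff: "f \<in> o_car P n d \<Longrightarrow> \<rho> n (d + 1) (o_diff P n d f) = end_diff V n d (\<rho> n d f)"
  using rho.map_diff[of f n d] by (simp add: End_operad_def)

lemma rho_outside: "f \<notin> o_car P n d \<Longrightarrow> \<rho> n d f = 0"
  using compatible by (simp add: compatible_algebra_def operad_algebra_def)

lemma rho_filt: "f \<in> o_car P n d \<Longrightarrow> \<rho> n d f \<in> end_filt V 0 n d"
  using compatible by (simp add: compatible_algebra_def)

end

lemma end_filtD:
  assumes "f \<in> end_filt V k n d" "length xs = n" "length ks = n"
    and "\<And>j. j < n \<Longrightarrow> snd (xs ! j) \<in> c_filt V (ks ! j) (fst (xs ! j))"
  shows "f xs \<in> c_filt V (sum_list ks + k) (tdeg xs + d)"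
  using assms by (simp add: end_filt_def)

text \<open>The graded part of the construction works for every \<open>\<alpha>\<close> in the first step of the filtration; the
  Maurer--Cartan equation enters with the differential.\<close>

locale pointed_algebra = filtered_algebra P V \<rho>
  for P :: "('k::field_char_0, 'o::ab_group_add) operad"
    and V :: "('k, 'v::ab_group_add) filtered_cochains" and \<rho> :: "('o, 'v) structure_map" +
  fixes \<alpha> :: 'v
  assumes alpha_filt: "\<alpha> \<in> c_filt V 1 2"
begin

lemma alpha_car: "\<alpha> \<in> c_car V 2"
  using V.filt_car[OF alpha_filt] .

abbreviation alphas :: "nat \<Rightarrow> (int \<times> 'v) list"
  where "alphas r \<equiv> replicate r (2, \<alpha>)"

definition twterm :: "nat \<Rightarrow> int \<Rightarrow> (nat \<Rightarrow> 'o) \<Rightarrow> (int \<times> 'v) list \<Rightarrow> nat \<Rightarrow> 'v"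
  where "twterm n d f xs r = c_scale V (1 / fact r) (\<rho> (r + n) (d - 2 * int r) (f r) (alphas r @ xs))"

definition twisted :: "(nat \<Rightarrow> 'o, 'v) structure_map"
  where "twisted n d f xs = (if f \<in> tw_car P n d \<and> xs \<in> hvecs V n
     then THE y. series_sum V (tdeg xs + d) (twterm n d f xs) y else 0)"

lemma alphas_hvecs: "xs \<in> hvecs V n \<Longrightarrow> alphas r @ xs \<in> hvecs V (r + n)"
  by (rule hvecs_appendI[OF hvecs_replicate[OF alpha_car]])

lemma rho_alphas_filt:
  assumes f: "f \<in> o_car P (r + n) d" and len: "length xs = n" "length ks = n"
    and xs: "\<And>j. j < n \<Longrightarrow> snd (xs ! j) \<in> c_filt V (ks ! j) (fst (xs ! j))"
  shows "\<rho> (r + n) d f (alphas r @ xs) \<in> c_filt V (r + sum_list ks) (2 * int r + tdeg xs + d)"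
proof -
  have "\<rho> (r + n) d f (alphas r @ xs) \<in> c_filt V (sum_list (replicate r 1 @ ks) + 0)
      (tdeg (alphas r @ xs) + d)"
  proof (rule end_filtD[OF rho_filt[OF f]])
    fix j assume "j < r + n"
    then show "snd ((alphas r @ xs) ! j) \<in> c_filt V ((replicate r 1 @ ks) ! j) (fst ((alphas r @ xs) ! j))"
      using xs[of "j - r"] alpha_filt by (auto simp: nth_append)
  qed (use len in auto)
  then show ?thesis by (simp add: sum_list_replicate mult.commute)
qed

text \<open>Each copy of \<open>\<alpha>\<close> raises the filtration by one. This gives the convergence of the series, and for
  \<open>f\<close> vanishing below position \<open>k\<close> also the filtration shift of its sum.\<close>

lemma twterm_filt:
  assumes f: "f \<in> tw_car P n d" and len: "length xs = n" "length ks = n"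
    and xs: "\<And>j. j < n \<Longrightarrow> snd (xs ! j) \<in> c_filt V (ks ! j) (fst (xs ! j))"
  shows "twterm n d f xs r \<in> c_filt V (r + sum_list ks) (tdeg xs + d)"
proof -
  have "2 * int r + tdeg xs + (d - 2 * int r) = tdeg xs + d" by simp
  then show ?thesis
    using rho_alphas_filt[OF tw_car_car[OF f] len xs, of r] unfolding twterm_def
    by (metis V.filt_closed(5))
qed

lemma twterm_filt_0:
  assumes f: "f \<in> tw_car P n d" and xs: "xs \<in> hvecs V n"
  shows "twterm n d f xs r \<in> c_filt V r (tdeg xs + d)"
  using twterm_filt[OF f, of xs "replicate n 0" r] hvecs_length[OF xs] hvecs_nth[OF xs] V.filt_0
  by (simp add: sum_list_replicate)

lemma twisted_series:
  assumes "f \<in> tw_car P n d" "xs \<in> hvecs V n"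
  shows "series_sum V (tdeg xs + d) (twterm n d f xs) (twisted n d f xs)"
  using theI'[OF V.series_exists[OF twterm_filt_0[OF assms]]] assms by (simp add: twisted_def)

lemma twisted_eqI:
  assumes "f \<in> tw_car P n d" "xs \<in> hvecs V n" "series_sum V (tdeg xs + d) (twterm n d f xs) y"
  shows "twisted n d f xs = y"
  using V.series_unique[OF twisted_series[OF assms(1,2)] assms(3)] .

lemma twisted_outside: "xs \<notin> hvecs V n \<Longrightarrow> twisted n d f xs = 0"
  by (simp add: twisted_def)

lemma rho_slot_linear:
  assumes f: "f \<in> o_car P (r + n) d" and ys: "ys \<in> hvecs V a" and zs: "zs \<in> hvecs V b" and n: "a + 1 + b = n"
    and D: "D = 2 * int r + tdeg ys + e + tdeg zs + d"
  shows "linear_on (c_scale V) (c_scale V) (c_car V e) (c_car V D)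
      (\<lambda>x. c_scale V c (\<rho> (r + n) d f (alphas r @ ys @ (e, x) # zs)))"
proof -
  have "linear_on (c_scale V) (c_scale V) (c_car V e) (c_car V (tdeg (alphas r @ ys) + e + tdeg zs + d))
      (\<lambda>x. \<rho> (r + n) d f ((alphas r @ ys) @ (e, x) # zs))"
    by (rule end_car_linear[OF rho_car[OF f] alphas_hvecs[OF ys] zs]) (use n in simp)
  moreover have "tdeg (alphas r @ ys) + e + tdeg zs + d = D" using D by simp
  ultimately show ?thesis
    unfolding linear_on_def
    by (auto simp: scaling.scale_right_distrib V.car_closed(5) mult.commute)
qed

lemma rho_slot_filt:
  assumes f: "f \<in> o_car P (r + n) d" and ys: "ys \<in> hvecs V a" and zs: "zs \<in> hvecs V b" and n: "a + 1 + b = n"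
    and D: "D = 2 * int r + tdeg ys + e + tdeg zs + d" and x: "x \<in> c_filt V k e"
  shows "c_scale V c (\<rho> (r + n) d f (alphas r @ ys @ (e, x) # zs)) \<in> c_filt V (r + k) D"
proof -
  have "\<rho> (r + n) d f (alphas r @ ys @ (e, x) # zs)
    \<in> c_filt V (r + sum_list (replicate a 0 @ k # replicate b 0)) (2 * int r + tdeg (ys @ (e, x) # zs) + d)"
  proof (rule rho_alphas_filt[OF f])
    fix j assume j: "j < n"
    consider "j < a" | "j = a" | "a < j" by linarith
    then show "snd ((ys @ (e, x) # zs) ! j) \<in> c_filt V ((replicate a 0 @ k # replicate b 0) ! j)
        (fst ((ys @ (e, x) # zs) ! j))"
    proof cases
      case 1
      then show ?thesis using hvecs_nth[OF ys] hvecs_length[OF ys] by (simp add: nth_append V.filt_0)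
    next
      case 2
      then show ?thesis using x hvecs_length[OF ys] by (simp add: nth_append)
    next
      case 3
      then have "(j - a) = Suc (j - a - 1)" "j - a - 1 < b" using j n by auto
      then show ?thesis using hvecs_nth[OF zs, of "j - a - 1"] hvecs_length[OF ys] 3
        by (simp add: nth_append nth_Cons' V.filt_0)
    qed
  qed (use n hvecs_length[OF ys] hvecs_length[OF zs] in auto)
  moreover have "2 * int r + tdeg (ys @ (e, x) # zs) + d = D" using D by simp
  ultimately show ?thesis using V.filt_closed(5) by (simp add: sum_list_replicate)
qed

lemma twterm_slot_linear:
  assumes f: "f \<in> tw_car P n d" and ys: "ys \<in> hvecs V a" and zs: "zs \<in> hvecs V b" and n: "a + 1 + b = n"
  shows "linear_on (c_scale V) (c_scale V) (c_car V e) (c_car V (tdeg ys + e + tdeg zs + d))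
      (\<lambda>x. twterm n d f (ys @ (e, x) # zs) r)"
  unfolding twterm_def by (rule rho_slot_linear[OF tw_car_car[OF f] ys zs n]) simp

lemma twterm_slot_filt:
  assumes f: "f \<in> tw_car P n d" and ys: "ys \<in> hvecs V a" and zs: "zs \<in> hvecs V b" and n: "a + 1 + b = n"
    and x: "x \<in> c_filt V k e"
  shows "twterm n d f (ys @ (e, x) # zs) r \<in> c_filt V (r + k) (tdeg ys + e + tdeg zs + d)"
  unfolding twterm_def by (rule rho_slot_filt[OF tw_car_car[OF f] ys zs n _ x]) simp

lemma slot_hvecs:
  assumes "ys \<in> hvecs V a" "zs \<in> hvecs V b" "a + 1 + b = n" "x \<in> c_car V e"
  shows "ys @ (e, x) # zs \<in> hvecs V n"
  using hvecs_appendI[OF assms(1), of "(e, x) # zs" "1 + b"] assms by (simp add: add.assoc)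

lemma scale_signed: "c_scale V c (signed k x) = signed k (c_scale V c x)"
  by (simp add: signed_def)

lemma series_scale:
  assumes "series_sum V d t y"
  shows "series_sum V d (\<lambda>r. c_scale V c (t r)) (c_scale V c y)"
  using assms V.filt_closed(5) V.car_closed(5) unfolding series_sum_def
  by (auto simp: scaling.scale_sum_right[symmetric] scaling.scale_right_diff_distrib[symmetric])

lemma twisted_end_car:
  assumes f: "f \<in> tw_car P n d"
  shows "twisted n d f \<in> end_car V n d"
  unfolding end_car_def
proof (intro CollectI conjI ballI allI impI)
  show "twisted n d f xs \<in> c_car V (tdeg xs + d)" if "xs \<in> hvecs V n" for xs
    using twisted_series[OF f that] by (simp add: series_sum_def)
  show "twisted n d f xs = 0" if "xs \<notin> hvecs V n" for xs
    using that by (rule twisted_outside)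
  fix xs ys e
  assume *: "xs \<in> hvecs V (length xs) \<and> ys \<in> hvecs V (length ys) \<and> length xs + 1 + length ys = n"
  note xs = conjunct1[OF *] and ys = conjunct1[OF conjunct2[OF *]] and n = conjunct2[OF conjunct2[OF *]]
  let ?D = "tdeg xs + e + tdeg ys + d"
  note lin = twterm_slot_linear[OF f xs ys n, of e]
  have hv: "xs @ (e, x) # ys \<in> hvecs V n" if "x \<in> c_car V e" for x
    by (rule slot_hvecs[OF xs ys n that])
  have ser: "series_sum V ?D (twterm n d f (xs @ (e, x) # ys)) (twisted n d f (xs @ (e, x) # ys))"
    if "x \<in> c_car V e" for x
    using twisted_series[OF f hv[OF that]] by (simp add: ac_simps)
  show "linear_on (c_scale V) (c_scale V) (c_car V e) (c_car V ?D) (\<lambda>x. twisted n d f (xs @ (e, x) # ys))"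
    unfolding linear_on_def
  proof (intro conjI ballI allI)
    show "twisted n d f (xs @ (e, x) # ys) \<in> c_car V ?D" if "x \<in> c_car V e" for x
      using ser[OF that] by (simp add: series_sum_def)
    fix x assume x: "x \<in> c_car V e"
    show "twisted n d f (xs @ (e, x + y) # ys) = twisted n d f (xs @ (e, x) # ys)
        + twisted n d f (xs @ (e, y) # ys)"
      if y: "y \<in> c_car V e" for y
    proof (rule V.series_unique[OF ser])
      show "x + y \<in> c_car V e" by (rule V.car_closed(2)[OF x y])
      have "twterm n d f (xs @ (e, x + y) # ys)
          = (\<lambda>r. twterm n d f (xs @ (e, x) # ys) r + twterm n d f (xs @ (e, y) # ys) r)"
        using linear_on_add[OF lin x y] by blast
      then show "series_sum V ?D (twterm n d f (xs @ (e, x + y) # ys))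
          (twisted n d f (xs @ (e, x) # ys) + twisted n d f (xs @ (e, y) # ys))"
        using V.series_add[OF ser[OF x] ser[OF y]] by simp
    qed
    show "twisted n d f (xs @ (e, c_scale V c x) # ys) = c_scale V c (twisted n d f (xs @ (e, x) # ys))" for c
    proof (rule V.series_unique[OF ser])
      show "c_scale V c x \<in> c_car V e" by (rule V.car_closed(5)[OF x])
      have "twterm n d f (xs @ (e, c_scale V c x) # ys)
          = (\<lambda>r. c_scale V c (twterm n d f (xs @ (e, x) # ys) r))"
        using linear_on_scale[OF lin x] by blast
      then show "series_sum V ?D (twterm n d f (xs @ (e, c_scale V c x) # ys))
          (c_scale V c (twisted n d f (xs @ (e, x) # ys)))"
        using series_scale[OF ser[OF x]] by simp
    qed
  qed
qed

lemma twisted_filt: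
  assumes f: "f \<in> tw_filt P k n d"
  shows "twisted n d f \<in> end_filt V k n d"
proof -
  have fc: "f \<in> tw_car P n d" and f0: "\<And>r. r < k \<Longrightarrow> f r = 0" using f by (auto simp: tw_filt_def)
  have "twisted n d f xs \<in> c_filt V (sum_list ks + k) (tdeg xs + d)"
    if "length xs = n" "length ks = n"
        and xs: "\<And>j. j < n \<Longrightarrow> snd (xs ! j) \<in> c_filt V (ks ! j) (fst (xs ! j))" for xs ks
  proof -
    have hv: "xs \<in> hvecs V n"
      unfolding hvecs_def using that(1) xs V.filt_car
        by (auto simp: in_set_conv_nth) (metis fst_conv snd_conv)
    show ?thesis
    proof (rule V.series_filtered[OF twisted_series[OF fc hv]])
      fix r
      show "twterm n d f xs r \<in> c_filt V (sum_list ks + k) (tdeg xs + d)"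
      proof (cases "r < k")
        case True
        then show ?thesis using V.filt_closed(1) by (simp add: twterm_def f0 rho_derived(1))
      next
        case False
        then show ?thesis using V.filt_mono[OF _ twterm_filt[OF fc that(1,2) xs, of r]] by simp
      qed
    qed
  qed
  then show ?thesis using twisted_end_car[OF fc] by (auto simp: end_filt_def)
qed

lemma twisted_linear:
  "linear_on (\<lambda>c f r. o_scale P c (f r)) (\<lambda>c f xs. c_scale V c (f xs)) (tw_car P n d) (end_car V n d)
      (twisted n d)"
  unfolding linear_on_def
proof (intro conjI ballI allI)
  note sub = subspace_closed[OF tw_vector_space tw_car_subspace, of \<phi> for \<phi>, unfolded Tw_def operad.simps]
  show "twisted n d f \<in> end_car V n d" if "f \<in> tw_car P n d" for f by (rule twisted_end_car[OF that])
  fix f assume f: "f \<in> tw_car P n d"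
  show "twisted n d (f + g) = twisted n d f + twisted n d g" if g: "g \<in> tw_car P n d" for g
  proof
    fix xs
    have fg: "f + g \<in> tw_car P n d" by (rule sub(2)[OF f g])
    show "twisted n d (f + g) xs = (twisted n d f + twisted n d g) xs"
    proof (cases "xs \<in> hvecs V n")
      case True
      have "twterm n d (f + g) xs = (\<lambda>r. twterm n d f xs r + twterm n d g xs r)"
        by (simp add: twterm_def fun_eq_iff linear_on_add[OF rho_linear tw_car_car[OF f] tw_car_car[OF g]]
            scaling.scale_right_distrib)
      then show ?thesis
        using twisted_eqI[OF fg True] V.series_add[OF twisted_series[OF f True] twisted_series[OF g True]] by simp
    qed (simp add: twisted_outside)
  qed
  show "twisted n d (\<lambda>r. o_scale P c (f r)) = (\<lambda>xs. c_scale V c (twisted n d f xs))" for c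
  proof
    fix xs
    have cf: "(\<lambda>r. o_scale P c (f r)) \<in> tw_car P n d" by (rule sub(5)[OF f])
    show "twisted n d (\<lambda>r. o_scale P c (f r)) xs = c_scale V c (twisted n d f xs)"
    proof (cases "xs \<in> hvecs V n")
      case True
      have "twterm n d (\<lambda>r. o_scale P c (f r)) xs = (\<lambda>r. c_scale V c (twterm n d f xs r))"
        by (simp add: twterm_def fun_eq_iff linear_on_scale[OF rho_linear tw_car_car[OF f]])
      then show ?thesis
        using twisted_eqI[OF cf True] series_scale[OF twisted_series[OF f True]] by simp
    qed (simp add: twisted_outside)
  qed
qed

lemma twisted_unit: "twisted 1 0 (tw_unit P) = end_unit V"
proof
  fix xs
  have uc: "tw_unit P \<in> tw_car P 1 0"
    unfolding tw_car_def tw_unit_def using unit_closed by auto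
  show "twisted 1 0 (tw_unit P) xs = end_unit V xs"
  proof (cases "xs \<in> hvecs V 1")
    case True
    have t: "twterm 1 0 (tw_unit P) xs r = (if r = 0 then end_unit V xs else 0)" for r
      by (simp add: twterm_def tw_unit_def rho_derived(1) rho_unit[simplified])
    have "end_unit V xs \<in> c_filt V 0 (tdeg xs + 0)"
      using True by (cases xs) (auto simp: end_unit_def hvecs_def V.filt_0)
    from V.series_single[OF this]
    have "series_sum V (tdeg xs + 0) (twterm 1 0 (tw_unit P) xs) (end_unit V xs)"
      unfolding t[abs_def, symmetric] .
    then show ?thesis by (rule twisted_eqI[OF uc True])
  qed (simp add: twisted_outside end_unit_def)
qed

lemma twisted_act:
  assumes f: "f \<in> tw_car P n d" and \<sigma>: "\<sigma> permutes {1..n}"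
  shows "twisted n d (tw_act P n d \<sigma> f) = end_act V n d \<sigma> (twisted n d f)"
proof
  fix xs
  show "twisted n d (tw_act P n d \<sigma> f) xs = end_act V n d \<sigma> (twisted n d f) xs"
  proof (cases "xs \<in> hvecs V n")
    case True
    let ?ys = "map (\<lambda>j. xs ! (\<sigma> j - 1)) [1..<n+1]"
    define k where "k = (\<Sum>(a, b)\<in>{(a, b). 1 \<le> a \<and> a < b \<and> b \<le> n \<and> \<sigma> b < \<sigma> a}.
                 fst (xs ! (\<sigma> a - 1)) * fst (xs ! (\<sigma> b - 1)))"
    have act: "end_act V n e \<sigma> g xs = signed k (g ?ys)" for e g
      unfolding end_act_def k_def using True by simp
    have ran: "\<sigma> j - 1 < n" if "j \<in> {1..n}" for j
      using permutes_in_image[OF \<sigma>, of j] that by auto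
    have ys: "?ys \<in> hvecs V n"
    proof -
      have "x \<in> c_car V d" if "(d, x) \<in> set ?ys" for d x
      proof -
        from that obtain j where j: "j \<in> {1..n}" "(d, x) = xs ! (\<sigma> j - 1)"
          by (auto simp: less_Suc_eq_le simp del: upt_Suc)
        show ?thesis using hvecs_nth[OF True ran[OF j(1)]] unfolding j(2)[symmetric] by simp
      qed
      then have "\<forall>(d, x)\<in>set ?ys. x \<in> c_car V d" by blast
      then show ?thesis unfolding hvecs_def by (simp only: mem_Collect_eq length_map length_upt) simp
    qed
    have bij: "bij_betw (\<lambda>j. \<sigma> (Suc j) - 1) {..<n} {..<n}"
    proof -
      have "bij_betw Suc {..<n} {1..n}" by (rule bij_betw_byWitness[where f' = "\<lambda>j. j - 1"]) auto
      moreover have "bij_betw \<sigma> {1..n} {1..n}" by (rule permutes_imp_bij[OF \<sigma>])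
      moreover have "bij_betw (\<lambda>j. j - 1) {1..n} {..<n}" by (rule bij_betw_byWitness[where f' = Suc]) auto
      ultimately have "bij_betw ((\<lambda>j. j - 1) \<circ> (\<sigma> \<circ> Suc)) {..<n} {..<n}" using bij_betw_trans by blast
      then show ?thesis by (simp add: comp_def)
    qed
    have td: "tdeg ?ys = tdeg xs"
    proof -
      have len: "length ?ys = n" by (simp del: upt_Suc)
      have "tdeg ?ys = (\<Sum>j<n. fst (?ys ! j))"
        unfolding tdeg_def by (subst sum_list_sum_nth) (simp add: lessThan_atLeast0 del: upt_Suc)
      also have "\<dots> = (\<Sum>j<n. fst (xs ! (\<sigma> (Suc j) - 1)))"
        by (rule sum.cong) (auto simp del: upt_Suc)
      also have "\<dots> = (\<Sum>j<n. fst (xs ! j))"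
        by (rule sum.reindex_bij_betw[OF bij])
      also have "\<dots> = tdeg xs"
        unfolding tdeg_def by (subst sum_list_sum_nth) (simp add: lessThan_atLeast0 hvecs_length[OF True])
      finally show ?thesis .
    qed
    have "twterm n d (tw_act P n d \<sigma> f) xs r = signed k (twterm n d f ?ys r)" for r
    proof -
      have s: "tw_shift r \<sigma> permutes {1..r+n}" by (rule permutes_subset[OF tw_shift_permutes[OF \<sigma>]]) auto
      show ?thesis
        unfolding twterm_def tw_act_eq rho_act[OF tw_car_car[OF f] s] end_act_tw_shift[OF \<sigma> alpha_car True, of r _ _ d] act
        by (simp add: signed_def)
    qed
    then have "twterm n d (tw_act P n d \<sigma> f) xs = (\<lambda>r. signed k (twterm n d f ?ys r))" by (rule ext)
    then have "series_sum V (tdeg xs + d) (twterm n d (tw_act P n d \<sigma> f) xs) (signed k (twisted n d f ?ys))"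
      using V.series_signed[OF twisted_series[OF f ys], of k] unfolding td by (simp only:)
    then show ?thesis unfolding act by (rule twisted_eqI[OF tw_act_car[OF f \<sigma>] True])
  qed (simp add: twisted_outside end_act_def)
qed

text \<open>All shuffles of the special inputs have the same value on copies of \<open>\<alpha>\<close>.\<close>

lemma rho_shuffle_sum:
  assumes x: "x \<in> o_car P (r + n) d" and xs: "xs \<in> hvecs V n" and r: "r = p + q"
  shows "c_scale V (1 / fact r) (\<rho> (r + n) d (\<Sum>\<sigma>\<in>Sh p q. o_act P (r + n) d \<sigma> x) (alphas r @ xs)) =
    c_scale V (1 / (fact p * fact q)) (\<rho> (r + n) d x (alphas r @ xs))"
proof -
  have perm: "\<sigma> permutes {1..r}" "\<sigma> permutes {1..r + n}" if "\<sigma> \<in> Sh p q" for \<sigma>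
    using Sh_permutes[OF that] permutes_le r by auto
  have "\<rho> (r + n) d (\<Sum>\<sigma>\<in>Sh p q. o_act P (r + n) d \<sigma> x) (alphas r @ xs) =
     (\<Sum>\<sigma>\<in>Sh p q. \<rho> (r + n) d (o_act P (r + n) d \<sigma> x) (alphas r @ xs))"
    by (subst rho_derived(5)) (auto intro: act_car[OF perm(2) x] simp: sum_fun_apply)
  also have "\<dots> = (\<Sum>\<sigma>\<in>Sh p q. \<rho> (r + n) d x (alphas r @ xs))"
    by (rule sum.cong[OF refl]) (simp add: rho_act[OF x perm(2)] end_act_special[OF perm(1) alpha_car xs])
  finally show ?thesis using scale_shuffle_sum[OF V.vector_space] r by simp
qed

text \<open>The summand of the composite with \<open>p\<close> special inputs in \<open>f\<close> and \<open>q\<close> in \<open>g\<close> becomes the term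
  \<open>1/(p! q!) f\<^sub>p(\<alpha>, \<dots>, \<alpha>, ys, g\<^sub>q(\<alpha>, \<dots>, \<alpha>, zs), ws)\<close>, up to the sign of moving \<open>g\<close> past \<open>ys\<close>. It lies in
  \<open>F\<^bsub>p+q\<^esub>\<close>, so the double series may be summed along its diagonals.\<close>

lemma twisted_ins:
  assumes f: "f \<in> tw_car P n d" and g: "g \<in> tw_car P m e" and i: "1 \<le> i" "i \<le> n"
  shows "twisted (n + m - 1) (d + e) (tw_ins P n d m e i f g)
      = end_ins V n d m e i (twisted n d f) (twisted m e g)"
proof
  fix xs
  show "twisted (n + m - 1) (d + e) (tw_ins P n d m e i f g) xs
      = end_ins V n d m e i (twisted n d f) (twisted m e g) xs"
  proof (cases "xs \<in> hvecs V (n + m - 1)")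
    case True
    define ys zs ws where "ys = take (i - 1) xs" and "zs = take m (drop (i - 1) xs)"
        and "ws = drop (i - 1 + m) xs"
    have split: "xs = ys @ zs @ ws"
      by (simp add: ys_def zs_def ws_def add.commute) (metis append_take_drop_id drop_drop)
    have ys: "ys \<in> hvecs V (i - 1)" unfolding ys_def by (rule hvecs_take[OF True]) (use i in simp)
    have zs: "zs \<in> hvecs V m" unfolding zs_def by (rule hvecs_take[OF hvecs_drop[OF True]]) (use i in simp)
    have ws: "ws \<in> hvecs V (n - i)"
    proof -
      have "n + m - 1 - (i - 1 + m) = n - i" using i by simp
      then show ?thesis unfolding ws_def using hvecs_drop[OF True, of "i - 1 + m"] by simp
    qed
    have zw: "zs @ ws \<in> hvecs V (m + (n - i))" by (rule hvecs_appendI[OF zs ws])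
    have an: "i - 1 + 1 + (n - i) = n" using i by simp
    define E where "E = tdeg zs + e"
    define z where "z = twisted m e g zs"
    let ?s = "e * tdeg ys" and ?D = "tdeg xs + (d + e)"
    have D: "?D = tdeg ys + E + tdeg ws + d" by (simp add: split E_def)
    define G where "G p x = signed ?s (twterm n d f (ys @ (E, x) # ws) p)" for p x
    define T where "T p q = G p (twterm m e g zs q)" for p q
    have zser: "series_sum V E (twterm m e g zs) z"
      unfolding E_def z_def by (rule twisted_series[OF g zs])
    have zc: "z \<in> c_car V E" using zser by (simp add: series_sum_def)
    have Glin: "linear_on (c_scale V) (c_scale V) (c_car V E) (c_car V ?D) (G p)" for p
      using twterm_slot_linear[OF f ys ws an, of E p] V.car_closed(6)
      unfolding D G_def linear_on_def by (auto simp: signed_add) (auto simp: signed_def)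
    have Gfilt: "G p x \<in> c_filt V (p + k) ?D" if "x \<in> c_filt V k E" for p k x
      unfolding D G_def by (rule V.filt_closed(6)[OF twterm_slot_filt[OF f ys ws an that]])
    have hv: "ys @ (E, z) # ws \<in> hvecs V n" by (rule slot_hvecs[OF ys ws an zc])
    have Yser: "series_sum V ?D (\<lambda>p. G p z) (signed ?s (twisted n d f (ys @ (E, z) # ws)))"
      using V.series_signed[OF twisted_series[OF f hv], of ?s] unfolding G_def D by (simp add: ac_simps)
    have diag: "series_sum V ?D (\<lambda>r. \<Sum>p\<le>r. T p (r - p)) (signed ?s (twisted n d f (ys @ (E, z) # ws)))"
      by (rule V.series_diagonal[OF Yser])
          (use series_map(1)[OF complete_filtered Glin Gfilt zser] in \<open>simp add: T_def\<close>)
    have "twterm (n + m - 1) (d + e) (tw_ins P n d m e i f g) xs r = (\<Sum>p\<le>r. T p (r - p))" for r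
    proof -
      have N: "r + (n + m - 1) = r + n + m - 1" using i by simp
      let ?A = "o_act P (r + (n + m - 1)) (d + e - 2 * int r)"
          and ?X = "\<lambda>p. tw_comp P n d m e i f g p (r - p)"
      let ?R = "\<rho> (r + (n + m - 1)) (d + e - 2 * int r)"
      have X: "?X p \<in> o_car P (r + (n + m - 1)) (d + e - 2 * int r)" if "p \<le> r" for p
      proof -
        have "p + (r - p) = r" using that by simp
        then show ?thesis
          using tw_comp_young[OF f g i, of p "r - p"] unfolding N
            by (simp only: young_invariants_def mem_Collect_eq)
      qed
      have AX: "?A \<sigma> (?X p) \<in> o_car P (r + (n + m - 1)) (d + e - 2 * int r)"
          if "p \<le> r" "\<sigma> \<in> Sh p (r - p)" for p \<sigma>
        by (rule act_car[OF permutes_le[OF Sh_permutes[OF that(2)]] X]) (use that in auto)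
      have "?R (tw_ins P n d m e i f g r) (alphas r @ xs) =
          (\<Sum>p\<le>r. ?R (\<Sum>\<sigma>\<in>Sh p (r - p). ?A \<sigma> (?X p)) (alphas r @ xs))"
      proof -
        have "?R (\<Sum>p\<le>r. \<Sum>\<sigma>\<in>Sh p (r - p). ?A \<sigma> (?X p)) = (\<Sum>p\<le>r. ?R (\<Sum>\<sigma>\<in>Sh p (r - p). ?A \<sigma> (?X p)))"
          by (rule rho_derived(5)) (rule car_sum, rule AX, simp_all)
        then show ?thesis unfolding tw_ins_eq[OF f g i] N[symmetric] by (simp only: sum_fun_apply)
      qed
      then have "twterm (n + m - 1) (d + e) (tw_ins P n d m e i f g) xs r =
          (\<Sum>p\<le>r. c_scale V (1 / fact r) (?R (\<Sum>\<sigma>\<in>Sh p (r - p). ?A \<sigma> (?X p)) (alphas r @ xs)))"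
        by (simp add: twterm_def scaling.scale_sum_right)
      also have "\<dots> = (\<Sum>p\<le>r. T p (r - p))"
      proof (rule sum.cong[OF refl])
        fix p assume "p \<in> {..r}"
        define q where "q = r - p"
        have r: "r = p + q" using \<open>p \<in> {..r}\<close> by (simp add: q_def)
        let ?f = "\<rho> (p + n) (d - 2 * int p) (f p)" and ?g = "\<rho> (q + m) (e - 2 * int q) (g q)"
        let ?y = "o_ins P (p + n) (d - 2 * int p) (q + m) (e - 2 * int q) (p + i) (f p) (g q)"
        have ar: "p + n + (q + m) - 1 = r + (n + m - 1)" "d - 2 * int p + (e - 2 * int q) = d + e - 2 * int r"
          "r + n + m - 1 = r + (n + m - 1)" "p + (i - 1) = p + i - 1"
          using i r by auto
        have y: "?y \<in> o_car P (r + (n + m - 1)) (d + e - 2 * int r)"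
          using ins_car[OF tw_car_car[OF f] tw_car_car[OF g], of "p + i" p q] i ar by simp
        have w: "slot_perm p q i permutes {1..r + (n + m - 1)}" by (rule slot_perm_permutes) (use i r in auto)
        have gz: "?g (alphas q @ zs) \<in> c_car V E"
          using end_car_in[OF rho_car[OF tw_car_car[OF g]] alphas_hvecs[OF zs], of q] by (simp add: E_def)
        have lin: "linear_on (c_scale V) (c_scale V) (c_car V E)
            (c_car V (2 * int p + tdeg ys + E + tdeg ws + (d - 2 * int p)))
            (\<lambda>x. c_scale V (1 / fact p) (\<rho> (p + n) (d - 2 * int p) (f p) (alphas p @ ys @ (E, x) # ws)))"
          by (rule rho_slot_linear[OF tw_car_car[OF f] ys ws an]) simp
        have ch: "(alphas p @ ys) @ (alphas q @ zs) @ ws \<in> hvecs V (p + n + (q + m) - 1)"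
        proof -
          have "p + (i - 1) + (q + m + (n - i)) = p + n + (q + m) - 1" using i by simp
          then show ?thesis
            using hvecs_appendI[OF alphas_hvecs[OF ys] hvecs_appendI[OF alphas_hvecs[OF zs] ws], of p q]
              by simp
        qed
        have "c_scale V (1 / fact r) (?R (\<Sum>\<sigma>\<in>Sh p q. ?A \<sigma> (?X p)) (alphas r @ xs)) =
            c_scale V (1 / (fact p * fact q)) (?R (?X p) (alphas r @ xs))"
          by (rule rho_shuffle_sum[OF X True r]) (use r in simp)
        also have "?R (?X p) (alphas r @ xs) =
            end_act V (r + (n + m - 1)) (d + e - 2 * int r) (slot_perm p q i) (?R ?y)
                (alphas (p + q) @ ys @ zs @ ws)"
          unfolding tw_comp_def q_def[symmetric] r[symmetric] ar(3) rho_act[OF y w] split ..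
        also have "\<dots> = ?R ?y (alphas p @ ys @ alphas q @ zs @ ws)"
          by (rule end_act_slot_perm[OF alpha_car ys zw]) (use i r in auto)
        also have "?R ?y = end_ins V (p + n) (d - 2 * int p) (q + m) (e - 2 * int q) (p + i) ?f ?g"
          unfolding ar(1,2)[symmetric] by (rule rho_ins[OF tw_car_car[OF f] tw_car_car[OF g]]) (use i in auto)
        also have "\<dots> (alphas p @ ys @ alphas q @ zs @ ws) =
            signed ((e - 2 * int q) * tdeg (alphas p @ ys))
                (?f ((alphas p @ ys) @ (tdeg (alphas q @ zs) + (e - 2 * int q), ?g (alphas q @ zs)) # ws))"
          using end_ins_eval[OF ch, of "p + i" "d - 2 * int p" "e - 2 * int q" ?f ?g]
            hvecs_length[OF ys] hvecs_length[OF zs] i by simp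
        also have "\<dots> = signed ?s (?f (alphas p @ ys @ (E, ?g (alphas q @ zs)) # ws))"
        proof -
          have parity: "even ((e - 2 * int q) * tdeg (alphas p @ ys) - ?s)" by (simp add: algebra_simps)
          have deg: "tdeg (alphas q @ zs) + (e - 2 * int q) = E" by (simp add: E_def)
          show ?thesis unfolding signed_cong_parity[OF parity] deg append.assoc ..
        qed
        also have "c_scale V (1 / (fact p * fact q)) \<dots> =
            signed ?s (c_scale V (1 / fact q)
                (c_scale V (1 / fact p) (?f (alphas p @ ys @ (E, ?g (alphas q @ zs)) # ws))))"
          by (simp add: signed_def mult.commute)
        also have "\<dots> = T p q"
          unfolding T_def G_def twterm_def linear_on_scale[OF lin gz] ..
        finally show "c_scale V (1 / fact r) (?R (\<Sum>\<sigma>\<in>Sh p (r - p). ?A \<sigma> (?X p)) (alphas r @ xs))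
            = T p (r - p)"
          by (simp add: q_def)
      qed
      finally show ?thesis .
    qed
    then have "series_sum V ?D (twterm (n + m - 1) (d + e) (tw_ins P n d m e i f g) xs)
        (signed ?s (twisted n d f (ys @ (E, z) # ws)))"
      using diag by presburger
    from twisted_eqI[OF tw_ins_car[OF f g i] True this]
    show ?thesis
      using end_ins_eval[of ys zs ws V n m i d e "twisted n d f" "twisted m e g"] True split
        hvecs_length[OF ys] hvecs_length[OF zs] by (simp add: E_def z_def)
  qed (simp add: twisted_outside end_ins_def)
qed

end


section \<open>Changing the differential\<close>

definition perturb ::
  "('k, 'v::ab_group_add) filtered_cochains \<Rightarrow> ((int \<times> 'v) list \<Rightarrow> 'v) \<Rightarrow> ('k, 'v) filtered_cochains"
  where "perturb V K = V\<lparr>c_diff := \<lambda>d x. c_diff V d x + K [(d, x)]\<rparr>"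

lemma perturb_simps [simp]:
  "c_scale (perturb V K) = c_scale V" "c_car (perturb V K) = c_car V" "c_filt (perturb V K) = c_filt V"
  "c_diff (perturb V K) d x = c_diff V d x + K [(d, x)]"
  by (simp_all add: perturb_def)

lemma perturb_hvecs [simp]: "hvecs (perturb V K) = hvecs V"
  by (simp add: hvecs_def fun_eq_iff)

lemma perturb_End [simp]:
  "end_car (perturb V K) = end_car V" "end_unit (perturb V K) = end_unit V"
  "end_ins (perturb V K) = end_ins V" "end_act (perturb V K) = end_act V"
  by (simp_all add: end_car_def end_unit_def end_ins_def end_act_def fun_eq_iff)

lemma perturb_end_filt [simp]: "end_filt (perturb V K) = end_filt V"
  by (simp add: end_filt_def fun_eq_iff)

lemma perturb_perturb: "perturb (perturb V K) K' = perturb V (K + K')"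
  by (simp add: perturb_def add.assoc)

lemma perturb_zero: "perturb V 0 = V"
  by (simp add: perturb_def)

lemma end_diff_perturb:
  assumes "cochain_complex V" "K \<in> end_car V 1 1" "f \<in> end_car V n d"
  shows "end_diff (perturb V K) n d f = end_diff V n d f + end_ins V 1 1 n d 1 K f
    - signed d (\<Sum>i=1..n. end_ins V n d 1 1 i f K)"
proof
  fix xs
  show "end_diff (perturb V K) n d f xs = (end_diff V n d f + end_ins V 1 1 n d 1 K f
    - signed d (\<Sum>i=1..n. end_ins V n d 1 1 i f K)) xs"
  proof (cases "xs \<in> hvecs V n")
    case True
    show ?thesis
      using end_diff_change[OF assms(1) _ _ assms(2,3) True, of "perturb V K"]
      by (simp add: signed_fun_apply sum_fun_apply)
  next
    case False
    then have "end_ins V n d 1 1 i f K xs = 0" for i by (simp add: end_ins_def)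
    then show ?thesis using False by (simp add: end_diff_def end_ins_def signed_fun_apply sum_fun_apply)
  qed
qed

context complete_filtered_complex
begin

lemma commutator_unary:
  assumes K: "K \<in> end_car V 1 1" and x: "x \<in> c_car V d"
  shows "end_diff V 1 1 K [(d, x)] = c_diff V (d + 1) (K [(d, x)]) + K [(d + 1, c_diff V d x)]"
    and "end_ins V 1 1 1 1 1 K K [(d, x)] = K [(d + 1, K [(d, x)])]"
  using x by (simp_all add: end_diff_def end_ins_def signed_def)

lemma unary_linear:
  assumes "K \<in> end_car V 1 1"
  shows "linear_on (c_scale V) (c_scale V) (c_car V d) (c_car V (d + 1)) (\<lambda>x. K [(d, x)])"
  using end_car_linear[OF assms, of "[]" 0 "[]" 0 d] by simp

end

text \<open>On a single vector the assumption \<open>flat\<close>, the Maurer--Cartan equation for \<open>K\<close> in the endomorphism operad,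
  says that the terms of the squared differential that involve \<open>K\<close> cancel.\<close>

lemma perturb_complete:
  fixes V :: "('k::field, 'v::ab_group_add) filtered_cochains"
  assumes V: "complete_filtered_complex V" and K: "K \<in> end_car V 1 1" and filt: "K \<in> end_filt V 0 1 1"
    and flat: "end_diff V 1 1 K + end_ins V 1 1 1 1 1 K K = 0"
  shows "complete_filtered_complex (perturb V K)"
proof -
  interpret V: complete_filtered_complex V by fact
  interpret scaling: vector_space "c_scale V" by (rule V.vector_space)
  note lin = V.unary_linear[OF K]
  have Kc: "K [(d, x)] \<in> c_car V (d + 1)" if "x \<in> c_car V d" for d x using linear_on_in[OF lin that] .
  have dc: "c_diff V d x \<in> c_car V (d + 1)" if "x \<in> c_car V d" for d x
    using linear_on_in[OF V.diff_linear that] .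
  show ?thesis
  proof (intro complete_filtered_complex.intro cochain_complex.intro complete_filtered_complex_axioms.intro,
      unfold perturb_simps)
    show "vector_space (c_scale V)" by (rule V.vector_space)
    show "module.subspace (c_scale V) (c_car V d)" for d by (rule V.subspace)
    show "linear_on (c_scale V) (c_scale V) (c_car V d) (c_car V (d + 1))
        (\<lambda>x. c_diff V d x + K [(d, x)])" for d
      using V.diff_linear[of d] lin[of d] V.car_closed(2) scaling.scale_right_distrib
      unfolding linear_on_def by simp
    show "c_diff V (d + 1) (c_diff V d x + K [(d, x)]) + K [(d + 1, c_diff V d x + K [(d, x)])] = 0"
      if x: "x \<in> c_car V d" for x d
    proof -
      have "c_diff V (d + 1) (K [(d, x)]) + K [(d + 1, c_diff V d x)] + K [(d + 1, K [(d, x)])] = 0"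
        using fun_cong[OF flat, of "[(d, x)]"] V.commutator_unary[OF K x] by simp
      then show ?thesis
        by (simp add: linear_on_add[OF V.diff_linear dc[OF x] Kc[OF x]] linear_on_add[OF lin dc[OF x] Kc[OF x]]
            V.diff_diff[OF x] add.assoc)
    qed
    show "c_diff V d x + K [(d, x)] = 0" if "x \<notin> c_car V d" for x d
      using V.diff_outside[OF that] end_car_outside[OF K, of "[(d, x)]"] that by simp
    show "c_filt V 0 d = c_car V d" for d by (rule V.filt_0)
    show "c_filt V (Suc k) d \<subseteq> c_filt V k d" for k d by (rule V.filt_descending)
    show "module.subspace (c_scale V) (c_filt V k d)" for k d by (rule V.filt_subspace)
    show "c_diff V d x + K [(d, x)] \<in> c_filt V k (d + 1)" if x: "x \<in> c_filt V k d" for x k d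
    proof -
      have "K [(d, x)] \<in> c_filt V (sum_list [k] + 0) (tdeg [(d, x)] + 1)"
        by (rule end_filtD[OF filt]) (use x in auto)
      then show ?thesis using V.filt_closed(2)[OF V.filt_diff[OF x]] by simp
    qed
    show "\<exists>!y. y \<in> c_car V d \<and> (\<forall>k. y - u k \<in> c_filt V k d)"
      if "\<And>k. u k \<in> c_car V d \<and> u (Suc k) - u k \<in> c_filt V k d" for u d
      by (rule V.filt_complete[OF that])
  qed
qed


section \<open>The differential of the twisted algebra\<close>

locale mc_algebra = twisting P \<phi> + pointed_algebra P V \<rho> \<alpha>
  for P :: "('k::field_char_0, 'o::ab_group_add) operad" and \<phi> :: "nat \<Rightarrow> 'o"
    and V :: "('k, 'v::ab_group_add) filtered_cochains" and \<rho> :: "('o, 'v) structure_map" and \<alpha> :: 'v +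
  assumes mc: "maurer_cartan \<phi> V \<rho> \<alpha>"
begin

abbreviation phi_alpha :: "nat \<Rightarrow> 'v"
  where "phi_alpha n \<equiv> \<rho> n (3 - 2 * int n) (\<phi> n) (alphas n)"

lemma phi_alpha_filt: "phi_alpha n \<in> c_filt V n 3"
  using rho_alphas_filt[of "\<phi> n" n 0 "3 - 2 * int n" "[]" "[]"] phi_car[of n] by simp

lemma phi_alpha_small: "phi_alpha 0 = 0" "phi_alpha 1 = 0"
  by (simp_all add: phi_0 phi_1 rho_derived(1))

lemma mc_series: "series_sum V 3 (\<lambda>n. c_scale V (1 / fact n) (phi_alpha n)) (- c_diff V 2 \<alpha>)"
proof -
  obtain s where s: "filt_sums V 3 2 (\<lambda>n. c_scale V (1 / fact n) (phi_alpha n)) s" "c_diff V 2 \<alpha> + s = 0"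
    using mc by (auto simp: maurer_cartan_def)
  have "s - (\<Sum>r<k. c_scale V (1 / fact r) (phi_alpha r)) \<in> c_filt V k 3" for k
    using s(1) unfolding filt_sums_def
    by (subst V.filt_sums_iff_series[symmetric])
      (auto intro: V.filt_closed(5) phi_alpha_filt simp: phi_alpha_small[simplified])
  then have "series_sum V 3 (\<lambda>n. c_scale V (1 / fact n) (phi_alpha n)) s"
    using s(1) by (simp add: series_sum_def filt_sums_def)
  moreover have "s = - c_diff V 2 \<alpha>" using s(2) by (simp add: eq_neg_iff_add_eq_0 add.commute)
  ultimately show ?thesis by simp
qed

lemma diff_alpha_filt: "c_diff V 2 \<alpha> \<in> c_filt V 1 3"
  using V.filt_diff[OF alpha_filt] by simp

text \<open>The differential of the endomorphism operad, applied to the operation of \<open>f\<^sub>r\<close> and evaluated on copies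
  of \<open>\<alpha>\<close>, has \<open>r\<close> equal terms \<open>f\<^sub>r(\<partial>\<alpha>, \<alpha>, \<dots>, \<alpha>, xs)\<close>. Replacing \<open>\<partial>\<alpha>\<close> by the Maurer--Cartan series turns
  the sum of these terms over \<open>r\<close> into a double series, whose diagonal sums are the values of the second
  summand of \<open>tw_base_diff\<close>.\<close>

lemma twisted_base_diff:
  assumes f: "f \<in> tw_car P n d"
  shows "twisted n (d + 1) (tw_base_diff P \<phi> n d f) = end_diff V n d (twisted n d f)"
proof
  fix xs
  show "twisted n (d + 1) (tw_base_diff P \<phi> n d f) xs = end_diff V n d (twisted n d f) xs"
  proof (cases "xs \<in> hvecs V n")
    case xs: True
    note fc = tw_car_car[OF f]
    let ?D = "tdeg xs + (d + 1)"
    let ?da = "c_diff V 2 \<alpha>"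
    have D: "?D = tdeg xs + d + 1" by simp
    define dx where "dx j = xs[j := (fst (xs ! j) + 1, c_diff V (fst (xs ! j)) (snd (xs ! j)))]" for j
    have dx: "dx j \<in> hvecs V n" "tdeg (dx j) + d = ?D" if j: "j < n" for j
    proof -
      have len: "length xs = n" using hvecs_length[OF xs] .
      have up: "dx j = take j xs @ (fst (xs ! j) + 1, c_diff V (fst (xs ! j)) (snd (xs ! j))) # drop
          (Suc j) xs"
        unfolding dx_def using j len by (simp add: upd_conv_take_nth_drop)
      show "dx j \<in> hvecs V n"
        unfolding up by (rule slot_hvecs[OF hvecs_take[OF xs] hvecs_drop[OF xs]])
          (use j linear_on_in[OF V.diff_linear hvecs_nth[OF xs j]] in auto)
      have "tdeg xs = tdeg (take j xs) + (fst (xs ! j) + tdeg (drop (Suc j) xs))"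
        using id_take_nth_drop[of j xs] j len by (metis tdeg_append tdeg_Cons)
      then show "tdeg (dx j) + d = ?D" unfolding up by simp
    qed
    \<comment> \<open>\<open>H s (\<partial>\<alpha>)\<close> is the contribution \<open>A (s + 1)\<close> of the copies of \<open>\<alpha>\<close>: the factor \<open>s + 1\<close> counts the
      positions that the differential can hit.\<close>
    define H where "H s x
        = c_scale V (1 / fact s) (\<rho> (s + 1 + n) (d - 2 * int (s + 1)) (f (s + 1)) ((3, x) # alphas s @ xs))"
      for s x
    define A where "A r = c_scale V (1 / fact r)
      (\<Sum>j<r. \<rho> (r + n) (d - 2 * int r) (f r) ((3, ?da) # alphas (r - 1) @ xs))" for r
    have Hlin: "linear_on (c_scale V) (c_scale V) (c_car V 3) (c_car V ?D) (H s)" for s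
    proof -
      have a: "0 + 1 + (s + n) = s + 1 + n" by simp
      have "linear_on (c_scale V) (c_scale V) (c_car V 3) (c_car V ?D)
        (\<lambda>x. c_scale V (1 / fact s)
            (\<rho> (0 + (s + 1 + n)) (d - 2 * int (s + 1)) (f (s + 1))
            (alphas 0 @ [] @ (3, x) # (alphas s @ xs))))"
        by (rule rho_slot_linear[where a = 0 and b = "s + n", OF _ _ alphas_hvecs[OF xs] a])
          (use fc[of "s + 1"] in simp_all)
      then show ?thesis by (simp add: H_def[abs_def])
    qed
    have Hfilt: "H s x \<in> c_filt V (s + k) ?D" if "x \<in> c_filt V k 3" for s k x
    proof -
      let ?g = "\<rho> (s + 1 + n) (d - 2 * int (s + 1)) (f (s + 1))"
      have "?g ((3, x) # alphas s @ xs) \<in> c_filt V (sum_list (k # replicate s 1 @ replicate n 0) + 0)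
          (tdeg ((3, x) # alphas s @ xs) + (d - 2 * int (s + 1)))"
      proof (rule end_filtD[OF rho_filt[OF fc]])
        fix j assume j: "j < s + 1 + n"
        show "snd (((3, x) # alphas s @ xs) ! j) \<in> c_filt V ((k # replicate s 1 @ replicate n 0) ! j)
            (fst (((3, x) # alphas s @ xs) ! j))"
          using j that alpha_filt hvecs_nth[OF xs, of "j - 1 - s"]
          by (auto simp: nth_append nth_Cons' V.filt_0)
      qed (use hvecs_length[OF xs] in auto)
      then show ?thesis unfolding H_def by (intro V.filt_closed(5)) (simp add: sum_list_replicate ac_simps)
    qed
    have A_Suc: "A (Suc s) = H s ?da" for s
    proof -
      have "(of_nat (Suc s) :: 'k) \<noteq> 0" by (rule of_nat_neq_0)
      then have "1 / fact (Suc s) * of_nat (Suc s) = (1 / fact s :: 'k)"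
        by (simp add: field_simps del: of_nat_Suc)
      then show ?thesis
        unfolding A_def H_def scaling.sum_constant_scale scaling.scale_scale by simp
    qed
    have A_filt: "A r \<in> c_filt V r ?D" for r
    proof (cases r)
      case 0
      then show ?thesis using V.filt_closed(1) by (simp add: A_def)
    next
      case (Suc s)
      then show ?thesis using Hfilt[OF diff_alpha_filt, of s] A_Suc by simp
    qed
    obtain a where a: "series_sum V ?D A a" using V.series_exists[OF A_filt] by blast
    define T where "T s p = H s (c_scale V (1 / fact p) (phi_alpha p))" for s p
    \<comment> \<open>The series of the \<open>A r\<close> and of the \<open>H s (- \<partial>\<alpha>)\<close> are shifted by one; as \<open>A 0 = 0\<close> and the error
      bounds improve with the index, their sums are opposite.\<close>
    have Tser: "series_sum V ?D (\<lambda>r. \<Sum>s\<le>r. T s (r - s)) (- a)"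
    proof (rule V.series_diagonal)
      have da: "?da \<in> c_car V 3" using V.filt_car[OF diff_alpha_filt] .
      have H_neg: "H s (- ?da) = - A (Suc s)" for s
        unfolding A_Suc using linear_on_uminus[OF V.vector_space V.subspace Hlin da] .
      show "series_sum V ?D (\<lambda>s. H s (- ?da)) (- a)"
        unfolding series_sum_def
      proof (intro conjI allI)
        show "- a \<in> c_car V ?D" using a V.car_closed(4) by (simp add: series_sum_def)
        fix k
        have "a - (\<Sum>r<Suc k. A r) \<in> c_filt V (Suc k) ?D" using a unfolding series_sum_def by blast
        then have "a - (\<Sum>r<Suc k. A r) \<in> c_filt V k ?D" by (rule V.filt_mono[rotated]) simp
        then have "- (a - (\<Sum>r<Suc k. A r)) \<in> c_filt V k ?D" by (rule V.filt_closed(4))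
        moreover have "(\<Sum>r<Suc k. A r) = (\<Sum>s<k. A (Suc s))"
          by (subst sum.lessThan_Suc_shift) (simp add: A_def)
        ultimately show "- a - (\<Sum>s<k. H s (- ?da)) \<in> c_filt V k ?D"
          by (simp add: H_neg sum_negf)
      qed
      fix s m
      show "H s (- ?da) - (\<Sum>q<m. T s q) \<in> c_filt V (s + m) ?D"
        unfolding T_def by (rule series_map(1)[OF complete_filtered Hlin Hfilt mc_series])
    qed
    have terms: "twterm n (d + 1) (tw_base_diff P \<phi> n d f) xs r =
        c_diff V (tdeg xs + d) (twterm n d f xs r) - signed d (A r)
        - signed d (\<Sum>j<n. signed (tdeg (take j xs)) (twterm n d f (dx j) r))
        - signed d (\<Sum>s\<le>r. T s (r - s))" for r
    proof -
      let ?c = "1 / fact r :: 'k"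
      let ?R = "\<rho> (r + n) (d + 1 - 2 * int r)"
      let ?X = "\<lambda>p. tw_base_comp P \<phi> n d f r p"
      let ?A = "o_act P (r + n) (d + 1 - 2 * int r)"
      have X: "?X p \<in> o_car P (r + n) (d + 1 - 2 * int r)" if "p \<in> {1..r}" for p
        using tw_base_young[OF f, of p r] that by (simp add: young_invariants_def)
      have AX: "?A \<sigma> (?X p) \<in> o_car P (r + n) (d + 1 - 2 * int r)" if "p \<in> {1..r}" "\<sigma> \<in> Sh p (r - p)" for p \<sigma>
        by (rule act_car[OF permutes_le[OF Sh_permutes[OF that(2)]] X[OF that(1)]]) (use that in auto)
      have sumX: "(\<Sum>\<sigma>\<in>Sh p (r - p). ?A \<sigma> (?X p)) \<in> o_car P (r + n) (d + 1 - 2 * int r)" if "p \<in> {1..r}" for p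
        by (rule car_sum) (rule AX[OF that])
      have deg: "d - 2 * int r + 1 = d + 1 - 2 * int r" by simp
      have df: "o_diff P (r + n) (d - 2 * int r) (f r) \<in> o_car P (r + n) (d + 1 - 2 * int r)"
        using linear_on_in[OF diff_linear fc, of r] unfolding deg .
      have R: "?R (tw_base_diff P \<phi> n d f r) (alphas r @ xs) =
          ?R (o_diff P (r + n) (d - 2 * int r) (f r)) (alphas r @ xs)
          - signed d (\<Sum>p=1..r. ?R (\<Sum>\<sigma>\<in>Sh p (r - p). ?A \<sigma> (?X p)) (alphas r @ xs))"
      proof -
        have sc: "(\<Sum>p=1..r. \<Sum>\<sigma>\<in>Sh p (r - p). ?A \<sigma> (?X p)) \<in> o_car P (r + n) (d + 1 - 2 * int r)"
          by (rule car_sum) (rule sumX)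
        have "?R (tw_base_diff P \<phi> n d f r) = ?R (o_diff P (r + n) (d - 2 * int r) (f r))
          - signed d (\<Sum>p=1..r. ?R (\<Sum>\<sigma>\<in>Sh p (r - p). ?A \<sigma> (?X p)))"
          unfolding tw_base_diff_def rho_derived(3)[OF df car_signed[OF sc]] rho_derived(4)[OF sc]
          by (subst rho_derived(5)) (rule sumX, assumption, rule refl)
        then show ?thesis by (simp only: minus_apply signed_fun_apply sum_fun_apply)
      qed
      have one: "c_scale V ?c (?R (o_diff P (r + n) (d - 2 * int r) (f r)) (alphas r @ xs)) =
          c_diff V (tdeg xs + d) (twterm n d f xs r) - signed d (A r)
          - signed d (\<Sum>j<n. signed (tdeg (take j xs)) (twterm n d f (dx j) r))"
      proof -
        let ?g = "\<rho> (r + n) (d - 2 * int r) (f r)"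
        have inv: "end_act V (r + n) (d - 2 * int r) \<sigma> ?g = ?g" if "\<sigma> permutes {1..r}" for \<sigma>
        proof -
          have "\<sigma> permutes {1..r + n}" by (rule permutes_le[OF that]) simp
          from rho_act[OF fc this] show ?thesis unfolding invariants_act[OF tw_carD[OF f] that] by simp
        qed
        have par: "signed (d - 2 * int r) v = signed d v" for v :: 'v by (rule signed_cong_parity) simp
        have deg': "2 * int r + tdeg xs + (d - 2 * int r) = tdeg xs + d" by simp
        have g: "?g (alphas r @ xs) \<in> c_car V (tdeg xs + d)"
          using end_car_in[OF rho_car[OF fc] alphas_hvecs[OF xs], of r] by simp
        have "?R (o_diff P (r + n) (d - 2 * int r) (f r)) (alphas r @ xs)
            = end_diff V (r + n) (d - 2 * int r) ?g (alphas r @ xs)"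
          using rho_diff[OF fc, of r] unfolding deg by simp
        also have "\<dots> = c_diff V (tdeg xs + d) (?g (alphas r @ xs))
            - signed d (\<Sum>j<r. ?g ((3, ?da) # alphas (r - 1) @ xs))
            - signed d (\<Sum>j<n. signed (tdeg (take j xs)) (?g (alphas r @ dx j)))"
          using end_diff_special[OF V.cochain_complex_axioms rho_car[OF fc] inv alpha_car xs]
          unfolding par deg' dx_def[symmetric] .
        finally show ?thesis
          unfolding twterm_def A_def linear_on_scale[OF V.diff_linear g]
          by (simp only: scaling.scale_right_diff_distrib scale_signed scaling.scale_sum_right)
      qed
      have two: "c_scale V ?c (?R (\<Sum>\<sigma>\<in>Sh p (r - p). ?A \<sigma> (?X p)) (alphas r @ xs)) = T (r - p) p"
        if p: "p \<in> {1..r}" for p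
      proof -
        let ?s = "r - p"
        let ?g = "\<rho> (?s + 1 + n) (d - 2 * int (?s + 1)) (f (?s + 1))" and ?h = "\<rho> p (3 - 2 * int p) (\<phi> p)"
        have ar: "?s + 1 + n + p - 1 = r + n" "d - 2 * int (?s + 1) + (3 - 2 * int p) = d + 1 - 2 * int r"
          using p by auto
        have al: "alphas r = alphas p @ alphas ?s" using p by (simp add: replicate_add[symmetric])
        have hv: "[] @ alphas p @ (alphas ?s @ xs) \<in> hvecs V (?s + 1 + n + p - 1)"
          unfolding ar(1) using alphas_hvecs[OF xs, of r] unfolding al by simp
        have pa: "phi_alpha p \<in> c_car V 3" using V.filt_car[OF phi_alpha_filt] .
        have "c_scale V ?c (?R (\<Sum>\<sigma>\<in>Sh p (r - p). ?A \<sigma> (?X p)) (alphas r @ xs)) =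
            c_scale V (1 / (fact p * fact ?s)) (?R (?X p) (alphas r @ xs))"
          by (rule rho_shuffle_sum[OF X[OF p] xs]) (use p in simp)
        also have "?R (?X p) = end_ins V (?s + 1 + n) (d - 2 * int (?s + 1)) p (3 - 2 * int p) 1 ?g ?h"
          unfolding ar[symmetric] by (rule rho_ins[OF fc phi_car]) auto
        also have "\<dots> (alphas r @ xs) = ?g ((3, phi_alpha p) # alphas ?s @ xs)"
          using end_ins_eval[OF hv, of 1 "d - 2 * int (?s + 1)" "3 - 2 * int p" ?g ?h] unfolding al
          by (simp add: signed_even)
        also have "c_scale V (1 / (fact p * fact ?s)) \<dots> = c_scale V (1 / fact p) (H ?s (phi_alpha p))"
          by (simp add: H_def)
        also have "\<dots> = T ?s p" unfolding T_def linear_on_scale[OF Hlin pa] ..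
        finally show ?thesis .
      qed
      have three: "(\<Sum>p=1..r. T (r - p) p) = (\<Sum>s\<le>r. T s (r - s))"
      proof -
        have "T r 0 = 0"
          unfolding T_def phi_alpha_small using linear_on_zero[OF V.vector_space V.subspace Hlin] by simp
        then have "(\<Sum>p=1..r. T (r - p) p) = (\<Sum>p\<le>r. T (r - p) p)"
          by (intro sum.mono_neutral_left) (auto simp: not_le)
        also have "\<dots> = (\<Sum>s\<le>r. T s (r - s))"
          by (rule sum.reindex_bij_witness[of _ "\<lambda>s. r - s" "\<lambda>s. r - s"]) auto
        finally show ?thesis .
      qed
      have "twterm n (d + 1) (tw_base_diff P \<phi> n d f) xs r = 
         c_scale V ?c (?R (o_diff P (r + n) (d - 2 * int r) (f r)) (alphas r @ xs))
         - signed d (\<Sum>p=1..r. c_scale V ?c (?R (\<Sum>\<sigma>\<in>Sh p (r - p). ?A \<sigma> (?X p)) (alphas r @ xs)))"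
        unfolding twterm_def R
          by (simp only: scaling.scale_right_diff_distrib scale_signed scaling.scale_sum_right)
      also have "(\<Sum>p=1..r. c_scale V ?c (?R (\<Sum>\<sigma>\<in>Sh p (r - p). ?A \<sigma> (?X p)) (alphas r @ xs)))
          = (\<Sum>p=1..r. T (r - p) p)"
        by (rule sum.cong[OF refl]) (rule two)
      finally show ?thesis unfolding one three .
    qed
    have s1: "series_sum V ?D (\<lambda>r. c_diff V (tdeg xs + d) (twterm n d f xs r))
        (c_diff V (tdeg xs + d) (twisted n d f xs))"
      unfolding D
      by (rule series_map(2)[OF complete_filtered V.diff_linear _ twisted_series[OF f xs]])
          (use V.filt_diff in simp_all)
    have s2: "series_sum V ?D (\<lambda>r. \<Sum>j<n. signed (tdeg (take j xs)) (twterm n d f (dx j) r))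
        (\<Sum>j<n. signed (tdeg (take j xs)) (twisted n d f (dx j)))"
      by (rule V.series_finite_sum, rule V.series_signed)
        (use twisted_series[OF f dx(1)] dx(2) in simp)
    have "series_sum V ?D (twterm n (d + 1) (tw_base_diff P \<phi> n d f) xs)
       (c_diff V (tdeg xs + d) (twisted n d f xs) - signed d a
        - signed d (\<Sum>j<n. signed (tdeg (take j xs)) (twisted n d f (dx j))) - signed d (- a))"
      unfolding terms[abs_def]
      by (intro V.series_diff V.series_signed s1 a s2 Tser)
    from twisted_eqI[OF tw_base_diff_car[OF f] xs this]
    show ?thesis unfolding end_diff_def dx_def[symmetric] using xs by (simp add: signed_minus)
  qed (simp add: twisted_outside end_diff_def)
qed

definition twisted_complex :: "('k, 'v) filtered_cochains"
  where "twisted_complex = perturb V (twisted 1 1 (tw_kappa \<phi>))"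

lemma kappa_filt: "tw_kappa \<phi> \<in> tw_filt P 0 1 1"
  using kappa_car by (simp add: tw_filt_def)

lemma twisted_derived:
  shows twisted_0: "twisted n d 0 = 0"
    and twisted_add: "f \<in> tw_car P n d \<Longrightarrow> g \<in> tw_car P n d \<Longrightarrow> twisted n d (f + g) = twisted n d f
        + twisted n d g"
    and twisted_minus: "f \<in> tw_car P n d \<Longrightarrow> g \<in> tw_car P n d \<Longrightarrow> twisted n d (f - g)
        = twisted n d f - twisted n d g"
    and twisted_signed: "f \<in> tw_car P n d \<Longrightarrow> twisted n d (signed k f) = signed k (twisted n d f)"
    and twisted_sum: "(\<And>i. i \<in> I \<Longrightarrow> F i \<in> tw_car P n d) \<Longrightarrow> twisted n d (sum F I) = (\<Sum>i\<in>I. twisted n d (F i))"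
proof -
  note D = linear_on_derived[OF tw_vector_space[of \<phi>, unfolded Tw_def operad.simps]
      tw_car_subspace[of \<phi>, unfolded Tw_def operad.simps] twisted_linear]
  show "twisted n d 0 = 0" by (rule D(1))
  show "twisted n d (f - g) = twisted n d f - twisted n d g" if "f \<in> tw_car P n d" "g \<in> tw_car P n d"
    using that by (rule D(3))
  show "twisted n d (signed k f) = signed k (twisted n d f)" if "f \<in> tw_car P n d" using that by (rule D(4))
  show "twisted n d (sum F I) = (\<Sum>i\<in>I. twisted n d (F i))" if "\<And>i. i \<in> I \<Longrightarrow> F i \<in> tw_car P n d"
    using that by (rule D(5))
  show "twisted n d (f + g) = twisted n d f + twisted n d g" if "f \<in> tw_car P n d" "g \<in> tw_car P n d"
    using that by (rule linear_on_add[OF twisted_linear])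
qed

text \<open>The Maurer--Cartan equation of the perturbation is the image of \<open>kappa_square\<close>.\<close>

lemma twisted_complete: "complete_filtered_complex twisted_complex"
  unfolding twisted_complex_def
proof (rule perturb_complete[OF complete_filtered twisted_end_car[OF kappa_car] twisted_filt[OF kappa_filt]])
  let ?\<kappa> = "tw_kappa \<phi>"
  have "end_diff V 1 1 (twisted 1 1 ?\<kappa>) + end_ins V 1 1 1 1 1 (twisted 1 1 ?\<kappa>) (twisted 1 1 ?\<kappa>) =
      twisted 1 2 (tw_base_diff P \<phi> 1 1 ?\<kappa> + tw_ins P 1 1 1 1 1 ?\<kappa> ?\<kappa>)"
    using twisted_base_diff[OF kappa_car] twisted_ins[OF kappa_car kappa_car, of 1]
      twisted_add[OF tw_base_diff_car[OF kappa_car] tw_kappa_ins_car(1)[OF kappa_car]]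
    by simp
  also have "\<dots> = 0" unfolding kappa_square by (rule twisted_0)
  finally show "end_diff V 1 1 (twisted 1 1 ?\<kappa>) + end_ins V 1 1 1 1 1 (twisted 1 1 ?\<kappa>) (twisted 1 1 ?\<kappa>) = 0" .
qed

lemma twisted_diff:
  assumes f: "f \<in> tw_car P n d"
  shows "twisted n (d + 1) (tw_diff P \<phi> n d f) = end_diff twisted_complex n d (twisted n d f)"
proof -
  let ?\<kappa> = "tw_kappa \<phi>" and ?K = "twisted 1 1 (tw_kappa \<phi>)"
  note cl = subspace_closed[OF tw_vector_space[of \<phi>] tw_car_subspace[of \<phi>]]
  note b = tw_base_diff_car[OF f] and l = tw_kappa_ins_car(1)[OF f] and r = tw_kappa_ins_car(2)[OF f]
  have sr: "(\<Sum>i=1..n. tw_ins P n d 1 1 i f ?\<kappa>) \<in> tw_car P n (d + 1)" by (rule cl(7)) (rule r)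
  have tsum: "twisted n (d + 1) (\<Sum>i=1..n. tw_ins P n d 1 1 i f ?\<kappa>) =
      (\<Sum>i=1..n. twisted n (d + 1) (tw_ins P n d 1 1 i f ?\<kappa>))"
    by (rule twisted_sum) (rule r)
  have "twisted n (d + 1) (tw_diff P \<phi> n d f) = twisted n (d + 1) (tw_base_diff P \<phi> n d f)
      + twisted n (d + 1) (tw_ins P 1 1 n d 1 ?\<kappa> f)
      - signed d (\<Sum>i=1..n. twisted n (d + 1) (tw_ins P n d 1 1 i f ?\<kappa>))"
    unfolding tw_diff_eq[OF f] twisted_minus[OF cl(2)[OF b l] cl(6)[OF sr]] twisted_add[OF b l]
      twisted_signed[OF sr] tsum ..
  also have "twisted n (d + 1) (tw_ins P 1 1 n d 1 ?\<kappa> f) = end_ins V 1 1 n d 1 ?K (twisted n d f)"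
    using twisted_ins[OF kappa_car f, of 1] by (simp add: add.commute)
  also have "(\<Sum>i=1..n. twisted n (d + 1) (tw_ins P n d 1 1 i f ?\<kappa>))
      = (\<Sum>i=1..n. end_ins V n d 1 1 i (twisted n d f) ?K)"
    by (rule sum.cong[OF refl]) (use twisted_ins[OF f kappa_car] in simp)
  finally show ?thesis
    unfolding twisted_complex_def twisted_base_diff[OF f]
      end_diff_perturb[OF V.cochain_complex_axioms twisted_end_car[OF kappa_car] twisted_end_car[OF f]] .
qed

theorem twisted_algebra: "filtered_tw_algebra P \<phi> twisted_complex twisted"
proof -
  have "dg_operad_map (Tw P \<phi>) (End_operad twisted_complex) twisted"
    unfolding dg_operad_map_def graded_operad_map_def dg_operad_map_axioms_def
    using twisted_linear twisted_unit twisted_act twisted_ins twisted_diff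
    by (simp add: Tw_def End_operad_def) (simp add: twisted_complex_def)
  moreover have "twisted n d f = 0" if "f \<notin> tw_car P n d" for n d f
    using that by (simp add: twisted_def fun_eq_iff)
  ultimately show ?thesis
    using twisted_complete twisted_filt
    unfolding filtered_tw_algebra_def operad_algebra_def complete_filtered_complex_def
    by (simp add: Tw_def) (simp add: twisted_complex_def)
qed

end


section \<open>Recovering the algebra and the Maurer--Cartan element\<close>

definition tw_mono :: "nat \<Rightarrow> 'o::zero \<Rightarrow> nat \<Rightarrow> 'o"
  where "tw_mono s f r = (if r = s then f else 0)"

definition untwisted_map :: "(nat \<Rightarrow> 'o::zero, 'v) structure_map \<Rightarrow> ('o, 'v) structure_map"
  where "untwisted_map \<rho> n d f = \<rho> n d (tw_mono 0 f)"

definition untwisted_point :: "('k, 'o::zero) operad \<Rightarrow> (nat \<Rightarrow> 'o, 'v) structure_map \<Rightarrow> 'v"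
  where "untwisted_point P \<rho> = \<rho> 0 2 (tw_mono 1 (o_unit P)) []"

definition untwisted_complex ::
  "(nat \<Rightarrow> 'o::zero) \<Rightarrow> ('k, 'v::ab_group_add) filtered_cochains \<Rightarrow> (nat \<Rightarrow> 'o, 'v) structure_map \<Rightarrow>
    ('k, 'v) filtered_cochains"
  where "untwisted_complex \<phi> V \<rho> = perturb V (- \<rho> 1 1 (tw_kappa \<phi>))"

lemma untwisted_complex_simps [simp]:
  "c_scale (untwisted_complex \<phi> V \<rho>) = c_scale V" "c_car (untwisted_complex \<phi> V \<rho>) = c_car V"
  "c_filt (untwisted_complex \<phi> V \<rho>) = c_filt V" "hvecs (untwisted_complex \<phi> V \<rho>) = hvecs V"
  "c_diff (untwisted_complex \<phi> V \<rho>) d x = c_diff V d x - \<rho> 1 1 (tw_kappa \<phi>) [(d, x)]"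
  by (simp_all add: untwisted_complex_def)

text \<open>Apply the Leibniz rule to \<open>u \<circ>\<^sub>1 u = u\<close>.\<close>

lemma (in dg_operad) diff_unit: "o_diff P 1 0 (o_unit P) = 0"
proof -
  have du: "o_diff P 1 0 (o_unit P) \<in> o_car P 1 1" using linear_on_in[OF diff_linear unit_closed] by simp
  have "o_diff P 1 0 (o_unit P) = o_diff P 1 0 (o_unit P) + o_diff P 1 0 (o_unit P)"
    using diff_ins[OF unit_closed unit_closed, of 1] ins_unit[OF du, of 1] unit_ins[OF du]
      ins_unit[OF unit_closed, of 1] by (simp add: signed_def)
  then show ?thesis by simp
qed

context graded_operad
begin

lemma tw_mono_car_iff: "tw_mono s f \<in> tw_car P n d \<longleftrightarrow> f \<in> o_invariants P s (s + n) (d - 2 * int s)"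
  by (auto simp: tw_car_def tw_mono_def)

lemma tw_mono_0_car_iff: "tw_mono 0 f \<in> tw_car P n d \<longleftrightarrow> f \<in> o_car P n d"
  by (simp add: tw_mono_car_iff)

lemma tw_point_car: "tw_mono 1 (o_unit P) \<in> tw_car P 0 2"
proof -
  have "o_unit P \<in> o_invariants P 1 1 0"
    unfolding o_invariants_def using unit_closed act_id[OF unit_closed] by simp
  then show ?thesis unfolding tw_mono_car_iff by simp
qed

lemma tw_comp_zero:
  assumes f: "f \<in> tw_car P n d" and g: "g \<in> tw_car P m e" and i: "1 \<le> i" "i \<le> n"
    and z: "f p = 0 \<or> g q = 0"
  shows "tw_comp P n d m e i f g p q = 0"
proof -
  have "o_ins P (p + n) (d - 2 * int p) (q + m) (e - 2 * int q) (p + i) (f p) (g q) = 0"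
    using z ins_zero_left[OF tw_car_car[OF g, of q], of "p + i" "p + n"]
      ins_zero_right[OF tw_car_car[OF f, of p], of "p + i"] i by auto
  moreover have "slot_perm p q i permutes {1..p + q + n + m - 1}" by (rule slot_perm_permutes) (use i in auto)
  ultimately show ?thesis unfolding tw_comp_def by simp
qed

text \<open>All other summands of the composite involve a vanishing component of one of the two factors.\<close>

lemma tw_ins_mono:
  assumes f: "tw_mono s f \<in> tw_car P n d" and g: "tw_mono t g \<in> tw_car P m e" and i: "1 \<le> i" "i \<le> n"
  shows "tw_ins P n d m e i (tw_mono s f) (tw_mono t g) = tw_mono (s + t)
    (\<Sum>\<sigma>\<in>Sh s t. o_act P (s + t + n + m - 1) (d + e - 2 * int (s + t)) \<sigma>
        (tw_comp P n d m e i (tw_mono s f) (tw_mono t g) s t))"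
proof
  fix r
  let ?A = "\<lambda>p. o_act P (r + n + m - 1) (d + e - 2 * int r)"
  let ?X = "\<lambda>p. tw_comp P n d m e i (tw_mono s f) (tw_mono t g) p (r - p)"
  have z: "(\<Sum>\<sigma>\<in>Sh p (r - p). ?A p \<sigma> (?X p)) = 0" if p: "p \<le> r" "p \<noteq> s \<or> r - p \<noteq> t" for p
  proof (rule sum.neutral, rule ballI)
    fix \<sigma> assume s: "\<sigma> \<in> Sh p (r - p)"
    have "\<sigma> permutes {1..r + n + m - 1}" by (rule permutes_le[OF Sh_permutes[OF s]]) (use p i in auto)
    moreover have "?X p = 0" by (rule tw_comp_zero[OF f g i]) (use p in \<open>auto simp: tw_mono_def\<close>)
    ultimately show "?A p \<sigma> (?X p) = 0" by simp
  qed
  show "tw_ins P n d m e i (tw_mono s f) (tw_mono t g) r = tw_mono (s + t)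
    (\<Sum>\<sigma>\<in>Sh s t. o_act P (s + t + n + m - 1) (d + e - 2 * int (s + t)) \<sigma>
        (tw_comp P n d m e i (tw_mono s f) (tw_mono t g) s t)) r"
  proof (cases "r = s + t")
    case True
    have "(\<Sum>p\<le>r. \<Sum>\<sigma>\<in>Sh p (r - p). ?A p \<sigma> (?X p)) = (\<Sum>p\<in>{s}. \<Sum>\<sigma>\<in>Sh p (r - p). ?A p \<sigma> (?X p))"
      by (rule sum.mono_neutral_right) (use True z in auto)
    then show ?thesis unfolding tw_ins_eq[OF f g i] by (simp add: True tw_mono_def)
  next
    case False
    have "(\<Sum>p\<le>r. \<Sum>\<sigma>\<in>Sh p (r - p). ?A p \<sigma> (?X p)) = 0"
      by (rule sum.neutral, rule ballI, rule z) (use False in auto)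
    then show ?thesis unfolding tw_ins_eq[OF f g i] using False by (simp add: tw_mono_def)
  qed
qed

lemma tw_ins_mono_0:
  assumes f: "f \<in> o_car P n d" and g: "g \<in> o_car P m e" and i: "1 \<le> i" "i \<le> n"
  shows "tw_ins P n d m e i (tw_mono 0 f) (tw_mono 0 g) = tw_mono 0 (o_ins P n d m e i f g)"
proof -
  have "tw_mono 0 f \<in> tw_car P n d" "tw_mono 0 g \<in> tw_car P m e" using f g
    by (simp_all add: tw_mono_0_car_iff)
  moreover have "o_act P (n + m - 1) (d + e) id (o_act P (n + m - 1) (d + e) id (o_ins P n d m e i f g))
      = o_ins P n d m e i f g"
    using act_id[OF ins_car[OF f g i]] by simp
  ultimately show ?thesis
    using i by (subst tw_ins_mono) (simp_all add: tw_comp_def slot_perm_0 tw_mono_def)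
qed

lemma tw_act_mono_0:
  assumes f: "f \<in> o_car P n d" and \<sigma>: "\<sigma> permutes {1..n}"
  shows "tw_act P n d \<sigma> (tw_mono 0 f) = tw_mono 0 (o_act P n d \<sigma> f)"
proof
  fix r
  have "tw_shift r \<sigma> permutes {1..r+n}" by (rule permutes_subset[OF tw_shift_permutes[OF \<sigma>]]) auto
  moreover have "tw_shift 0 \<sigma> = \<sigma>"
    using permutes_atLeastAtMost_fixes(1)[OF \<sigma>, of 0] by (auto simp: tw_shift_def fun_eq_iff)
  ultimately show "tw_act P n d \<sigma> (tw_mono 0 f) r = tw_mono 0 (o_act P n d \<sigma> f) r"
    by (simp add: tw_act_eq tw_mono_def)
qed

text \<open>The composite sums the translates of \<open>f\<close> under the shuffles of one new special input into the \<open>s\<close> old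
  ones, and \<open>f\<close> is invariant under all of them. Each insertion thus turns one more ordinary input into a
  special one, at the price of a factor \<open>s + 1\<close>.\<close>

lemma tw_ins_point:
  assumes f: "f \<in> o_invariants P (Suc s) (Suc s + n) (d - 2 * int s)"
  shows "tw_ins P (Suc n) d 0 2 1 (tw_mono s f) (tw_mono 1 (o_unit P)) = tw_mono (Suc s) (\<Sum>\<sigma>\<in>Sh s 1. f)"
proof -
  have fs: "tw_mono s f \<in> tw_car P (Suc n) d"
    using invariants_mono[OF f, of s] by (simp add: tw_mono_car_iff)
  have comp: "tw_comp P (Suc n) d 0 2 1 (tw_mono s f) (tw_mono 1 (o_unit P)) s 1 = f"
    using ins_unit[OF invariants_car[OF f], of "Suc s"] act_id[OF invariants_car[OF f]]
    unfolding tw_comp_def slot_perm_first by (simp add: tw_mono_def)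
  have ar: "s + 1 = Suc s" "Suc s + Suc n + 0 - 1 = Suc s + n" "d + 2 - 2 * int (Suc s) = d - 2 * int s"
    by auto
  have "o_act P (Suc s + n) (d - 2 * int s) \<sigma> f = f" if "\<sigma> \<in> Sh s 1" for \<sigma>
    using invariants_act[OF f] Sh_permutes[OF that] by simp
  then have "(\<Sum>\<sigma>\<in>Sh s 1. o_act P (Suc s + n) (d - 2 * int s) \<sigma> f) = (\<Sum>\<sigma>\<in>Sh s 1. f)"
    by (rule sum.cong[OF refl])
  moreover have "1 \<le> Suc n" by simp
  ultimately show ?thesis
    unfolding tw_ins_mono[OF fs tw_point_car order.refl \<open>1 \<le> Suc n\<close>] comp ar by (simp only:)
qed

end

lemma (in twisting) tw_base_diff_mono_0:
  assumes f: "f \<in> o_car P n d"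
  shows "tw_base_diff P \<phi> n d (tw_mono 0 f) = tw_mono 0 (o_diff P n d f)"
proof
  fix r
  have z: "o_diff P (r + n) (d - 2 * int r) 0 = 0"
    by (rule linear_on_zero[OF vector_space subspace diff_linear])
  have "(\<Sum>p=1..r. \<Sum>\<sigma>\<in>Sh p (r - p). o_act P (r + n) (d + 1 - 2 * int r) \<sigma>
      (tw_base_comp P \<phi> n d (tw_mono 0 f) r p)) = 0"
  proof (intro sum.neutral ballI)
    fix p \<sigma> assume p: "p \<in> {1..r}" and s: "\<sigma> \<in> Sh p (r - p)"
    have "\<sigma> permutes {1..r + n}" by (rule permutes_le[OF Sh_permutes[OF s]]) (use p in auto)
    then show "o_act P (r + n) (d + 1 - 2 * int r) \<sigma> (tw_base_comp P \<phi> n d (tw_mono 0 f) r p) = 0"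
      using ins_zero_left[OF phi_car, of 1 "r - p + 1 + n"] by (simp add: tw_mono_def)
  qed
  then show "tw_base_diff P \<phi> n d (tw_mono 0 f) r = tw_mono 0 (o_diff P n d f) r"
    unfolding tw_base_diff_def using z by (simp add: tw_mono_def)
qed

text \<open>In position \<open>r\<close> only the summand \<open>p = r\<close> of the differential survives; it inserts \<open>\<phi> r\<close> into the unit.
  This is how the Maurer--Cartan equation is encoded in the twisted operad.\<close>

lemma (in twisting) tw_base_diff_point: "tw_base_diff P \<phi> 0 2 (tw_mono 1 (o_unit P)) = - \<phi>"
proof
  fix r
  let ?u = "tw_mono 1 (o_unit P)"
  let ?t = "\<lambda>p \<sigma>. o_act P (r + 0) (2 + 1 - 2 * int r) \<sigma>
        (o_ins P (r - p + 1 + 0) (2 - 2 * int (r - p + 1)) p (3 - 2 * int p) 1 (?u (r - p + 1)) (\<phi> p))"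
  have "o_diff P (r + 0) (2 - 2 * int r) (?u r) = 0"
    using linear_on_zero[OF vector_space subspace diff_linear] diff_unit by (simp add: tw_mono_def)
  moreover have "(\<Sum>p=1..r. \<Sum>\<sigma>\<in>Sh p (r - p). ?t p \<sigma>) = \<phi> r"
  proof (cases "r = 0")
    case True
    then show ?thesis by (simp add: phi_0)
  next
    case False
    have "(\<Sum>p=1..r. \<Sum>\<sigma>\<in>Sh p (r - p). ?t p \<sigma>) = (\<Sum>p\<in>{r}. \<Sum>\<sigma>\<in>Sh p (r - p). ?t p \<sigma>)"
    proof (rule sum.mono_neutral_right)
      show "\<forall>p\<in>{1..r} - {r}. (\<Sum>\<sigma>\<in>Sh p (r - p). ?t p \<sigma>) = 0"
      proof (intro ballI sum.neutral)
        fix p \<sigma> assume p: "p \<in> {1..r} - {r}" and s: "\<sigma> \<in> Sh p (r - p)"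
        have "\<sigma> permutes {1..r + 0}" by (rule permutes_le[OF Sh_permutes[OF s]]) (use p in auto)
        moreover have "?u (r - p + 1) = 0" using p by (auto simp: tw_mono_def)
        ultimately show "?t p \<sigma> = 0" using ins_zero_left[OF phi_car, of 1 "r - p + 1 + 0"] by simp
      qed
    qed (use False in auto)
    also have "\<dots> = \<phi> r"
      using unit_ins[OF phi_car, of r] act_id[OF phi_car[of r]] by (simp add: tw_mono_def)
    finally show ?thesis .
  qed
  ultimately show "tw_base_diff P \<phi> 0 2 ?u r = (- \<phi>) r"
    unfolding tw_base_diff_def by (simp add: signed_even)
qed

context mc_algebra
begin

lemma untwisted_map_twisted: "untwisted_map twisted = \<rho>"
proof (intro ext)
  fix n d f xs
  show "untwisted_map twisted n d f xs = \<rho> n d f xs"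
  proof (cases "f \<in> o_car P n d \<and> xs \<in> hvecs V n")
    case True
    then have f: "f \<in> o_car P n d" and xs: "xs \<in> hvecs V n" by auto
    have "twterm n d (tw_mono 0 f) xs = (\<lambda>r. if r = 0 then \<rho> n d f xs else 0)"
      by (auto simp: twterm_def tw_mono_def rho_derived(1))
    moreover have "\<rho> n d f xs \<in> c_filt V 0 (tdeg xs + d)"
      using end_car_in[OF rho_car[OF f] xs] by (simp add: V.filt_0)
    ultimately show ?thesis
      unfolding untwisted_map_def using f
      by (intro twisted_eqI[OF _ xs]) (simp_all add: tw_mono_0_car_iff V.series_single)
  next
    case False
    then show ?thesis
      using rho_outside end_car_outside[OF rho_car]
      by (cases "f \<in> o_car P n d") (auto simp: untwisted_map_def twisted_def tw_mono_0_car_iff)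
  qed
qed

lemma untwisted_point_twisted: "untwisted_point P twisted = \<alpha>"
proof -
  have "twterm 0 2 (tw_mono 1 (o_unit P)) [] = (\<lambda>r. if r = 1 then \<alpha> else 0)"
    by (auto simp: twterm_def tw_mono_def rho_derived(1) rho_unit[simplified] end_unit_def alpha_car)
  then have "series_sum V (tdeg [] + 2) (twterm 0 2 (tw_mono 1 (o_unit P)) []) \<alpha>"
    using V.series_single[OF alpha_filt] by simp
  from twisted_eqI[OF tw_point_car _ this] show ?thesis unfolding untwisted_point_def by simp
qed

lemma untwisted_complex_twisted: "untwisted_complex \<phi> twisted_complex twisted = V"
  by (simp add: untwisted_complex_def twisted_complex_def perturb_perturb perturb_zero)

end

locale tw_algebra = twisting P \<phi>
  for P :: "('k::field_char_0, 'o::ab_group_add) operad" and \<phi> :: "nat \<Rightarrow> 'o" +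
  fixes V :: "('k, 'v::ab_group_add) filtered_cochains" and \<rho> :: "(nat \<Rightarrow> 'o, 'v) structure_map"
  assumes tw_alg: "filtered_tw_algebra P \<phi> V \<rho>"
begin

lemma complete_filtered: "complete_filtered_complex V"
  using tw_alg by (simp add: filtered_tw_algebra_def)

sublocale V: complete_filtered_complex V
  by (rule complete_filtered)

sublocale scaling: vector_space "c_scale V"
  by (rule V.vector_space)

sublocale rho: dg_operad_map "Tw P \<phi>" "End_operad V" \<rho>
  using tw_alg by (simp add: filtered_tw_algebra_def operad_algebra_def)

lemma rho_linear:
  "linear_on (o_scale (Tw P \<phi>)) (\<lambda>c f xs. c_scale V c (f xs)) (tw_car P n d) (end_car V n d) (\<rho> n d)"
  using rho.map_linear[of n d] by (simp add: End_operad_def Tw_def)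

lemmas rho_car = linear_on_in[OF rho_linear]
lemmas rho_add = linear_on_add[OF rho_linear]
lemmas rho_derived = linear_on_derived[OF tw_vector_space tw_car_subspace rho_linear]
lemmas tw_closed = subspace_closed[OF tw_vector_space[of \<phi>] tw_car_subspace[of \<phi>]]

lemma rho_act: "f \<in> tw_car P n d \<Longrightarrow> \<sigma> permutes {1..n} \<Longrightarrow>
    \<rho> n d (tw_act P n d \<sigma> f) = end_act V n d \<sigma> (\<rho> n d f)"
  using rho.map_act[of f n d \<sigma>] by (simp add: End_operad_def Tw_def)

lemma rho_ins: "f \<in> tw_car P n d \<Longrightarrow> g \<in> tw_car P m e \<Longrightarrow> 1 \<le> i \<Longrightarrow> i \<le> n \<Longrightarrow>
    \<rho> (n + m - 1) (d + e) (tw_ins P n d m e i f g) = end_ins V n d m e i (\<rho> n d f) (\<rho> m e g)"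
  using rho.map_ins[of f n d g m e i] by (simp add: End_operad_def Tw_def)

lemma rho_unit: "\<rho> 1 0 (tw_unit P) = end_unit V"
  using rho.map_unit by (simp add: End_operad_def Tw_def)

lemma rho_diff: "f \<in> tw_car P n d \<Longrightarrow> \<rho> n (d + 1) (tw_diff P \<phi> n d f) = end_diff V n d (\<rho> n d f)"
  using rho.map_diff[of f n d] by (simp add: End_operad_def Tw_def)

lemma rho_outside: "f \<notin> tw_car P n d \<Longrightarrow> \<rho> n d f = 0"
  using tw_alg by (simp add: filtered_tw_algebra_def operad_algebra_def Tw_def)

lemma rho_filt: "f \<in> tw_filt P k n d \<Longrightarrow> \<rho> n d f \<in> end_filt V k n d"
  using tw_alg by (simp add: filtered_tw_algebra_def)

abbreviation \<alpha> :: 'v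
  where "\<alpha> \<equiv> untwisted_point P \<rho>"

abbreviation K :: "(int \<times> 'v) list \<Rightarrow> 'v"
  where "K \<equiv> \<rho> 1 1 (tw_kappa \<phi>)"

lemma alpha_filt: "\<alpha> \<in> c_filt V 1 2"
proof -
  have "tw_mono 1 (o_unit P) \<in> tw_filt P 1 0 2" using tw_point_car by (simp add: tw_filt_def tw_mono_def)
  from end_filtD[OF rho_filt[OF this], of "[]" "[]"] show ?thesis by (simp add: untwisted_point_def)
qed

lemma alpha_car: "\<alpha> \<in> c_car V 2"
  by (rule V.filt_car[OF alpha_filt])

lemma rho_mono_Suc:
  assumes f: "f \<in> o_invariants P (Suc s) (Suc s + n) (d - 2 * int s)" and xs: "xs \<in> hvecs V n"
  shows "c_scale V (of_nat (Suc s)) (\<rho> n (d + 2) (tw_mono (Suc s) f) xs)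
      = \<rho> (Suc n) d (tw_mono s f) ((2, \<alpha>) # xs)"
proof -
  have fs: "tw_mono s f \<in> tw_car P (Suc n) d"
    using invariants_mono[OF f, of s] by (simp add: tw_mono_car_iff)
  have fS: "tw_mono (Suc s) f \<in> tw_car P n (d + 2)"
    using f by (simp add: tw_mono_car_iff)
  have sum: "tw_mono (Suc s) (\<Sum>\<sigma>\<in>Sh s 1. f) = (\<Sum>\<sigma>\<in>Sh s 1. tw_mono (Suc s) f)"
    by (rule ext) (simp add: tw_mono_def sum_fun_apply)
  have "\<rho> n (d + 2) (tw_ins P (Suc n) d 0 2 1 (tw_mono s f) (tw_mono 1 (o_unit P))) xs =
      end_ins V (Suc n) d 0 2 1 (\<rho> (Suc n) d (tw_mono s f)) (\<rho> 0 2 (tw_mono 1 (o_unit P))) xs"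
    using rho_ins[OF fs tw_point_car, of 1] by simp
  also have "\<dots> = \<rho> (Suc n) d (tw_mono s f) ((2, \<alpha>) # xs)"
    using end_ins_eval[of "[]" "[]" xs V "Suc n" 0 1 d 2 "\<rho> (Suc n) d (tw_mono s f)" "\<rho> 0 2
        (tw_mono 1 (o_unit P))"] xs
    by (simp add: signed_even untwisted_point_def)
  also have "\<rho> n (d + 2) (tw_ins P (Suc n) d 0 2 1 (tw_mono s f) (tw_mono 1 (o_unit P))) xs =
      (\<Sum>\<sigma>\<in>Sh s 1. \<rho> n (d + 2) (tw_mono (Suc s) f) xs)"
    unfolding tw_ins_point[OF f] sum rho_derived(5)[OF fS] by (simp add: sum_fun_apply)
  also have "\<dots> = c_scale V (of_nat (Suc s)) (\<rho> n (d + 2) (tw_mono (Suc s) f) xs)"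
    unfolding scaling.sum_constant_scale card_Sh by simp
  finally show ?thesis .
qed

lemma rho_mono_fact:
  assumes f: "f \<in> o_invariants P r (r + n) d" and s: "s \<le> r" and ys: "ys \<in> hvecs V (r - s + n)"
  shows "c_scale V (fact s) (\<rho> (r - s + n) (d + 2 * int s) (tw_mono s f) ys) =
    \<rho> (r + n) d (tw_mono 0 f) (replicate s (2, \<alpha>) @ ys)"
  using s ys
proof (induction s arbitrary: ys)
  case 0
  then show ?case by simp
next
  case (Suc s)
  define m where "m = r - Suc s + n"
  have m: "r - s + n = Suc m" "r + n = Suc s + m" using Suc.prems by (auto simp: m_def)
  have fi: "f \<in> o_invariants P (Suc s) (Suc s + m) (d + 2 * int s - 2 * int s)"
    using invariants_mono[OF f, of "Suc s"] Suc.prems m by simp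
  have ys: "ys \<in> hvecs V m" using Suc.prems by (simp add: m_def)
  have deg: "d + 2 * int (Suc s) = d + 2 * int s + 2" by simp
  have "c_scale V (fact (Suc s)) (\<rho> m (d + 2 * int s + 2) (tw_mono (Suc s) f) ys) =
      c_scale V (fact s) (c_scale V (of_nat (Suc s)) (\<rho> m (d + 2 * int s + 2) (tw_mono (Suc s) f) ys))"
    by (simp add: mult.commute)
  also have "\<dots> = c_scale V (fact s) (\<rho> (Suc m) (d + 2 * int s) (tw_mono s f) ((2, \<alpha>) # ys))"
    unfolding rho_mono_Suc[OF fi ys] ..
  also have "\<dots> = \<rho> (r + n) d (tw_mono 0 f) (replicate s (2, \<alpha>) @ (2, \<alpha>) # ys)"
    using Suc.IH[of "(2, \<alpha>) # ys"] Suc.prems ys alpha_car unfolding m(1) by simp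
  also have "replicate s (2, \<alpha>) @ (2, \<alpha>) # ys = replicate (Suc s) (2, \<alpha>) @ ys"
    by (simp add: replicate_app_Cons_same)
  finally show ?case unfolding deg m_def .
qed

text \<open>An element of \<open>Tw P\<close> is the sum of its components in the topology of the filtration, and a
  component in position \<open>r\<close> arises from inserting the Maurer--Cartan element \<open>r\<close> times, up to \<open>r!\<close>.\<close>

lemma rho_series:
  assumes f: "f \<in> tw_car P n d" and xs: "xs \<in> hvecs V n"
  shows "series_sum V (tdeg xs + d) (\<lambda>r. c_scale V (1 / fact r)
    (untwisted_map \<rho> (r + n) (d - 2 * int r) (f r) (replicate r (2, \<alpha>) @ xs))) (\<rho> n d f xs)"
proof -
  have fm: "tw_mono r (f r) \<in> tw_car P n d" for r using tw_carD[OF f] by (simp add: tw_mono_car_iff)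
  have terms: "c_scale V (1 / fact r)
      (untwisted_map \<rho> (r + n) (d - 2 * int r) (f r) (replicate r (2, \<alpha>) @ xs)) =
      \<rho> n d (tw_mono r (f r)) xs" for r
  proof -
    have "c_scale V (fact r) (\<rho> n d (tw_mono r (f r)) xs) =
        untwisted_map \<rho> (r + n) (d - 2 * int r) (f r) (replicate r (2, \<alpha>) @ xs)"
      using rho_mono_fact[OF tw_carD[OF f], of r r xs] xs by (simp add: untwisted_map_def)
    then show ?thesis by (simp flip: \<open>c_scale V (fact r) (\<rho> n d (tw_mono r (f r)) xs) = _\<close>)
  qed
  show ?thesis
    unfolding terms series_sum_def
  proof (intro conjI allI)
    show "\<rho> n d f xs \<in> c_car V (tdeg xs + d)" by (rule end_car_in[OF rho_car[OF f] xs])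
    fix k
    let ?s = "\<Sum>r<k. tw_mono r (f r)"
    have s: "?s \<in> tw_car P n d" by (rule tw_closed(7)) (rule fm)
    have "(f - ?s) r = 0" if "r < k" for r
    proof -
      have "?s r = (\<Sum>j<k. if j = r then f r else 0)"
        unfolding sum_fun_apply by (rule sum.cong) (auto simp: tw_mono_def)
      then show ?thesis using that by simp
    qed
    then have "f - ?s \<in> tw_filt P k n d" using tw_closed(3)[OF f s] by (simp add: tw_filt_def)
    from end_filtD[OF rho_filt[OF this], of xs "replicate n 0"]
    have "\<rho> n d (f - ?s) xs \<in> c_filt V k (tdeg xs + d)"
      using hvecs_length[OF xs] hvecs_nth[OF xs] by (simp add: V.filt_0 sum_list_replicate)
    moreover have "\<rho> n d ?s = (\<Sum>r<k. \<rho> n d (tw_mono r (f r)))" by (rule rho_derived(5)) (rule fm)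
    ultimately show "\<rho> n d f xs - (\<Sum>r<k. \<rho> n d (tw_mono r (f r)) xs) \<in> c_filt V k (tdeg xs + d)"
      using rho_derived(3)[OF f s] by (simp add: sum_fun_apply)
  qed
qed

lemma kappa_uminus: "- tw_kappa \<phi> \<in> tw_car P 1 1" "\<rho> 1 1 (- tw_kappa \<phi>) = - K"
  by (rule tw_closed(4)[OF kappa_car], rule rho_derived(2)[OF kappa_car])

lemma minus_K: "- K \<in> end_car V 1 1" "- K \<in> end_filt V 0 1 1"
  using rho_car[OF kappa_uminus(1)] rho_filt[of "- tw_kappa \<phi>" 0 1 1] kappa_uminus
  by (simp_all add: tw_filt_def)

lemma rho_tw_diff:
  assumes f: "f \<in> tw_car P n d"
  shows "end_diff V n d (\<rho> n d f) = \<rho> n (d + 1) (tw_base_diff P \<phi> n d f) + end_ins V 1 1 n d 1 K (\<rho> n d f)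
      - signed d (\<Sum>i=1..n. end_ins V n d 1 1 i (\<rho> n d f) K)"
proof -
  let ?\<kappa> = "tw_kappa \<phi>"
  note b = tw_base_diff_car[OF f] and l = tw_kappa_ins_car(1)[OF f] and r = tw_kappa_ins_car(2)[OF f]
  have sr: "(\<Sum>i=1..n. tw_ins P n d 1 1 i f ?\<kappa>) \<in> tw_car P n (d + 1)" by (rule tw_closed(7)) (rule r)
  have rsum: "\<rho> n (d + 1) (\<Sum>i=1..n. tw_ins P n d 1 1 i f ?\<kappa>)
      = (\<Sum>i=1..n. \<rho> n (d + 1) (tw_ins P n d 1 1 i f ?\<kappa>))"
    by (rule rho_derived(5)) (rule r)
  have "end_diff V n d (\<rho> n d f) = \<rho> n (d + 1) (tw_base_diff P \<phi> n d f)
      + \<rho> n (d + 1) (tw_ins P 1 1 n d 1 ?\<kappa> f)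
      - signed d (\<Sum>i=1..n. \<rho> n (d + 1) (tw_ins P n d 1 1 i f ?\<kappa>))"
    unfolding rho_diff[OF f, symmetric] tw_diff_eq[OF f] rho_derived(3)[OF tw_closed(2)[OF b l] tw_closed(6)[OF sr]]
      rho_add[OF b l] rho_derived(4)[OF sr] rsum ..
  also have "\<rho> n (d + 1) (tw_ins P 1 1 n d 1 ?\<kappa> f) = end_ins V 1 1 n d 1 K (\<rho> n d f)"
    using rho_ins[OF kappa_car f, of 1] by (simp add: add.commute)
  also have "(\<Sum>i=1..n. \<rho> n (d + 1) (tw_ins P n d 1 1 i f ?\<kappa>)) = (\<Sum>i=1..n. end_ins V n d 1 1 i (\<rho> n d f) K)"
    by (rule sum.cong[OF refl]) (use rho_ins[OF f kappa_car] in simp)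
  finally show ?thesis .
qed

text \<open>By \<open>kappa_square\<close> the full twisted differential of \<open>\<kappa>\<close> is \<open>\<kappa> \<circ>\<^sub>1 \<kappa>\<close>, which is the Maurer--Cartan equation
  for the perturbation by \<open>- \<kappa>\<close>.\<close>

lemma untwisted_complete: "complete_filtered_complex (untwisted_complex \<phi> V \<rho>)"
  unfolding untwisted_complex_def
proof (rule perturb_complete[OF complete_filtered minus_K])
  let ?\<kappa> = "tw_kappa \<phi>"
  have Kc: "K \<in> end_car V 1 1" by (rule rho_car[OF kappa_car])
  have "\<rho> 1 2 (tw_base_diff P \<phi> 1 1 ?\<kappa>) + \<rho> 1 2 (tw_ins P 1 1 1 1 1 ?\<kappa> ?\<kappa>) = 0"
    using rho_add[OF tw_base_diff_car[OF kappa_car] tw_kappa_ins_car(1)[OF kappa_car]] rho_derived(1)[of 1 2]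
    unfolding kappa_square by simp
  moreover have "\<rho> 1 2 (tw_ins P 1 1 1 1 1 ?\<kappa> ?\<kappa>) = end_ins V 1 1 1 1 1 K K"
    using rho_ins[OF kappa_car kappa_car, of 1] by simp
  ultimately have flat: "end_diff V 1 1 K = end_ins V 1 1 1 1 1 K K"
    using rho_tw_diff[OF kappa_car] by (simp add: signed_def)
  show "end_diff V 1 1 (- K) + end_ins V 1 1 1 1 1 (- K) (- K) = 0"
  proof
    fix xs
    show "(end_diff V 1 1 (- K) + end_ins V 1 1 1 1 1 (- K) (- K)) xs = 0 xs"
    proof (cases "xs \<in> hvecs V 1")
      case True
      then obtain d x where xs: "xs = [(d, x)]" and x: "x \<in> c_car V d"
        by (cases xs) (auto simp: hvecs_def)
      have Kx: "K [(d, x)] \<in> c_car V (d + 1)" using linear_on_in[OF V.unary_linear[OF Kc] x] .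
      have flatx: "K [(d + 1, K [(d, x)])] = c_diff V (d + 1) (K [(d, x)]) + K [(d + 1, c_diff V d x)]"
        using fun_cong[OF flat, of "[(d, x)]"] unfolding V.commutator_unary[OF Kc x] by (rule sym)
      show ?thesis
        unfolding xs plus_fun_apply V.commutator_unary[OF minus_K(1) x]
        by (simp add: flatx linear_on_uminus[OF V.vector_space V.subspace V.diff_linear Kx]
            linear_on_uminus[OF V.vector_space V.subspace V.unary_linear[OF Kc] Kx] del: One_nat_def)
    next
      case False
      then show ?thesis by (simp add: end_diff_def end_ins_def)
    qed
  qed
qed

lemma perturb_untwisted: "perturb (untwisted_complex \<phi> V \<rho>) K = V"
  by (simp add: untwisted_complex_def perturb_perturb perturb_zero)

text \<open>Perturbing back by \<open>\<kappa>\<close> accounts for the commutator with \<open>\<kappa>\<close> in the twisted differential.\<close>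

lemma untwisted_diff:
  assumes f: "f \<in> o_car P n d"
  shows "untwisted_map \<rho> n (d + 1) (o_diff P n d f) = end_diff (untwisted_complex \<phi> V \<rho>) n d
      (untwisted_map \<rho> n d f)"
proof -
  let ?U = "untwisted_complex \<phi> V \<rho>"
  have fm: "tw_mono 0 f \<in> tw_car P n d" using f by (simp add: tw_mono_0_car_iff)
  have "end_diff (perturb ?U K) n d (\<rho> n d (tw_mono 0 f)) = end_diff ?U n d (\<rho> n d (tw_mono 0 f))
    + end_ins V 1 1 n d 1 K (\<rho> n d (tw_mono 0 f))
        - signed d (\<Sum>i=1..n. end_ins V n d 1 1 i (\<rho> n d (tw_mono 0 f)) K)"
    using end_diff_perturb[of ?U K "\<rho> n d
        (tw_mono 0 f)" n d] untwisted_complete rho_car[OF kappa_car] rho_car[OF fm]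
    by (simp add: complete_filtered_complex_def untwisted_complex_def)
  then show ?thesis
    unfolding perturb_untwisted rho_tw_diff[OF fm] tw_base_diff_mono_0[OF f] untwisted_map_def by simp
qed

lemma untwisted_compatible: "compatible_algebra P (untwisted_complex \<phi> V \<rho>) (untwisted_map \<rho>)"
proof -
  let ?U = "untwisted_complex \<phi> V \<rho>" and ?r = "untwisted_map \<rho>"
  have U [simp]: "c_scale ?U = c_scale V" "end_car ?U = end_car V" "end_unit ?U
      = end_unit V" "end_ins ?U = end_ins V"
     "end_act ?U = end_act V" "end_filt ?U = end_filt V"
    by (simp_all add: untwisted_complex_def)
  have mono: "tw_mono 0 f \<in> tw_car P n d" if "f \<in> o_car P n d" for f n d using that
    by (simp add: tw_mono_0_car_iff)
  have sc: "o_scale (Tw P \<phi>) c (tw_mono 0 f) = tw_mono 0 (o_scale P c f)" for c f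
  proof -
    have "o_scale P c 0 = 0"
      using vector_space by (metis module.scale_zero_right module_iff_vector_space)
    then show ?thesis by (simp add: Tw_def tw_mono_def fun_eq_iff)
  qed
  have lin: "linear_on (o_scale P) (\<lambda>c f xs. c_scale V c (f xs)) (o_car P n d) (end_car V n d) (?r n d)"
      for n d
    unfolding linear_on_def untwisted_map_def
  proof (intro conjI ballI allI)
    fix f assume f: "f \<in> o_car P n d"
    show "\<rho> n d (tw_mono 0 f) \<in> end_car V n d" by (rule rho_car[OF mono[OF f]])
    show "\<rho> n d (tw_mono 0 (f + g)) = \<rho> n d (tw_mono 0 f) + \<rho> n d (tw_mono 0 g)" if g: "g \<in> o_car P n d" for g
    proof -
      have "tw_mono 0 (f + g) = tw_mono 0 f + tw_mono 0 g" by (simp add: tw_mono_def fun_eq_iff)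
      then show ?thesis using rho_add[OF mono[OF f] mono[OF g]] by simp
    qed
    show "\<rho> n d (tw_mono 0 (o_scale P c f)) = (\<lambda>xs. c_scale V c (\<rho> n d (tw_mono 0 f) xs))" for c
      using linear_on_scale[OF rho_linear mono[OF f], of c] unfolding sc .
  qed
  have unit: "?r 1 0 (o_unit P) = end_unit V"
  proof -
    have "tw_mono 0 (o_unit P) = tw_unit P" by (simp add: tw_mono_def tw_unit_def fun_eq_iff)
    then show ?thesis using rho_unit by (simp add: untwisted_map_def)
  qed
  have act: "?r n d (o_act P n d \<sigma> f) = end_act V n d \<sigma> (?r n d f)" if f: "f \<in> o_car P n d"
      and s: "\<sigma> permutes {1..n}" for n d f \<sigma>
    using rho_act[OF mono[OF f] s] by (simp add: untwisted_map_def tw_act_mono_0[OF f s])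
  have ins: "?r (n + m - 1) (d + e) (o_ins P n d m e i f g) = end_ins V n d m e i (?r n d f) (?r m e g)"
    if f: "f \<in> o_car P n d" and g: "g \<in> o_car P m e" and i: "1 \<le> i" "i \<le> n" for n d m e i f g
    using rho_ins[OF mono[OF f] mono[OF g] i] by (simp add: untwisted_map_def tw_ins_mono_0[OF f g i])
  have "dg_operad_map P (End_operad ?U) ?r"
    unfolding dg_operad_map_def graded_operad_map_def dg_operad_map_axioms_def
    using lin unit act ins untwisted_diff by (simp add: End_operad_def)
  moreover have "?r n d f = 0" if "f \<notin> o_car P n d" for n d f
    unfolding untwisted_map_def by (rule rho_outside) (use that in \<open>simp add: tw_mono_0_car_iff\<close>)
  moreover have "?r n d f \<in> end_filt V 0 n d" if "f \<in> o_car P n d" for n d f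
    unfolding untwisted_map_def by (rule rho_filt) (use mono[OF that] in \<open>simp add: tw_filt_def\<close>)
  ultimately show ?thesis
    using untwisted_complete
      unfolding compatible_algebra_def operad_algebra_def complete_filtered_complex_def by simp
qed

text \<open>The sequence \<open>\<phi>\<close> is itself an element of \<open>Tw P\<close> of arity \<open>0\<close> and degree \<open>3\<close>. The series of its value
  is the curvature sum, and \<open>tw_base_diff_point\<close> identifies this value with minus the differential of \<open>\<alpha>\<close>.\<close>

lemma untwisted_mc: "maurer_cartan \<phi> (untwisted_complex \<phi> V \<rho>) (untwisted_map \<rho>) \<alpha>"
proof -
  let ?u = "tw_mono 1 (o_unit P)"
  let ?t = "\<lambda>r. c_scale V (1 / fact r) (untwisted_map \<rho> r (3 - 2 * int r) (\<phi> r) (replicate r (2, \<alpha>)))"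
  have phi: "\<phi> \<in> tw_car P 0 3" unfolding tw_car_def using phi_invariant by simp
  define s where "s = \<rho> 0 3 \<phi> []"
  have ser: "series_sum V 3 ?t s" using rho_series[OF phi, of "[]"] by (simp add: s_def)
  have t01: "?t 0 = 0" "?t 1 = 0"
  proof -
    have "\<rho> n d (tw_mono 0 0) xs = 0" for n d xs
    proof -
      have "tw_mono 0 (0 :: 'o) = 0" by (simp add: tw_mono_def fun_eq_iff)
      then show ?thesis by (simp add: rho_derived(1))
    qed
    then show "?t 0 = 0" "?t 1 = 0" by (simp_all add: untwisted_map_def phi_0 phi_1)
  qed
  have "filt_sums V 3 2 ?t s"
    unfolding filt_sums_def using V.filt_sums_iff_series[OF V.series_term[OF ser] t01] ser
    by (simp add: series_sum_def)
  then have "filt_sums (untwisted_complex \<phi> V \<rho>) 3 2 ?t s"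
    by (simp add: filt_sums_def untwisted_complex_def)
  moreover have "c_diff V 2 \<alpha> - K [(2, \<alpha>)] + s = 0"
  proof -
    have "end_diff V 0 2 (\<rho> 0 2 ?u) [] = c_diff V 2 \<alpha>"
      by (simp add: end_diff_def untwisted_point_def)
    moreover have "end_ins V 1 1 0 2 1 K (\<rho> 0 2 ?u) [] = K [(2, \<alpha>)]"
      by (simp add: end_ins_def untwisted_point_def signed_def)
    moreover have "\<rho> 0 3 (- \<phi>) [] = - s" using rho_derived(2)[OF phi] by (simp add: s_def)
    ultimately show ?thesis
      using fun_cong[OF rho_tw_diff[OF tw_point_car], of "[]"]
        by (simp add: tw_base_diff_point[simplified] signed_def)
  qed
  ultimately show ?thesis
    unfolding maurer_cartan_def using alpha_filt
    by (auto simp: untwisted_complex_def)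
qed

sublocale untwisted: mc_algebra P \<phi> "untwisted_complex \<phi> V \<rho>" "untwisted_map \<rho>" \<alpha>
  by unfold_locales (use untwisted_compatible untwisted_mc alpha_filt in \<open>simp_all add: untwisted_complex_def\<close>)

lemma twisted_untwisted: "untwisted.twisted = \<rho>"
proof (intro ext)
  fix n d f xs
  have hv: "hvecs (untwisted_complex \<phi> V \<rho>) = hvecs V" by (simp add: untwisted_complex_def)
  show "untwisted.twisted n d f xs = \<rho> n d f xs"
  proof (cases "f \<in> tw_car P n d \<and> xs \<in> hvecs V n")
    case True
    then have f: "f \<in> tw_car P n d" and xs: "xs \<in> hvecs V n" by auto
    show ?thesis
      by (rule untwisted.twisted_eqI[OF f])
        (use xs rho_series[OF f xs] in \<open>simp_all add: hv untwisted.twterm_def[abs_def] series_sum_def\<close>)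
  next
    case False
    then show ?thesis
      using rho_outside end_car_outside[OF rho_car]
      by (cases "f \<in> tw_car P n d") (auto simp: untwisted.twisted_def hv)
  qed
qed

lemma twisted_complex_untwisted: "untwisted.twisted_complex = V"
  unfolding untwisted.twisted_complex_def twisted_untwisted by (rule perturb_untwisted)

end


section \<open>Morphisms and the isomorphism of categories\<close>

lemma map_hvecs:
  assumes "\<And>d x. x \<in> c_car V d \<Longrightarrow> f d x \<in> c_car W d" "xs \<in> hvecs V n"
  shows "map (\<lambda>(e, x). (e, f e x)) xs \<in> hvecs W n"
  using assms by (auto simp: hvecs_def)

lemma tdeg_map: "tdeg (map (\<lambda>(e, x). (e, f e x)) xs) = tdeg xs"
  by (induction xs) auto

text \<open>Preservation of \<open>\<alpha>\<close> and of the operations of \<open>P\<close> carries over to the operations of \<open>Tw P\<close> by applying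
  the map to \<open>rho_series\<close> term by term. The differentials of the two sides differ by the operation \<open>\<kappa>\<close>,
  which is preserved as well.\<close>

lemma tw_algebra_map_iff:
  assumes X: "tw_algebra P \<phi> V \<rho>" and Y: "tw_algebra P \<phi> W \<rho>'"
  shows "filtered_algebra_map (Tw P \<phi>) V \<rho> W \<rho>' f \<longleftrightarrow>
    filtered_algebra_map P (untwisted_complex \<phi> V \<rho>) (untwisted_map \<rho>)
      (untwisted_complex \<phi> W \<rho>') (untwisted_map \<rho>') f \<and>
    f 2 (untwisted_point P \<rho>) = untwisted_point P \<rho>'"
    (is "?L \<longleftrightarrow> ?R \<and> ?A")
proof -
  interpret X: tw_algebra P \<phi> V \<rho> by fact
  interpret Y: tw_algebra P \<phi> W \<rho>' by fact
  let ?K = "\<rho> 1 1 (tw_kappa \<phi>)" and ?K' = "\<rho>' 1 1 (tw_kappa \<phi>)"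
  let ?\<alpha> = "untwisted_point P \<rho>" and ?\<alpha>' = "untwisted_point P \<rho>'"
  let ?F = "map (\<lambda>(e, x). (e, f e x))"
  have Tw_car: "o_car (Tw P \<phi>) = tw_car P" by (simp add: Tw_def)
  have unary: "K \<in> end_car V 1 1 \<Longrightarrow> x \<in> c_car V d \<Longrightarrow> K [(d, x)] \<in> c_car V (d + 1)" for K d x
    using linear_on_in[OF X.V.unary_linear] .
  note Kc = unary[OF X.rho_car[OF X.kappa_car]]
  note dc = linear_on_in[OF X.V.diff_linear]
  have diffs: "(\<forall>d. \<forall>x\<in>c_car V d. f (d + 1) (c_diff V d x) = c_diff W d (f d x)) \<longleftrightarrow>
      (\<forall>d. \<forall>x\<in>c_car V d. f (d + 1) (c_diff V d x - ?K [(d, x)]) = c_diff W d (f d x) - ?K' [(d, f d x)])"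
    if lin: "\<forall>d. linear_on (c_scale V) (c_scale W) (c_car V d) (c_car W d) (f d)"
      and K: "\<And>d x. x \<in> c_car V d \<Longrightarrow> f (d + 1) (?K [(d, x)]) = ?K' [(d, f d x)]"
    using linear_on_minus[OF X.V.vector_space X.V.subspace lin[rule_format] dc Kc] K by simp
  have K_unary: "f (d + 1) (?K [(d, x)]) = ?K' [(d, f d x)]"
    if "\<forall>n d. \<forall>v\<in>tw_car P n d. \<forall>xs\<in>hvecs V n. f (tdeg xs + d) (\<rho> n d v xs) = \<rho>' n d v (?F xs)"
      and "x \<in> c_car V d" for d x
    using that(1)[rule_format, OF X.kappa_car, of "[(d, x)]"] that(2) by simp
  show ?thesis
  proof
    assume L: ?L
    then have lin: "\<forall>d. linear_on (c_scale V) (c_scale W) (c_car V d) (c_car W d) (f d)"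
      and ops: "\<forall>n d. \<forall>v\<in>tw_car P n d. \<forall>xs\<in>hvecs V n. f (tdeg xs + d) (\<rho> n d v xs) = \<rho>' n d v (?F xs)"
      by (simp_all add: filtered_algebra_map_def Tw_car)
    have ?A using ops[rule_format, OF X.tw_point_car, of "[]"] by (simp add: untwisted_point_def)
    moreover have ?R
      using L diffs[OF lin K_unary[OF ops]] ops
      by (simp add: filtered_algebra_map_def Tw_car untwisted_map_def X.tw_mono_0_car_iff)
    ultimately show "?R \<and> ?A" by blast
  next
    assume R: "?R \<and> ?A"
    then have lin: "\<forall>d. linear_on (c_scale V) (c_scale W) (c_car V d) (c_car W d) (f d)"
      and ops0: "\<And>n d v xs. v \<in> o_car P n d \<Longrightarrow> xs \<in> hvecs V n \<Longrightarrow>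
        f (tdeg xs + d) (untwisted_map \<rho> n d v xs) = untwisted_map \<rho>' n d v (?F xs)"
      and filt: "\<And>k d x. x \<in> c_filt V k d \<Longrightarrow> f d x \<in> c_filt W k d"
      and pt: "f 2 ?\<alpha> = ?\<alpha>'"
      by (simp_all add: filtered_algebra_map_def)
    have ops: "f (tdeg xs + d) (\<rho> n d v xs) = \<rho>' n d v (?F xs)"
      if v: "v \<in> tw_car P n d" and xs: "xs \<in> hvecs V n" for n d v xs
    proof (rule Y.V.series_unique)
      let ?t = "\<lambda>r. untwisted_map \<rho> (r + n) (d - 2 * int r) (v r) (replicate r (2, ?\<alpha>) @ xs)"
      have "series_sum W (tdeg xs + d) (\<lambda>r. f (tdeg xs + d) (c_scale V (1 / fact r) (?t r)))
          (f (tdeg xs + d) (\<rho> n d v xs))"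
        by (rule series_map(2)[OF X.complete_filtered lin[rule_format] _ X.rho_series[OF v xs]])
            (simp_all add: filt)
      moreover have "f (tdeg xs + d) (c_scale V (1 / fact r) (?t r)) = c_scale W (1 / fact r)
          (untwisted_map \<rho>' (r + n) (d - 2 * int r) (v r) (replicate r (2, ?\<alpha>') @ ?F xs))" for r
      proof -
        have hv: "replicate r (2, ?\<alpha>) @ xs \<in> hvecs V (r + n)"
          by (rule hvecs_appendI[OF hvecs_replicate[OF X.alpha_car] xs])
        have "tdeg (replicate r (2, ?\<alpha>) @ xs) + (d - 2 * int r) = tdeg xs + d" by simp
        with ops0[OF X.tw_car_car[OF v] hv]
        have eq: "f (tdeg xs + d) (?t r) = untwisted_map \<rho>' (r + n) (d - 2 * int r) (v r)
            (replicate r (2, ?\<alpha>') @ ?F xs)"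
          by (simp add: pt)
        have mem: "?t r \<in> c_car V (tdeg xs + d)"
          using end_car_in[OF X.untwisted.rho_car[OF X.tw_car_car[OF v]], of "replicate r
              (2, ?\<alpha>) @ xs" r] hv by simp
        show ?thesis unfolding linear_on_scale[OF lin[rule_format] mem] eq ..
      qed
      ultimately show "series_sum W (tdeg xs + d) (\<lambda>r. c_scale W (1 / fact r)
          (untwisted_map \<rho>' (r + n) (d - 2 * int r) (v r) (replicate r (2, ?\<alpha>') @ ?F xs)))
              (f (tdeg xs + d) (\<rho> n d v xs))"
        by simp
      have "?F xs \<in> hvecs W n" by (rule map_hvecs[OF _ xs]) (rule linear_on_in[OF lin[rule_format]])
      from Y.rho_series[OF v this] show "series_sum W (tdeg xs + d) (\<lambda>r. c_scale W (1 / fact r)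
          (untwisted_map \<rho>' (r + n) (d - 2 * int r) (v r) (replicate r (2, ?\<alpha>') @ ?F xs))) (\<rho>' n d v (?F xs))"
        by (simp add: tdeg_map)
    qed
    then have "\<forall>n d. \<forall>v\<in>tw_car P n d. \<forall>xs\<in>hvecs V n. f (tdeg xs + d) (\<rho> n d v xs) = \<rho>' n d v (?F xs)"
      by blast
    from diffs[OF lin K_unary[OF this]] R this show ?L
      by (simp add: filtered_algebra_map_def Tw_car)
  qed
qed

lemma filtered_algebra_map_ident:
  assumes "cochain_complex V" and ops: "\<And>n d v. v \<in> o_car Q n d \<Longrightarrow> \<rho> n d v \<in> end_car V n d"
    and filt: "\<And>k d x. x \<in> c_filt V k d \<Longrightarrow> x \<in> c_car V d"
  shows "filtered_algebra_map Q V \<rho> V \<rho> (ident_map V)"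
proof -
  interpret V: cochain_complex V by fact
  note cl = subspace_closed[OF V.vector_space V.subspace]
  have "map (\<lambda>(e, x). (e, ident_map V e x)) xs = xs" if "xs \<in> hvecs V n" for xs n
    using that by (intro map_idI) (auto simp: hvecs_def ident_map_def)
  then show ?thesis
    unfolding filtered_algebra_map_def linear_on_def
    using cl(2,5) linear_on_in[OF V.diff_linear] end_car_in[OF ops] filt
    by (auto simp: ident_map_def)
qed

lemma filtered_algebra_map_comp:
  assumes f: "filtered_algebra_map Q U \<rho> V \<rho>' f" and g: "filtered_algebra_map Q V \<rho>' W \<rho>'' g"
    and V: "cochain_complex V"
  shows "filtered_algebra_map Q U \<rho> W \<rho>'' (\<lambda>d x. g d (f d x))"
proof -
  interpret V: cochain_complex V by fact
  have fc: "x \<in> c_car U d \<Longrightarrow> f d x \<in> c_car V d" for d x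
    using f by (simp add: filtered_algebra_map_def linear_on_def)
  have g0: "g d 0 = 0" for d
    using g linear_on_zero[OF V.vector_space V.subspace] unfolding filtered_algebra_map_def by blast
  let ?F = "map (\<lambda>(e, x). (e, f e x))" and ?G = "map (\<lambda>(e, x). (e, g e x))"
  have FG: "map (\<lambda>(e, x). (e, g e (f e x))) xs = ?G (?F xs)" for xs by auto
  show ?thesis
    unfolding filtered_algebra_map_def FG
  proof (intro conjI allI ballI impI)
    show "linear_on (c_scale U) (c_scale W) (c_car U d) (c_car W d) (\<lambda>x. g d (f d x))" for d
      using f g unfolding filtered_algebra_map_def linear_on_def by simp
    show "g d (f d x) = 0" if "x \<notin> c_car U d" for d x
      using f that g0 by (simp add: filtered_algebra_map_def)
    show "g (d + 1) (f (d + 1) (c_diff U d x)) = c_diff W d (g d (f d x))" if "x \<in> c_car U d" for d x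
      using f g fc[OF that] that by (simp add: filtered_algebra_map_def)
    show "g d (f d x) \<in> c_filt W k d" if "x \<in> c_filt U k d" for k d x
      using f g that by (simp add: filtered_algebra_map_def)
    show "g (tdeg xs + d) (f (tdeg xs + d) (\<rho> n d v xs)) = \<rho>'' n d v (?G (?F xs))"
      if v: "v \<in> o_car Q n d" and xs: "xs \<in> hvecs U n" for n d v xs
    proof -
      have "f (tdeg xs + d) (\<rho> n d v xs) = \<rho>' n d v (?F xs)"
        using f v xs unfolding filtered_algebra_map_def by blast
      moreover have "?F xs \<in> hvecs V n" by (rule map_hvecs[OF fc xs])
      then have "g (tdeg (?F xs) + d) (\<rho>' n d v (?F xs)) = \<rho>'' n d v (?G (?F xs))"
        using g v unfolding filtered_algebra_map_def by blast
      ultimately show ?thesis by (simp add: tdeg_map)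
    qed
  qed
qed

lemma filtered_algebra_map_ident_unit:
  assumes f: "filtered_algebra_map Q V \<rho> W \<rho>' f" and V: "cochain_complex V"
  shows "(\<lambda>d x. f d (ident_map V d x)) = f" "(\<lambda>d x. ident_map W d (f d x)) = f"
proof -
  interpret V: cochain_complex V by fact
  have out: "x \<notin> c_car V d \<Longrightarrow> f d x = 0" and inn: "x \<in> c_car V d \<Longrightarrow> f d x \<in> c_car W d"
    and lin: "linear_on (c_scale V) (c_scale W) (c_car V d) (c_car W d) (f d)" for d x
    using f by (simp_all add: filtered_algebra_map_def linear_on_def)
  show "(\<lambda>d x. ident_map W d (f d x)) = f"
  proof (intro ext)
    show "ident_map W d (f d x) = f d x" for d x
      using out[of x d] inn[of x d] by (cases "x \<in> c_car V d") (simp_all add: ident_map_def)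
  qed
  show "(\<lambda>d x. f d (ident_map V d x)) = f"
  proof (intro ext)
    show "f d (ident_map V d x) = f d x" for d x
      using out[of x d] linear_on_zero[OF V.vector_space V.subspace lin] by (simp add: ident_map_def)
  qed
qed

text \<open>A map of dg operads carries over the invariance of the generators and the formula for their
  differentials. The terms \<open>p = 1\<close> and \<open>p = n\<close> are added here; they contain \<open>\<phi> 1 = 0\<close>.\<close>

lemma generator_images_twisting:
  fixes L :: "('k::field, 'l::ab_group_add) operad" and P :: "('k, 'o::ab_group_add) operad"
  assumes L: "Lambda_Lie_infty L lam" and P: "dg_operad P" and h: "dg_operad_map L P \<phi>hat"
  shows "twisting P (generator_images \<phi>hat lam)"
proof -
  interpret L: Lambda_Lie_infty L lam by fact
  interpret P: dg_operad P by fact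
  interpret h: dg_operad_map L P \<phi>hat by fact
  let ?\<phi> = "generator_images \<phi>hat lam"
  note hlin = linear_on_derived[OF L.vector_space L.subspace h.map_linear]
  have lc: "2 \<le> n \<Longrightarrow> lam n \<in> o_car L n (3 - 2 * int n)" for n
    using L.lam_invariant by (simp add: o_invariants_def)
  have g2: "2 \<le> n \<Longrightarrow> ?\<phi> n = \<phi>hat n (3 - 2 * int n) (lam n)" and g0: "n < 2 \<Longrightarrow> ?\<phi> n = 0" for n
    by (simp_all add: generator_images_def)
  have inv: "?\<phi> n \<in> o_invariants P n n (3 - 2 * int n)" for n
  proof (cases "2 \<le> n")
    case True
    then show ?thesis
      using L.lam_invariant[OF True] h.map_act[OF lc[OF True]] linear_on_in[OF h.map_linear lc[OF True]]
      by (simp add: g2 o_invariants_def)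
  qed (simp add: g0)
  let ?x = "\<lambda>n p. o_ins P (n - p + 1) (3 - 2 * int (n - p + 1)) p (3 - 2 * int p) 1
      (?\<phi> (n - p + 1)) (?\<phi> p)"
    and ?h = "\<lambda>n. \<phi>hat n (4 - 2 * int n)" and ?c = "\<lambda>n. o_car L n (4 - 2 * int n)"
    and ?A = "\<lambda>n. o_act P n (4 - 2 * int n)" and ?B = "\<lambda>n. o_act L n (4 - 2 * int n)"
  have diff: "o_diff P n (3 - 2 * int n) (?\<phi> n) =
      - (\<Sum>p=1..n. \<Sum>\<sigma>\<in>Sh p (n - p). ?A n \<sigma> (?x n p))"
      (is "_ = - (\<Sum>p=1..n. ?S p)") if n: "1 \<le> n" for n
  proof -
    have pc: "?\<phi> m \<in> o_car P m (3 - 2 * int m)" for m using P.invariants_car[OF inv] .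
    have zero: "?S p = 0" if p: "p = 1 \<or> p = n" for p
    proof (rule sum.neutral, rule ballI)
      fix \<sigma> assume s: "\<sigma> \<in> Sh p (n - p)"
      have "\<sigma> permutes {1..n}" by (rule permutes_le[OF Sh_permutes[OF s]]) (use p n in auto)
      moreover have "?x n p = 0"
        using p g0[of 1] P.ins_zero_left[OF pc[of p], of 1 "n - p
            + 1"] P.ins_zero_right[OF pc[of "n - p + 1"], of 1] by auto
      ultimately show "?A n \<sigma> (?x n p) = 0"
        by simp
    qed
    have "(\<Sum>p=1..n. ?S p) = (\<Sum>p=2..n-1. ?S p)"
    proof (rule sum.mono_neutral_right)
      show "\<forall>p\<in>{1..n} - {2..n-1}. ?S p = 0" by (rule ballI, rule zero) auto
    qed auto
    moreover have "o_diff P n (3 - 2 * int n) (?\<phi> n) = - (\<Sum>p=2..n-1. ?S p)"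
    proof (cases "n = 1")
      case True
      then show ?thesis using linear_on_zero[OF P.vector_space P.subspace P.diff_linear] g0[of 1] by simp
    next
      case False
      then have n2: "2 \<le> n" using n by simp
      let ?y = "\<lambda>p. o_ins L (n - p + 1) (3 - 2 * int (n - p + 1)) p (3 - 2 * int p) 1 (lam (n - p + 1))
          (lam p)"
      have deg: "3 - 2 * int n + 1 = 4 - 2 * int n" by simp
      have y: "?y p \<in> ?c n"
          "?h n (?y p) = ?x n p"
        if p: "p \<in> {2..n-1}" for p
      proof -
        have ar: "n - p + 1 + p - 1 = n" "3 - 2 * int (n - p + 1) + (3 - 2 * int p) = 4 - 2 * int n"
          and ge: "2 \<le> n - p + 1" "2 \<le> p" using p by auto
        show "?y p \<in> ?c n"
          using L.ins_car[OF lc[OF ge(1)] lc[OF ge(2)], of 1] unfolding ar by simp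
        show "?h n (?y p) = ?x n p"
          using h.map_ins[OF lc[OF ge(1)] lc[OF ge(2)], of 1] unfolding ar g2[OF ge(1)] g2[OF ge(2)] by simp
      qed
      have perm: "\<sigma> permutes {1..n}" if "p \<in> {2..n-1}" "\<sigma> \<in> Sh p (n - p)" for p \<sigma>
        by (rule permutes_le[OF Sh_permutes[OF that(2)]]) (use that in auto)
      have ay: "?B n \<sigma> (?y p) \<in> ?c n" if "p \<in> {2..n-1}" "\<sigma> \<in> Sh p (n - p)" for p \<sigma>
        by (rule L.act_car[OF perm[OF that] y(1)[OF that(1)]])
      have say: "(\<Sum>\<sigma>\<in>Sh p (n - p). ?B n \<sigma> (?y p)) \<in> ?c n" if "p \<in> {2..n-1}" for p
        by (rule L.car_sum) (rule ay[OF that])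
      have ssay: "(\<Sum>p=2..n-1. \<Sum>\<sigma>\<in>Sh p (n - p). ?B n \<sigma> (?y p)) \<in> ?c n"
        by (rule L.car_sum) (rule say)
      have "o_diff P n (3 - 2 * int n) (?\<phi> n) = ?h n (o_diff L n (3 - 2 * int n) (lam n))"
        using h.map_diff[OF lc[OF n2]] unfolding deg g2[OF n2] by simp
      also have "\<dots> = - ?h n (\<Sum>p=2..n-1. \<Sum>\<sigma>\<in>Sh p (n - p). ?B n \<sigma> (?y p))"
        unfolding L.diff_lam[OF n2] by (rule hlin(2)[OF ssay])
      also have "?h n (\<Sum>p=2..n-1. \<Sum>\<sigma>\<in>Sh p (n - p). ?B n \<sigma> (?y p)) =
          (\<Sum>p=2..n-1. ?h n (\<Sum>\<sigma>\<in>Sh p (n - p). ?B n \<sigma> (?y p)))"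
        by (rule hlin(5)) (rule say)
      also have "\<dots> = (\<Sum>p=2..n-1. ?S p)"
      proof (rule sum.cong[OF refl])
        fix p assume p: "p \<in> {2..n-1}"
        have "?h n (\<Sum>\<sigma>\<in>Sh p (n - p). ?B n \<sigma> (?y p)) =
            (\<Sum>\<sigma>\<in>Sh p (n - p). ?h n (?B n \<sigma> (?y p)))"
          by (rule hlin(5)) (rule ay[OF p])
        also have "\<dots> = ?S p"
          by (rule sum.cong[OF refl]) (simp only: h.map_act[OF y(1)[OF p] perm[OF p]] y(2)[OF p])
        finally show "?h n (\<Sum>\<sigma>\<in>Sh p (n - p). ?B n \<sigma> (?y p)) = ?S p" .
      qed
      finally show ?thesis .
    qed
    ultimately show ?thesis by simp
  qed
  show ?thesis
    by unfold_locales (use inv g0 diff in auto)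
qed

theorem theorem3p10:
  fixes L :: "('k::field_char_0, 'l::ab_group_add) operad"
    and lam :: "nat \<Rightarrow> 'l"
    and P :: "('k, 'o::ab_group_add) operad"
    and \<phi>hat :: "nat \<Rightarrow> int \<Rightarrow> 'l \<Rightarrow> 'o"
  assumes "Lambda_Lie_infty L lam"
    and "dg_operad P"
    and "dg_operad_map L P \<phi>hat"
  shows "isomorphic_categories
    (Alg_filtr_Tw P (generator_images \<phi>hat lam) ::
      (('k, 'v::ab_group_add) filtered_cochains \<times> (nat \<Rightarrow> 'o, 'v) structure_map, int \<Rightarrow> 'v \<Rightarrow> 'v) cat)
    (Alg_MC P (generator_images \<phi>hat lam) ::
      (('k, 'v) filtered_cochains \<times> ('o, 'v) structure_map \<times> 'v, int \<Rightarrow> 'v \<Rightarrow> 'v) cat)"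
proof -
  define \<phi> where "\<phi> = generator_images \<phi>hat lam"
  let ?C = "Alg_filtr_Tw P \<phi> ::
      (('k, 'v) filtered_cochains \<times> (nat \<Rightarrow> 'o, 'v) structure_map, int \<Rightarrow> 'v \<Rightarrow> 'v) cat"
    and ?D = "Alg_MC P \<phi> :: (('k, 'v) filtered_cochains \<times> ('o, 'v) structure_map \<times> 'v, int \<Rightarrow> 'v \<Rightarrow> 'v) cat"
  interpret twisting P \<phi> unfolding \<phi>_def by (rule generator_images_twisting[OF assms])
  have tw: "filtered_tw_algebra P \<phi> V \<rho> \<Longrightarrow> tw_algebra P \<phi> V \<rho>"
    for V :: "('k, 'v) filtered_cochains" and \<rho>
    by (simp add: tw_algebra_def twisting_axioms tw_algebra_axioms_def)
  have mc: "compatible_algebra P V \<rho> \<and> maurer_cartan \<phi> V \<rho> \<alpha> \<Longrightarrow> mc_algebra P \<phi> V \<rho> \<alpha>"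
    for V :: "('k, 'v) filtered_cochains" and \<rho> \<alpha>
    by unfold_locales (auto simp: maurer_cartan_def)
  have tw_cc: "filtered_tw_algebra P \<phi> V \<rho> \<Longrightarrow> cochain_complex V"
    and mc_cc: "compatible_algebra P V \<rho>' \<Longrightarrow> cochain_complex V"
    for V :: "('k, 'v) filtered_cochains" and \<rho> \<rho>'
    by (simp_all add: filtered_tw_algebra_def compatible_algebra_def complete_filtered_complex_def)
  have C: "category ?C"
  proof (rule category.intro)
    fix X assume "X \<in> Obj ?C"
    then obtain V \<rho> where X: "X = (V, \<rho>)" and a: "filtered_tw_algebra P \<phi> V \<rho>"
      by (auto simp: Alg_filtr_Tw_def)
    interpret X: tw_algebra P \<phi> V \<rho> by (rule tw[OF a])
    have "filtered_algebra_map (Tw P \<phi>) V \<rho> V \<rho> (ident_map V)"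
      by (rule filtered_algebra_map_ident[OF X.V.cochain_complex_axioms])
        (use X.rho_car X.V.filt_car in \<open>simp_all add: Tw_def\<close>)
    then show "Ident ?C X \<in> Hom ?C X X" by (simp add: X Alg_filtr_Tw_def)
  qed (auto simp: Alg_filtr_Tw_def intro: filtered_algebra_map_comp filtered_algebra_map_ident_unit tw_cc)
  have D: "category ?D"
  proof (rule category.intro)
    fix X assume "X \<in> Obj ?D"
    then obtain V \<rho> \<alpha> where X: "X = (V, \<rho>, \<alpha>)" and a: "compatible_algebra P V \<rho> \<and> maurer_cartan \<phi> V \<rho> \<alpha>"
      by (auto simp: Alg_MC_def)
    interpret X: mc_algebra P \<phi> V \<rho> \<alpha> by (rule mc[OF a])
    have "filtered_algebra_map P V \<rho> V \<rho> (ident_map V)"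
      by (rule filtered_algebra_map_ident[OF X.V.cochain_complex_axioms])
          (use X.rho_car X.V.filt_car in simp_all)
    then show "Ident ?D X \<in> Hom ?D X X" using X.alpha_car by (simp add: X Alg_MC_def ident_map_def)
  qed (auto simp: Alg_MC_def intro: filtered_algebra_map_comp filtered_algebra_map_ident_unit mc_cc)
  define F :: "('k, 'v) filtered_cochains \<times> (nat \<Rightarrow> 'o, 'v) structure_map \<Rightarrow> ('k, 'v) filtered_cochains \<times>
      ('o, 'v) structure_map \<times> 'v"
    where "F = (\<lambda>(V, \<rho>). (untwisted_complex \<phi> V \<rho>, untwisted_map \<rho>, untwisted_point P \<rho>))"
  define F' where "F' = (\<lambda>(V :: ('k, 'v) filtered_cochains, \<rho>, \<alpha>).
      (mc_algebra.twisted_complex P \<phi> V \<rho> \<alpha>, pointed_algebra.twisted P V \<rho> \<alpha>))"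
  have FF': "F X \<in> Obj ?D" "F' (F X) = X" if "X \<in> Obj ?C" for X
  proof -
    obtain V \<rho> where X: "X = (V, \<rho>)" and a: "filtered_tw_algebra P \<phi> V \<rho>"
      using \<open>X \<in> Obj ?C\<close> by (auto simp: Alg_filtr_Tw_def)
    interpret X: tw_algebra P \<phi> V \<rho> by (rule tw[OF a])
    show "F X \<in> Obj ?D" using X.untwisted_compatible X.untwisted_mc by (simp add: X F_def Alg_MC_def)
    show "F' (F X) = X" by (simp add: X F_def F'_def X.twisted_complex_untwisted X.twisted_untwisted)
  qed
  have F'F: "F' X \<in> Obj ?C" "F (F' X) = X" if "X \<in> Obj ?D" for X
  proof -
    obtain V \<rho> \<alpha> where X: "X = (V, \<rho>, \<alpha>)" and a: "compatible_algebra P V \<rho> \<and> maurer_cartan \<phi> V \<rho> \<alpha>"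
      using \<open>X \<in> Obj ?D\<close> by (auto simp: Alg_MC_def)
    interpret X: mc_algebra P \<phi> V \<rho> \<alpha> by (rule mc[OF a])
    show "F' X \<in> Obj ?C" using X.twisted_algebra by (simp add: X F'_def Alg_filtr_Tw_def)
    show "F (F' X) = X"
      by (simp add: X F_def F'_def X.untwisted_complex_twisted X.untwisted_map_twisted X.untwisted_point_twisted)
  qed
  have hom: "Hom ?C X Y = Hom ?D (F X) (F Y)" if XY: "X \<in> Obj ?C" "Y \<in> Obj ?C" for X Y
  proof -
    obtain V \<rho> where X: "X = (V, \<rho>)" and a: "filtered_tw_algebra P \<phi> V \<rho>"
      using XY(1) by (auto simp: Alg_filtr_Tw_def)
    obtain W \<rho>' where Y: "Y = (W, \<rho>')" and b: "filtered_tw_algebra P \<phi> W \<rho>'"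
      using XY(2) by (auto simp: Alg_filtr_Tw_def)
    show ?thesis
      by (auto simp: X Y F_def Alg_filtr_Tw_def Alg_MC_def tw_algebra_map_iff[OF tw[OF a] tw[OF b]])
  qed
  have "category_isomorphism ?C ?D F (\<lambda>_ _ f. f)"
  proof (intro category_isomorphism.intro C D category_isomorphism_axioms.intro)
    show "bij_betw F (Obj ?C) (Obj ?D)"
      by (rule bij_betw_byWitness[where f' = F']) (use FF' F'F in auto)
    show "bij_betw (\<lambda>f. f) (Hom ?C X Y) (Hom ?D (F X) (F Y))" if "X \<in> Obj ?C" "Y \<in> Obj ?C" for X Y
      unfolding hom[OF that] by (simp add: bij_betw_def)
    show "Ident ?C X = Ident ?D (F X)" for X
      by (cases X) (simp add: F_def Alg_filtr_Tw_def Alg_MC_def ident_map_def fun_eq_iff)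
    show "Comp ?C X Y Z g f = Comp ?D (F X) (F Y) (F Z) g f" for X Y Z f g
      by (simp add: Alg_filtr_Tw_def Alg_MC_def)
  qed
  then show ?thesis unfolding isomorphic_categories_def \<phi>_def by blast
qed


end
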